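(* Let $G_0\in\mathcal{G}\mathcal{H}_\mu(\overline{\mathbb{R}})^{n\times n}$ have a right factorization $G_0=G_0^-\Lambda G_0^+$ with partial indices $\varkappa_1\ge\dots\ge\varkappa_n$, and let $G_\varepsilon=G_0+\varepsilon N_\varepsilon$, where $N_\varepsilon\in\mathcal{H}_\mu(\overline{\mathbb{R}})^{n\times n}$ is bounded in the $\mathcal{H}_\mu$-norm uniformly for $\varepsilon\in(0,\varepsilon_0)$. Put $M_0=(m_{lj})_{l,j=1}^n:=(G_0^-)^{-1}N_\varepsilon(G_0^+)^{-1}$. Fix $\varepsilon$. Then the boundary value problem $$N^-_{1,\varepsilon}(x)\Lambda^-(x)G_0^+(x)+G_0^-(x)\Lambda^+(x)N^+_{1,\varepsilon}(x)=N_\varepsilon(x),\qquad x\in\mathbb{R},$$ has a solution with $N^\pm_{1,\varepsilon}$ continuous and bounded on $\overline{\Pi^\pm}$ and analytic in $\Pi^\pm$ if and only if all of the following hold: (a) for every $l\le p$ with $\varkappa_l\ge2$ and every $j$: $\int_{-\infty}^{\infty}\frac{m_{lj}(\tau)\,d\tau}{(\tau-i)^{r+1}}=0$ for $r=1,\dots,\varkappa_l-1$; (b) for every $j\ge q+1$ with $\varkappa_j\le-2$ and every $l$: $\int_{-\infty}^{\infty}\frac{m_{lj}(\tau)\,d\tau}{(\tau+i)^{r+1}}=0$ for $r=1,\dots,-\varkappa_j-1$; (c) for every $l\le p$ and $j\ge q+1$: $\int_{-\infty}^{\infty}\frac{m_{lj}(\tau)\,d\tau}{\tau^2+1}=0$.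 Moreover, if (a)–(c) hold for all $\varepsilon\in(0,\varepsilon_0)$, then such solutions $N^\pm_{1,\varepsilon}$ can be chosen bounded uniformly in $\varepsilon$, and there is $\varepsilon_1>0$ such that for $\varepsilon\in(0,\varepsilon_1)$ the matrices $F^-_\varepsilon:=G_0^-+\varepsilon N^-_{1,\varepsilon}(\Lambda^+)^{-1}$ and $F^+_\varepsilon:=G_0^++\varepsilon(\Lambda^-)^{-1}N^+_{1,\varepsilon}$ are analytic in $\Pi^\mp$… more precisely $F^\pm_\varepsilon$ are analytic in $\Pi^\pm$, continuous, bounded and invertible with bounded inverses on $\overline{\Pi^\pm}$, and $\sup_{x\in\mathbb{R}}\|G_\varepsilon(x)-F^-_\varepsilon(x)\Lambda(x)F^+_\varepsilon(x)\|=O(\varepsilon^2)$ as $\varepsilon\to0$; in particular $F^-_\varepsilon\Lambda F^+_\varepsilon$ has the same partial indices as $G_0$.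
   Context: $\Pi^+=\{\operatorname{Im}z>0\}$, $\Pi^-=\{\operatorname{Im}z<0\}$, $b(x)=\frac{x-i}{x+i}$. $\mathcal{H}_\mu(\overline{\mathbb{R}})^{n\times n}$ denotes $n\times n$ matrix functions whose entries are bounded and Hölder continuous with exponent $\mu\in(0,1)$ on $\mathbb{R}\cup\{\infty\}$; $\mathcal{G}$ indicates pointwise invertibility with inverse in the same class. A right factorization of $G_0$ is $G_0=G_0^-\Lambda G_0^+$ on $\mathbb{R}$, with $G_0^\pm,(G_0^\pm)^{-1}$ continuous and bounded on $\overline{\Pi^\pm}$ and analytic in $\Pi^\pm$, and $\Lambda=\operatorname{diag}(b^{\varkappa_1},\dots,b^{\varkappa_n})$, $\varkappa_1\ge\dots\ge\varkappa_n$ integers. Here $p$ is the number of indices with $\varkappa_j>0$ (so $\varkappa_j>0$ iff $j\le p$) and $q$ the number with $\varkappa_j\ge0$ (so $\varkappa_j<0$ iff $j\ge q+1$). $\Lambda^+:=\operatorname{diag}(b^{\max(\varkappa_1,0)},\dots,b^{\max(\varkappa_n,0)})$ and $\Lambda^-:=\operatorname{diag}(b^{\min(\varkappa_1,0)},\dots,b^{\min(\varkappa_n,0)})$, so $\Lambda=\Lambda^+\Lambda^-$. *)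

theory Defs
  imports "HOL-Analysis.Analysis"
begin

type_synonym 'n cmat = "complex ^ 'n ^ 'n"

definition bfun :: "complex \<Rightarrow> complex" where
  "bfun z = (z - \<i>) / (z + \<i>)"

definition diag_b :: "('n::finite \<Rightarrow> int) \<Rightarrow> complex \<Rightarrow> 'n cmat" where
  "diag_b k z = (\<chi> i j. if i = j then bfun z powi k i else 0)"

definition Lam :: "('n::finite \<Rightarrow> int) \<Rightarrow> complex \<Rightarrow> 'n cmat" where
  "Lam k = diag_b k"
definition Lam_plus :: "('n::finite \<Rightarrow> int) \<Rightarrow> complex \<Rightarrow> 'n cmat" where
  "Lam_plus k = diag_b (\<lambda>i. max (k i) 0)"
definition Lam_minus :: "('n::finite \<Rightarrow> int) \<Rightarrow> complex \<Rightarrow> 'n cmat" where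
  "Lam_minus k = diag_b (\<lambda>i. min (k i) 0)"
definition Lam_plus_inv :: "('n::finite \<Rightarrow> int) \<Rightarrow> complex \<Rightarrow> 'n cmat" where
  "Lam_plus_inv k = diag_b (\<lambda>i. - max (k i) 0)"
definition Lam_minus_inv :: "('n::finite \<Rightarrow> int) \<Rightarrow> complex \<Rightarrow> 'n cmat" where
  "Lam_minus_inv k = diag_b (\<lambda>i. - min (k i) 0)"

text \<open>Hoelder estimate on the one-point compactified real line, measured in the
  chordal metric |b(x) - b(y)| (i.e. Hoelder continuity of the transplanted
  function on the unit circle), with bound K for both sup norm and Hoelder seminorm.\<close>
definition hoelder_bounded :: "real \<Rightarrow> real \<Rightarrow> (real \<Rightarrow> 'n::finite cmat) \<Rightarrow> bool" where
  "hoelder_bounded \<mu> K f \<longleftrightarrow>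
     (\<forall>x. norm (f x) \<le> K) \<and>
     (\<forall>x y. norm (f x - f y) \<le> K * (cmod (bfun (of_real x) - bfun (of_real y))) powr \<mu>)"

definition hoelder :: "real \<Rightarrow> (real \<Rightarrow> 'n::finite cmat) \<Rightarrow> bool" where
  "hoelder \<mu> f \<longleftrightarrow> (\<exists>K. hoelder_bounded \<mu> K f)"

definition inv_hoelder :: "real \<Rightarrow> (real \<Rightarrow> 'n::finite cmat) \<Rightarrow> bool" where
  "inv_hoelder \<mu> f \<longleftrightarrow> hoelder \<mu> f \<and> (\<forall>x. invertible (f x)) \<and> hoelder \<mu> (\<lambda>x. matrix_inv (f x))"

definition upper_hp :: "complex set" where "upper_hp = {z. 0 < Im z}"
definition upper_cl :: "complex set" where "upper_cl = {z. 0 \<le> Im z}"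
definition lower_hp :: "complex set" where "lower_hp = {z. Im z < 0}"
definition lower_cl :: "complex set" where "lower_cl = {z. Im z \<le> 0}"

definition cont_bdd_analytic :: "complex set \<Rightarrow> complex set \<Rightarrow> (complex \<Rightarrow> 'n::finite cmat) \<Rightarrow> bool" where
  "cont_bdd_analytic U C F \<longleftrightarrow>
     continuous_on C F \<and> bounded (F ` C) \<and> (\<forall>i j. (\<lambda>z. F z $ i $ j) holomorphic_on U)"

definition plus_fun :: "(complex \<Rightarrow> 'n::finite cmat) \<Rightarrow> bool" where
  "plus_fun F \<longleftrightarrow> cont_bdd_analytic upper_hp upper_cl F"
definition minus_fun :: "(complex \<Rightarrow> 'n::finite cmat) \<Rightarrow> bool" where
  "minus_fun F \<longleftrightarrow> cont_bdd_analytic lower_hp lower_cl F"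

definition plus_factor :: "(complex \<Rightarrow> 'n::finite cmat) \<Rightarrow> bool" where
  "plus_factor F \<longleftrightarrow> plus_fun F \<and> (\<forall>z\<in>upper_cl. invertible (F z)) \<and> plus_fun (\<lambda>z. matrix_inv (F z))"
definition minus_factor :: "(complex \<Rightarrow> 'n::finite cmat) \<Rightarrow> bool" where
  "minus_factor F \<longleftrightarrow> minus_fun F \<and> (\<forall>z\<in>lower_cl. invertible (F z)) \<and> minus_fun (\<lambda>z. matrix_inv (F z))"

definition right_factorization ::
  "(real \<Rightarrow> 'n::{finite,linorder} cmat) \<Rightarrow> (complex \<Rightarrow> 'n cmat) \<Rightarrow> (complex \<Rightarrow> 'n cmat) \<Rightarrow> ('n \<Rightarrow> int) \<Rightarrow> bool" where
  "right_factorization G Gm Gp k \<longleftrightarrow>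
     minus_factor Gm \<and> plus_factor Gp \<and> (\<forall>i j. i \<le> j \<longrightarrow> k j \<le> k i) \<and>
     (\<forall>x::real. G x = Gm (of_real x) ** Lam k (of_real x) ** Gp (of_real x))"

definition cond_a :: "('n::finite \<Rightarrow> int) \<Rightarrow> (real \<Rightarrow> 'n cmat) \<Rightarrow> bool" where
  "cond_a k M \<longleftrightarrow> (\<forall>l j. \<forall>r::nat. 2 \<le> k l \<and> 1 \<le> r \<and> int r \<le> k l - 1 \<longrightarrow>
      integral UNIV (\<lambda>\<tau>::real. M \<tau> $ l $ j / (of_real \<tau> - \<i>) ^ (r + 1)) = 0)"
definition cond_b :: "('n::finite \<Rightarrow> int) \<Rightarrow> (real \<Rightarrow> 'n cmat) \<Rightarrow> bool" where
  "cond_b k M \<longleftrightarrow> (\<forall>l j. \<forall>r::nat. k j \<le> -2 \<and> 1 \<le> r \<and> int r \<le> - k j - 1 \<longrightarrow>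
      integral UNIV (\<lambda>\<tau>::real. M \<tau> $ l $ j / (of_real \<tau> + \<i>) ^ (r + 1)) = 0)"
definition cond_c :: "('n::finite \<Rightarrow> int) \<Rightarrow> (real \<Rightarrow> 'n cmat) \<Rightarrow> bool" where
  "cond_c k M \<longleftrightarrow> (\<forall>l j. 0 < k l \<and> k j < 0 \<longrightarrow>
      integral UNIV (\<lambda>\<tau>::real. M \<tau> $ l $ j / of_real (\<tau>\<^sup>2 + 1)) = 0)"

definition solves_bvp ::
  "('n::finite \<Rightarrow> int) \<Rightarrow> (complex \<Rightarrow> 'n cmat) \<Rightarrow> (complex \<Rightarrow> 'n cmat) \<Rightarrow> (real \<Rightarrow> 'n cmat)
   \<Rightarrow> (complex \<Rightarrow> 'n cmat) \<Rightarrow> (complex \<Rightarrow> 'n cmat) \<Rightarrow> bool" where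
  "solves_bvp k Gm Gp N N1m N1p \<longleftrightarrow>
     minus_fun N1m \<and> plus_fun N1p \<and>
     (\<forall>x::real. N1m (of_real x) ** Lam_minus k (of_real x) ** Gp (of_real x)
              + Gm (of_real x) ** Lam_plus k (of_real x) ** N1p (of_real x) = N x)"

end

theory Submission
  imports Defs "HOL-Complex_Analysis.Cauchy_Integral_Formula"
begin

text \<open>
  The Cayley transform \<open>t = b x\<close> moves the problem to the unit circle; there the minus functions,
  reflected by \<open>x \<mapsto> - x\<close>, that is \<open>t \<mapsto> 1 / t\<close>, become functions on the disc as well. After
  multiplication by the inverse factors the boundary value problem decouples into scalar problems
  \<open>m = t ^ a * u t + t ^ (- c) * v (1 / t)\<close> with \<open>u\<close>, \<open>v\<close> analytic in the disc, where \<open>a\<close> is the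
  positive part of a row index and \<open>c\<close> the negative part of a column index. Such a problem is
  solvable iff the Fourier coefficients of \<open>m\<close> strictly between \<open>- c\<close> and \<open>a\<close> vanish, and these are
  the conditions (a), (b), (c). The solutions are Cauchy integrals of \<open>m\<close>. They are bounded and
  continuous up to the circle by the Hardy-Littlewood theorem, provided that \<open>m\<close> is Hoelder.

  The factors are only known to be bounded and continuous, so the Hoelder property of \<open>m\<close> has to be
  proved: an entry \<open>f\<close> of an inverse factor satisfies
  \<open>t ^ k * f t = (\<Sum>i. h i (1 / t) * g i t)\<close> with Hoelder \<open>g i\<close> and bounded analytic \<open>h i\<close>. In the
  Cauchy formula for the derivative of \<open>f\<close> the values \<open>g i t\<close> may be replaced by differences
  \<open>g i t - g i t0\<close> up to a bounded error, which again gives a Hardy-Littlewood bound.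
\<close>

section \<open>Bounded functions on the punctured circle and on the disc\<close>

text \<open>Boundedness and continuity on a closed half-plane imply no limit at infinity, so on the
  circle the point 1 is lost: boundary functions live on \<open>sphere 0 1 - {1}\<close>, and
  boundedness has to compensate for the missing value. Cauchy's formula is therefore established for
  such functions. The Hoelder property of \<open>m\<close> is essential, since the Cauchy integral
  of a merely bounded continuous function can be unbounded. Its source is the factorization itself:
  solving \<open>G0 = Gm ** Lam ** Gp\<close> for \<open>matrix_inv Gp\<close> times the inverse of
  \<open>Lam\<close> leaves \<open>matrix_inv G0 ** Gm\<close>, that is, Hoelder entries paired with
  functions analytic on the other side. The inverse of \<open>Gm\<close> is treated in the same way.
  Half of the exponent is lost, but any positive exponent suffices for the scalar problems. All
  estimates are linear in the Hoelder constant of \<open>N\<close>, with factors that do not depend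
  on \<open>N\<close>; this is what makes the solutions bounded uniformly in \<epsilon>.\<close>

definition circle_fun :: "(complex \<Rightarrow> 'a::real_normed_vector) \<Rightarrow> bool" where
  "circle_fun g \<longleftrightarrow> continuous_on (sphere 0 1 - {1}) g \<and> bounded (g ` (sphere 0 1 - {1}))"

definition disc_fun :: "(complex \<Rightarrow> complex) \<Rightarrow> bool" where
  "disc_fun f \<longleftrightarrow> continuous_on (cball 0 1 - {1}) f \<and> f holomorphic_on ball 0 1
     \<and> bounded (f ` (cball 0 1 - {1}))"

text \<open>Normalized arc length in the parameter \<open>s\<close>. The open interval keeps
  \<open>cis (2 * pi * s)\<close> away from 1, where the functions carry no information.\<close>

definition circle_mean :: "(complex \<Rightarrow> 'a::real_normed_vector) \<Rightarrow> 'a" where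
  "circle_mean g = integral {0<..<1} (\<lambda>s. g (cis (2 * pi * s)))"

lemma cis_in_punctured_circle:
  assumes "s \<in> {0<..<1}"
  shows "cis (2 * pi * s) \<in> sphere 0 1 - {1}"
proof -
  have "cis (2 * pi * s) \<noteq> 1"
  proof
    assume "cis (2 * pi * s) = 1"
    then have "cos (2 * pi * s) = 1"
      by (metis cis.simps(1) one_complex.sel(1))
    then obtain n :: int where "2 * pi * s = of_int n * 2 * pi"
      by (auto simp: cos_one_2pi_int)
    then have "s = of_int n" by simp
    with assms show False by auto
  qed
  then show ?thesis by simp
qed

lemma circle_fun_absolutely_integrable:
  fixes g :: "complex \<Rightarrow> 'a::euclidean_space"
  assumes "circle_fun g"
  shows "(\<lambda>s. g (cis (2 * pi * s))) absolutely_integrable_on {0<..<1}"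
proof -
  obtain B where B: "\<And>t. t \<in> sphere 0 1 - {1} \<Longrightarrow> norm (g t) \<le> B"
    using assms unfolding circle_fun_def bounded_iff by blast
  show ?thesis
  proof (rule measurable_bounded_by_integrable_imp_absolutely_integrable)
    have "continuous_on {0<..<1} (\<lambda>s. g (cis (2 * pi * s)))"
    proof (rule continuous_on_compose2[where g=g and t="sphere 0 1 - {1}"])
      show "continuous_on (sphere 0 1 - {1}) g" using assms by (simp add: circle_fun_def)
      show "continuous_on {0<..<1} (\<lambda>s. cis (2 * pi * s))" by (intro continuous_intros)
      show "(\<lambda>s. cis (2 * pi * s)) ` {0<..<1} \<subseteq> sphere 0 1 - {1}"
        by (rule image_subsetI) (rule cis_in_punctured_circle)
    qed
    then show "(\<lambda>s. g (cis (2 * pi * s))) \<in> borel_measurable (lebesgue_on {0<..<1})"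
      by (intro continuous_imp_measurable_on_sets_lebesgue) auto
    show "(\<lambda>s. B) integrable_on {0<..<1::real}" 
      using integrable_on_open_interval_real[of "\<lambda>s. B" 0 1] integrable_const_ivl by blast
    show "norm (g (cis (2 * pi * s))) \<le> B" if "s \<in> {0<..<1}" for s
      by (rule B[OF cis_in_punctured_circle[OF that]])
  qed auto
qed

lemma circle_fun_integrable:
  fixes g :: "complex \<Rightarrow> 'a::euclidean_space"
  assumes "circle_fun g"
  shows "(\<lambda>s. g (cis (2 * pi * s))) integrable_on {0<..<1}"
  using circle_fun_absolutely_integrable[OF assms] set_lebesgue_integral_eq_integral(1) by blast

lemma circle_fun_const: "circle_fun (\<lambda>t. c)"
  by (auto simp: circle_fun_def bounded_iff)

lemma circle_fun_continuous:
  assumes "continuous_on (sphere 0 1) g"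
  shows "circle_fun g"
  unfolding circle_fun_def
proof
  show "continuous_on (sphere 0 1 - {1}) g"
    using assms continuous_on_subset by blast
  have "bounded (g ` sphere 0 1)"
    by (intro compact_imp_bounded compact_continuous_image assms compact_sphere)
  then show "bounded (g ` (sphere 0 1 - {1}))" by (rule bounded_subset) auto
qed

lemma circle_fun_add:
  assumes "circle_fun f" "circle_fun g"
  shows "circle_fun (\<lambda>t. f t + g t)"
  using assms by (auto simp: circle_fun_def intro!: continuous_intros bounded_plus_comp)

lemma circle_fun_diff:
  assumes "circle_fun f" "circle_fun g"
  shows "circle_fun (\<lambda>t. f t - g t)"
  using assms by (auto simp: circle_fun_def intro!: continuous_intros bounded_minus_comp)

lemma bounded_image_mult:
  fixes f g :: "'b \<Rightarrow> 'a::real_normed_algebra"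
  assumes "bounded (f ` S)" "bounded (g ` S)"
  shows "bounded ((\<lambda>t. f t * g t) ` S)"
proof -
  obtain A B where A: "\<And>t. t \<in> S \<Longrightarrow> norm (f t) \<le> A" and B: "\<And>t. t \<in> S \<Longrightarrow> norm (g t) \<le> B"
    using assms unfolding bounded_iff by blast
  have "norm (f t * g t) \<le> A * B" if "t \<in> S" for t
    by (rule order_trans[OF norm_mult_ineq])
       (meson A B mult_mono norm_ge_zero order_trans that)
  then show ?thesis unfolding bounded_iff by blast
qed

lemma circle_fun_mult:
  fixes f g :: "complex \<Rightarrow> 'a::real_normed_algebra"
  assumes "circle_fun f" "circle_fun g"
  shows "circle_fun (\<lambda>t. f t * g t)"
  using assms by (auto simp: circle_fun_def intro!: continuous_intros bounded_image_mult)

lemma circle_fun_sum: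
  assumes "\<And>i. i \<in> I \<Longrightarrow> circle_fun (f i)"
  shows "circle_fun (\<lambda>t. \<Sum>i\<in>I. f i t)"
  using assms
  by (induction I rule: infinite_finite_induct) (auto intro: circle_fun_add circle_fun_const)

lemma inverse_punctured_circle:
  "t \<in> sphere 0 1 - {1::complex} \<Longrightarrow> inverse t \<in> sphere 0 1 - {1}"
  by (auto simp: norm_inverse)

lemma circle_fun_inverse:
  assumes "circle_fun g"
  shows "circle_fun (\<lambda>t. g (inverse t))"
  unfolding circle_fun_def
proof
  show "continuous_on (sphere 0 1 - {1}) (\<lambda>t. g (inverse t))"
  proof (rule continuous_on_compose2[where g=g and t="sphere 0 1 - {1}"])
    show "continuous_on (sphere 0 1 - {1}) g" using assms by (simp add: circle_fun_def)
    show "continuous_on (sphere 0 1 - {1::complex}) inverse" by (intro continuous_intros) auto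
    show "inverse ` (sphere 0 1 - {1::complex}) \<subseteq> sphere 0 1 - {1}"
      by (rule image_subsetI) (rule inverse_punctured_circle)
  qed
  have "(\<lambda>t. g (inverse t)) ` (sphere 0 1 - {1}) \<subseteq> g ` (sphere 0 1 - {1})"
    using inverse_punctured_circle by (intro image_subsetI imageI)
  then show "bounded ((\<lambda>t. g (inverse t)) ` (sphere 0 1 - {1}))"
    using assms bounded_subset unfolding circle_fun_def by blast
qed

lemma disc_fun_circle_fun: "disc_fun f \<Longrightarrow> circle_fun f"
  unfolding disc_fun_def circle_fun_def
  by (auto elim!: continuous_on_subset bounded_subset)

lemma circle_mean_cong:
  assumes "\<And>t. t \<in> sphere 0 1 - {1} \<Longrightarrow> f t = g t"
  shows "circle_mean f = circle_mean g"
  unfolding circle_mean_def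
  by (intro integral_cong assms cis_in_punctured_circle)

lemma circle_mean_const: "circle_mean (\<lambda>t. c) = (c::'a::euclidean_space)"
  unfolding circle_mean_def by (simp flip: integral_open_interval_real)

lemma circle_mean_add:
  fixes f g :: "complex \<Rightarrow> 'a::euclidean_space"
  assumes "circle_fun f" "circle_fun g"
  shows "circle_mean (\<lambda>t. f t + g t) = circle_mean f + circle_mean g"
  unfolding circle_mean_def by (intro integral_add circle_fun_integrable assms)

lemma circle_mean_diff:
  fixes f g :: "complex \<Rightarrow> 'a::euclidean_space"
  assumes "circle_fun f" "circle_fun g"
  shows "circle_mean (\<lambda>t. f t - g t) = circle_mean f - circle_mean g"
  unfolding circle_mean_def by (intro integral_diff circle_fun_integrable assms)

lemma circle_mean_cmult:
  fixes f :: "complex \<Rightarrow> complex"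
  shows "circle_mean (\<lambda>t. c * f t) = c * circle_mean f"
  unfolding circle_mean_def by (rule integral_mult_right)

lemma circle_mean_sum:
  fixes f :: "'i \<Rightarrow> complex \<Rightarrow> 'a::euclidean_space"
  assumes "finite I" "\<And>i. i \<in> I \<Longrightarrow> circle_fun (f i)"
  shows "circle_mean (\<lambda>t. \<Sum>i\<in>I. f i t) = (\<Sum>i\<in>I. circle_mean (f i))"
  unfolding circle_mean_def by (intro integral_sum circle_fun_integrable assms)

lemma circle_mean_norm_le:
  fixes f :: "complex \<Rightarrow> 'a::euclidean_space" and g :: "complex \<Rightarrow> real"
  assumes "circle_fun f" "circle_fun g"
    and "\<And>t. t \<in> sphere 0 1 - {1} \<Longrightarrow> norm (f t) \<le> g t"
  shows "norm (circle_mean f) \<le> circle_mean g"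
  unfolding circle_mean_def
  by (intro integral_norm_bound_integral circle_fun_integrable assms cis_in_punctured_circle)

lemma circle_mean_norm_le_const:
  fixes f :: "complex \<Rightarrow> 'a::euclidean_space"
  assumes "circle_fun f" "\<And>t. t \<in> sphere 0 1 - {1} \<Longrightarrow> norm (f t) \<le> B"
  shows "norm (circle_mean f) \<le> B"
  using circle_mean_norm_le[OF assms(1) circle_fun_const[of B]] assms(2)
  by (simp add: circle_mean_const)

text \<open>The reflection \<open>1 - s\<close> of the parameter preserves the interval and inverts
  \<open>cis (2 * pi * s)\<close>. It lets functions analytic outside the disc be integrated as
  functions analytic inside.\<close>

lemma circle_mean_inverse:
  fixes g :: "complex \<Rightarrow> 'a::euclidean_space"
  assumes "circle_fun g"
  shows "circle_mean (\<lambda>t. g (inverse t)) = circle_mean g"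
proof -
  have img: "(\<lambda>s. 1 - s) ` {0<..<1::real} = {0<..<1}"
  proof
    show "{0<..<1} \<subseteq> (\<lambda>s. 1 - s) ` {0<..<1::real}"
      by (auto intro!: image_eqI[of _ _ "1 - x" for x])
  qed auto
  have "(\<lambda>s. \<bar>-1\<bar> *\<^sub>R g (cis (2 * pi * (1 - s)))) absolutely_integrable_on {0<..<1} \<and>
      integral {0<..<1} (\<lambda>s. \<bar>-1\<bar> *\<^sub>R g (cis (2 * pi * (1 - s)))) = circle_mean g"
    by (subst has_absolute_integral_change_of_variables_real
          [where g="\<lambda>s. 1 - s" and f="\<lambda>s. g (cis (2 * pi * s))" and h="\<lambda>s. -1"])
       (auto intro!: derivative_eq_intros inj_onI circle_fun_absolutely_integrable assms
             simp: img circle_mean_def)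
  moreover have "cis (2 * pi * (1 - s)) = inverse (cis (2 * pi * s))" for s
    by (simp add: right_diff_distrib inverse_eq_divide del: cis_inverse flip: cis_divide)
  ultimately show ?thesis by (simp add: circle_mean_def)
qed

section \<open>Cauchy's formula for bounded analytic functions on the punctured closed disc\<close>

lemma disc_fun_mult: "disc_fun f \<Longrightarrow> disc_fun g \<Longrightarrow> disc_fun (\<lambda>z. f z * g z)"
  unfolding disc_fun_def by (auto intro!: continuous_intros holomorphic_intros bounded_image_mult)

lemma disc_fun_continuous:
  assumes "continuous_on (cball 0 1) f" "f holomorphic_on ball 0 1"
  shows "disc_fun f"
proof -
  have "bounded (f ` cball 0 1)"
    by (intro compact_imp_bounded compact_continuous_image assms compact_cball)
  then have "bounded (f ` (cball 0 1 - {1}))" by (rule bounded_subset) auto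
  then show ?thesis using assms by (auto simp: disc_fun_def intro: continuous_on_subset)
qed

text \<open>Values at the single boundary point 1 are irrelevant: approximate by circles of radius
  tending to 1 and use dominated convergence.\<close>
lemma disc_fun_radial_limit:
  assumes f: "disc_fun f" and k: "continuous_on (sphere 0 1) k"
  defines "r \<equiv> \<lambda>n. 1 - inverse (of_nat (Suc n)) :: real"
  shows "(\<lambda>n. circle_mean (\<lambda>t. f (of_real (r n) * t) * k t)) \<longlonglongrightarrow> circle_mean (\<lambda>t. f t * k t)"
proof -
  obtain B where B: "\<And>t. t \<in> cball 0 1 - {1} \<Longrightarrow> norm (f t) \<le> B"
    using f unfolding disc_fun_def bounded_iff by blast
  have "bounded (k ` sphere 0 1)"
    by (intro compact_imp_bounded compact_continuous_image k compact_sphere)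
  then obtain C where C: "\<And>t. t \<in> sphere 0 1 \<Longrightarrow> norm (k t) \<le> C"
    unfolding bounded_iff by blast
  have r: "0 \<le> r n" "r n < 1" for n by (auto simp: r_def inverse_le_1_iff)
  have rlim: "r \<longlonglongrightarrow> 1"
    unfolding r_def using LIMSEQ_inverse_real_of_nat_add_minus[of 1] by simp
  have rb: "of_real (r n) * t \<in> ball 0 1" if "t \<in> sphere 0 1" for n and t :: complex
    using that r[of n] by (auto simp: norm_mult)
  have cf: "circle_fun (\<lambda>t. f (of_real (r n) * t) * k t)" for n
  proof (intro circle_fun_continuous continuous_intros k)
    show "continuous_on (sphere 0 1) (\<lambda>x. f (of_real (r n) * x))"
      by (rule continuous_on_compose2[where g=f and t="ball 0 1"])
         (use f rb in \<open>auto simp: disc_fun_def intro!: continuous_intros holomorphic_on_imp_continuous_on\<close>)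
  qed
  show ?thesis unfolding circle_mean_def
  proof (rule dominated_convergence(2)[where h="\<lambda>s. B * C"])
    show "(\<lambda>s. f (of_real (r n) * cis (2 * pi * s)) * k (cis (2 * pi * s))) integrable_on {0<..<1}" for n
      using circle_fun_integrable[OF cf] .
    show "(\<lambda>s. B * C) integrable_on {0<..<1::real}"
      using circle_fun_integrable[OF circle_fun_const] .
    fix s :: real assume s: "s \<in> {0<..<1}"
    let ?t = "cis (2 * pi * s)"
    have t: "?t \<in> sphere 0 1 - {1}" using cis_in_punctured_circle[OF s] .
    have m: "of_real (r n) * ?t \<in> cball 0 1 - {1}" for n
      using rb[of ?t n] t by auto
    show "norm (f (of_real (r n) * ?t) * k ?t) \<le> B * C" for n
      unfolding norm_mult using B[OF m[of n]] C[of ?t] t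
      by (intro mult_mono) (auto intro: order_trans[OF norm_ge_zero])
    have "(\<lambda>n. of_real (r n) * ?t) \<longlonglongrightarrow> of_real 1 * ?t"
      by (intro tendsto_intros rlim)
    then have "(\<lambda>n. f (of_real (r n) * ?t)) \<longlonglongrightarrow> f ?t"
      using f m t unfolding disc_fun_def
      by (intro continuous_on_tendsto_compose[where s="cball 0 1 - {1}" and f=f]) auto
    then show "(\<lambda>n. f (of_real (r n) * ?t) * k ?t) \<longlonglongrightarrow> f ?t * k ?t"
      by (intro tendsto_intros)
  qed
qed

text \<open>With \<open>t = cis (2 * pi * s)\<close> one has
  \<open>dt / (2 * pi * \<i>) = t ds\<close>, so \<open>t / (t - z)\<close> is the Cauchy kernel
  with respect to the normalized mean.\<close>

lemma cauchy_formula_circle_mean: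
  assumes "continuous_on (cball 0 1) f" "f holomorphic_on ball 0 1" "z \<in> ball 0 1"
  shows "circle_mean (\<lambda>t. f t * (t / (t - z))) = f z"
proof -
  have "((\<lambda>u. f u/(u - z)) has_contour_integral (2 * of_real pi * \<i> * f z)) (circlepath 0 1)"
    using assms by (intro Cauchy_integral_circlepath) auto
  then have "((\<lambda>s. f (circlepath 0 1 s) / (circlepath 0 1 s - z) *
       (2 * of_real pi * \<i> * exp (2 * of_real pi * \<i> * of_real s))) has_integral 2 * of_real pi * \<i> * f z) {0..1}"
    unfolding has_contour_integral_def
    by (rule has_integral_eq[rotated]) (simp add: vector_derivative_circlepath01)
  moreover have e: "circlepath 0 1 s = cis (2 * pi * s)" "exp (2 * of_real pi * \<i> * of_real s) = cis (2 * pi * s)" for s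
    by (simp_all add: circlepath cis_conv_exp mult_ac)
  ultimately have "((\<lambda>s. (2 * of_real pi * \<i>) * (f (cis (2 * pi * s)) * (cis (2 * pi * s) / (cis (2 * pi * s) - z))))
       has_integral 2 * of_real pi * \<i> * f z) {0<..<1}"
    by (simp add: has_integral_Icc_iff_Ioo mult_ac)
  then show ?thesis
    unfolding circle_mean_def by (subst (asm) has_integral_mult_right_iff) (auto intro: integral_unique)
qed

text \<open>Each dilate \<open>f (r n * t)\<close> is continuous on the whole closed disc and obeys
  the classical formula; both sides converge as the radii tend to 1.\<close>

lemma disc_fun_cauchy:
  assumes f: "disc_fun f" and z: "z \<in> ball 0 1"
  shows "circle_mean (\<lambda>t. f t * (t / (t - z))) = f z"
proof -
  define r where "r = (\<lambda>n. 1 - inverse (of_nat (Suc n)) :: real)"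
  have r: "0 \<le> r n" "r n < 1" for n by (auto simp: r_def inverse_le_1_iff)
  have rlim: "r \<longlonglongrightarrow> 1"
    unfolding r_def using LIMSEQ_inverse_real_of_nat_add_minus[of 1] by simp
  have rb: "of_real (r n) * t \<in> ball 0 1" if "t \<in> cball 0 1" for n and t :: complex
    using that r[of n] mult_less_le_imp_less[of "r n" 1 "norm t" 1]
    by (cases "t = 0") (auto simp: norm_mult)
  have fc: "continuous_on (ball 0 1) f" "f holomorphic_on ball 0 1"
    using f by (auto simp: disc_fun_def intro: holomorphic_on_imp_continuous_on)
  have eq: "circle_mean (\<lambda>t. f (of_real (r n) * t) * (t / (t - z))) = f (of_real (r n) * z)" for n
  proof (rule cauchy_formula_circle_mean[OF _ _ z])
    show "continuous_on (cball 0 1) (\<lambda>t. f (of_real (r n) * t))"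
      by (rule continuous_on_compose2[OF fc(1)]) (use rb in \<open>auto intro!: continuous_intros\<close>)
    show "(\<lambda>t. f (of_real (r n) * t)) holomorphic_on ball 0 1"
      using rb by (intro holomorphic_on_compose_gen[OF _ fc(2), unfolded o_def] holomorphic_intros) auto
  qed
  have "(\<lambda>n. circle_mean (\<lambda>t. f (of_real (r n) * t) * (t / (t - z))))
      \<longlonglongrightarrow> circle_mean (\<lambda>t. f t * (t / (t - z)))"
    unfolding r_def using z by (intro disc_fun_radial_limit f continuous_intros) auto
  moreover have "(\<lambda>n. f (of_real (r n) * z)) \<longlonglongrightarrow> f z"
  proof (rule continuous_on_tendsto_compose[OF fc(1)])
    show "(\<lambda>n. of_real (r n) * z) \<longlonglongrightarrow> z"
      using tendsto_mult[OF tendsto_of_real[OF rlim] tendsto_const[of z]] by simp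
    show "\<forall>\<^sub>F n in sequentially. of_real (r n) * z \<in> ball 0 1"
      using rb z by (intro always_eventually) auto
  qed (use z in auto)
  ultimately show ?thesis unfolding eq using LIMSEQ_unique by blast
qed

text \<open>At \<open>z = 0\<close> the Cauchy kernel is 1, so the mean of
  \<open>t ^ k * f t\<close> is its value at the centre.\<close>

lemma disc_fun_mean_zero:
  assumes f: "disc_fun f" and k: "k \<ge> (1::nat)"
  shows "circle_mean (\<lambda>t. t ^ k * f t) = 0"
proof -
  have "disc_fun (\<lambda>t. t ^ k * f t)"
    by (intro disc_fun_mult f disc_fun_continuous continuous_intros holomorphic_intros)
  from disc_fun_cauchy[OF this, of 0]
  have "circle_mean (\<lambda>t. t ^ k * f t * (t / (t - 0))) = 0" using k by simp
  also have "circle_mean (\<lambda>t. t ^ k * f t * (t / (t - 0))) = circle_mean (\<lambda>t. t ^ k * f t)"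
    by (rule circle_mean_cong) auto
  finally show ?thesis .
qed

section \<open>Hoelder functions and the Cauchy transform\<close>

text \<open>One constant bounds both the values and the Hoelder quotients, so it behaves like a
  norm: sums add it, products multiply it up to a factor 2, and later bounds are linear in
  it.\<close>

definition circle_hoelder :: "real \<Rightarrow> real \<Rightarrow> (complex \<Rightarrow> complex) \<Rightarrow> bool" where
  "circle_hoelder \<alpha> K g \<longleftrightarrow> (\<forall>t\<in>sphere 0 1 - {1}. norm (g t) \<le> K) \<and>
     (\<forall>t\<in>sphere 0 1 - {1}. \<forall>t'\<in>sphere 0 1 - {1}. norm (g t - g t') \<le> K * norm (t - t') powr \<alpha>)"

lemma circle_hoelder_nonneg:
  assumes "circle_hoelder \<alpha> K g"
  shows "0 \<le> K"
proof -
  have "norm (g (-1)) \<le> K" using assms by (auto simp: circle_hoelder_def)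
  then show ?thesis using norm_ge_zero order_trans by blast
qed

lemma circle_hoelder_mono:
  assumes "circle_hoelder \<alpha> K g" "K \<le> K'"
  shows "circle_hoelder \<alpha> K' g"
  using assms unfolding circle_hoelder_def
  by (meson mult_right_mono order_trans powr_ge_zero)

text \<open>Chords have length at most 2, so giving up at most 1 of the exponent costs at most the
  factor \<open>2 powr 1\<close>.\<close>

lemma circle_hoelder_exponent:
  assumes g: "circle_hoelder \<alpha> K g" and "\<alpha>' \<le> \<alpha>" "\<alpha> - \<alpha>' \<le> 1"
  shows "circle_hoelder \<alpha>' (2 * K) g"
proof -
  have K: "0 \<le> K" using circle_hoelder_nonneg[OF g] .
  have *: "norm (t - t') powr \<alpha> \<le> 2 * norm (t - t') powr \<alpha>'" 
    if "t \<in> sphere 0 1 - {1}" "t' \<in> sphere 0 1 - {1}" for t t' :: complex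
  proof -
    have "norm (t - t') \<le> 2" using norm_triangle_ineq4[of t t'] that by simp
    then have "norm (t - t') powr (\<alpha> - \<alpha>') \<le> 2 powr (\<alpha> - \<alpha>')"
      using assms by (intro powr_mono2) auto
    also have "\<dots> \<le> 2 powr 1" using assms by (intro powr_mono) auto
    finally have "norm (t - t') powr \<alpha>' * norm (t - t') powr (\<alpha> - \<alpha>') \<le> norm (t - t') powr \<alpha>' * 2"
      by (intro mult_left_mono) auto
    then show ?thesis by (simp add: mult.commute flip: powr_add)
  qed
  show ?thesis
    unfolding circle_hoelder_def
  proof (intro conjI ballI)
    fix t assume t: "t \<in> sphere 0 1 - {1::complex}"
    show "norm (g t) \<le> 2 * K" using g t K unfolding circle_hoelder_def by force
    fix t' assume t': "t' \<in> sphere 0 1 - {1::complex}"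
    have "norm (g t - g t') \<le> K * norm (t - t') powr \<alpha>"
      using g t t' by (simp add: circle_hoelder_def)
    also have "\<dots> \<le> K * (2 * norm (t - t') powr \<alpha>')"
      by (intro mult_left_mono * t t' K)
    finally show "norm (g t - g t') \<le> 2 * K * norm (t - t') powr \<alpha>'" by simp
  qed
qed

lemma circle_hoelder_mult:
  assumes f: "circle_hoelder \<alpha> K f" and g: "circle_hoelder \<alpha> L g"
  shows "circle_hoelder \<alpha> (2 * K * L) (\<lambda>t. f t * g t)"
proof -
  have K: "0 \<le> K" "0 \<le> L" using circle_hoelder_nonneg f g by auto
  show ?thesis
    unfolding circle_hoelder_def
  proof (intro conjI ballI)
    fix t assume t: "t \<in> sphere 0 1 - {1::complex}"
    have "norm (f t) * norm (g t) \<le> K * L"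
      using f g t K by (intro mult_mono) (auto simp: circle_hoelder_def)
    also have "\<dots> \<le> 2 * K * L" using K by simp
    finally show "norm (f t * g t) \<le> 2 * K * L" by (simp add: norm_mult)
    fix t' assume t': "t' \<in> sphere 0 1 - {1::complex}"
    have "norm (f t * g t - f t' * g t') = norm (f t * (g t - g t') + (f t - f t') * g t')"
      by (simp add: algebra_simps)
    also have "\<dots> \<le> norm (f t) * norm (g t - g t') + norm (f t - f t') * norm (g t')"
      by (metis norm_mult norm_triangle_ineq)
    also have "\<dots> \<le> K * (L * norm (t - t') powr \<alpha>) + (K * norm (t - t') powr \<alpha>) * L"
      using f g t t' K by (intro add_mono mult_mono) (auto simp: circle_hoelder_def)
    finally show "norm (f t * g t - f t' * g t') \<le> 2 * K * L * norm (t - t') powr \<alpha>"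
      by (simp add: algebra_simps)
  qed
qed

lemma circle_hoelder_sum:
  assumes "finite I" "\<And>i. i \<in> I \<Longrightarrow> circle_hoelder \<alpha> (K i) (f i)"
  shows "circle_hoelder \<alpha> (\<Sum>i\<in>I. K i) (\<lambda>t. \<Sum>i\<in>I. f i t)"
  unfolding circle_hoelder_def
proof (intro conjI ballI)
  fix t assume t: "t \<in> sphere 0 1 - {1::complex}"
  show "norm (\<Sum>i\<in>I. f i t) \<le> (\<Sum>i\<in>I. K i)"
    using assms t by (intro sum_norm_le) (auto simp: circle_hoelder_def)
  fix t' assume t': "t' \<in> sphere 0 1 - {1::complex}"
  show "norm ((\<Sum>i\<in>I. f i t) - (\<Sum>i\<in>I. f i t')) \<le> (\<Sum>i\<in>I. K i) * norm (t - t') powr \<alpha>"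
    unfolding sum_subtractf[symmetric] sum_distrib_right
    using assms t t' by (intro sum_norm_le) (auto simp: circle_hoelder_def)
qed

text \<open>On the circle inversion is complex conjugation, hence an isometry, and the constant does
  not change.\<close>

lemma circle_hoelder_inverse:
  assumes g: "circle_hoelder \<alpha> K g"
  shows "circle_hoelder \<alpha> K (\<lambda>t. g (inverse t))"
  unfolding circle_hoelder_def
proof (intro conjI ballI)
  fix t assume t: "t \<in> sphere 0 1 - {1::complex}"
  note it = inverse_punctured_circle[OF t]
  show "norm (g (inverse t)) \<le> K" using g it unfolding circle_hoelder_def by blast
  fix t' assume t': "t' \<in> sphere 0 1 - {1::complex}"
  note it' = inverse_punctured_circle[OF t']
  have "t \<noteq> 0" "t' \<noteq> 0" using t t' by auto
  then have "inverse t - inverse t' = (t' - t) / (t * t')" by (simp add: field_simps)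
  then have "norm (inverse t - inverse t') = norm (t - t')"
    using t t' by (simp add: norm_divide norm_mult norm_minus_commute)
  moreover have "norm (g (inverse t) - g (inverse t')) \<le> K * norm (inverse t - inverse t') powr \<alpha>"
    using g it it' unfolding circle_hoelder_def by blast
  ultimately show "norm (g (inverse t) - g (inverse t')) \<le> K * norm (t - t') powr \<alpha>" by simp
qed

lemma circle_hoelder_power:
  assumes "0 \<le> \<alpha>" "\<alpha> \<le> 1"
  shows "circle_hoelder \<alpha> (2 * real (Suc k)) (\<lambda>t. t ^ k)"
proof -
  \<comment> \<open>\<open>k\<close> is a Lipschitz constant; \<open>Suc k\<close> also dominates
    the values, of norm 1, when \<open>k = 0\<close>.\<close>
  have "circle_hoelder 1 (real (Suc k)) (\<lambda>t. t ^ k)"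
    unfolding circle_hoelder_def
  proof (intro conjI ballI)
    fix t assume t: "t \<in> sphere 0 1 - {1::complex}"
    show "norm (t ^ k) \<le> real (Suc k)" using t by (simp add: norm_power)
    fix t' assume t': "t' \<in> sphere 0 1 - {1::complex}"
    have "norm (t ^ k - t' ^ k) \<le> real k * norm (t - t')"
      using t t' by (intro norm_power_diff) auto
    also have "\<dots> \<le> real (Suc k) * norm (t - t')" by (intro mult_right_mono) auto
    finally show "norm (t ^ k - t' ^ k) \<le> real (Suc k) * norm (t - t') powr 1" by simp
  qed
  from circle_hoelder_exponent[OF this, of \<alpha>] assms show ?thesis by simp
qed

lemma circle_hoelder_circle_fun:
  assumes g: "circle_hoelder \<alpha> K g" and "0 < \<alpha>"
  shows "circle_fun g"
  unfolding circle_fun_def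
proof
  show "bounded (g ` (sphere 0 1 - {1}))"
    using g unfolding circle_hoelder_def bounded_iff by blast
  show "continuous_on (sphere 0 1 - {1}) g"
    unfolding continuous_on_def
  proof
    fix t :: complex assume t: "t \<in> sphere 0 1 - {1}"
    have "((\<lambda>t'. K * norm (t' - t) powr \<alpha>) \<longlongrightarrow> K * norm (t - t) powr \<alpha>) (at t within sphere 0 1 - {1})"
      using \<open>0 < \<alpha>\<close> by (intro tendsto_intros tendsto_powr') auto
    then have "((\<lambda>t'. K * norm (t' - t) powr \<alpha>) \<longlongrightarrow> 0) (at t within sphere 0 1 - {1})" by simp
    then have "((\<lambda>t'. g t' - g t) \<longlongrightarrow> 0) (at t within sphere 0 1 - {1})"
      by (rule Lim_null_comparison[rotated])
         (use g t in \<open>auto simp: circle_hoelder_def eventually_at_filter\<close>)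
    then show "(g \<longlongrightarrow> g t) (at t within sphere 0 1 - {1})" by (simp add: LIM_zero_iff)
  qed
qed

section \<open>The Cauchy transform and its derivative\<close>

definition cauchy_transform :: "(complex \<Rightarrow> complex) \<Rightarrow> complex \<Rightarrow> complex" where
  "cauchy_transform h z = circle_mean (\<lambda>t. h t * (t / (t - z)))"

lemma circle_dist_ge:
  assumes "t \<in> sphere 0 (1::real)"
  shows "1 - norm z \<le> norm (t - z :: complex)"
  using norm_triangle_ineq2[of t z] assms by simp

text \<open>The kernel is expanded exactly to second order:
  \<open>1/(t-y) = 1/(t-z) + (y-z)/(t-z)^2 + (y-z)^2/((t-y)(t-z)^2)\<close>. The coefficient of the
  last term has a uniformly bounded mean for \<open>y\<close> near \<open>z\<close>, so the
  difference quotient converges at a linear rate.\<close>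

lemma cauchy_transform_has_derivative:
  assumes h: "circle_fun h" and z: "z \<in> ball 0 1"
  shows "(cauchy_transform h has_field_derivative circle_mean (\<lambda>t. h t * (t / (t - z)\<^sup>2))) (at z)"
proof -
  define \<delta> where "\<delta> = 1 - norm z"
  have \<delta>: "0 < \<delta>" using z by (simp add: \<delta>_def)
  obtain B where B: "\<And>t. t \<in> sphere 0 1 - {1} \<Longrightarrow> norm (h t) \<le> B"
    using h unfolding circle_fun_def bounded_iff by blast
  have "0 \<le> B" using order_trans[OF norm_ge_zero B[of "-1"]] by simp
  let ?D = "circle_mean (\<lambda>t. h t * (t / (t - z)\<^sup>2))"
  define E where "E y = circle_mean (\<lambda>t. h t * (t / ((t - y) * (t - z)\<^sup>2)))" for y
  have near: "norm ((cauchy_transform h y - cauchy_transform h z) / (y - z) - ?D)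
      \<le> norm (y - z) * (B * (1 / (\<delta> / 2 * \<delta>\<^sup>2)))"
    if y: "y \<noteq> z" "dist y z < \<delta> / 2" for y
  proof -
    \<comment> \<open>A point within \<open>\<delta> / 2\<close> of \<open>z\<close> still has
      distance at least \<open>\<delta> / 2\<close> from the circle; this bounds the denominator of
      the remainder.\<close>
    have ny: "norm y < 1 - \<delta> / 2"
      using y norm_triangle_ineq2[of y z] unfolding \<delta>_def dist_norm by argo
    have ne: "t - y \<noteq> 0" "t - z \<noteq> 0" if "norm t = 1" for t
      using that z ny \<delta> by auto
    have cf: "circle_fun (\<lambda>t. h t * (t / (t - z)))" "circle_fun (\<lambda>t. h t * (t / (t - z)\<^sup>2))"
      "circle_fun (\<lambda>t. h t * (t / ((t - y) * (t - z)\<^sup>2)))"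
      using ne by (intro circle_fun_mult h circle_fun_continuous continuous_intros; force)+
    have "cauchy_transform h y = circle_mean (\<lambda>t. h t * (t / (t - z))
        + ((y - z) * (h t * (t / (t - z)\<^sup>2)) + (y - z)\<^sup>2 * (h t * (t / ((t - y) * (t - z)\<^sup>2)))))"
      unfolding cauchy_transform_def
    proof (rule circle_mean_cong)
      fix t :: complex assume "t \<in> sphere 0 1 - {1}"
      then have "t - y \<noteq> 0" "t - z \<noteq> 0" using ne by auto
      then have "1 / (t - y) = 1 / (t - z) + ((y - z) * (1 / (t - z)\<^sup>2) + (y - z)\<^sup>2 * (1 / ((t - y) * (t - z)\<^sup>2)))"
        by (simp add: divide_simps) (simp add: algebra_simps power2_eq_square)
      then have "h t * t * (1 / (t - y)) = h t * t * (1 / (t - z) + ((y - z) * (1 / (t - z)\<^sup>2) + (y - z)\<^sup>2 * (1 / ((t - y) * (t - z)\<^sup>2))))"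
        by simp
      then show "h t * (t / (t - y)) = h t * (t / (t - z))
        + ((y - z) * (h t * (t / (t - z)\<^sup>2)) + (y - z)\<^sup>2 * (h t * (t / ((t - y) * (t - z)\<^sup>2))))"
        by (simp add: algebra_simps)
    qed
    also have "\<dots> = cauchy_transform h z + ((y - z) * ?D + (y - z)\<^sup>2 * E y)"
      unfolding cauchy_transform_def E_def
      by (simp only: circle_mean_add circle_mean_cmult cf(1) circle_fun_add
            circle_fun_mult[OF circle_fun_const cf(2)] circle_fun_mult[OF circle_fun_const cf(3)])
    finally have "cauchy_transform h y - cauchy_transform h z = (y - z) * (?D + (y - z) * E y)"
      by (simp add: algebra_simps power2_eq_square)
    then have "(cauchy_transform h y - cauchy_transform h z) / (y - z) - ?D = (y - z) * E y"
      using y by simp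
    moreover have "norm (E y) \<le> B * (1 / (\<delta> / 2 * \<delta>\<^sup>2))"
      unfolding E_def
    proof (rule circle_mean_norm_le_const)
      show "circle_fun (\<lambda>t. h t * (t / ((t - y) * (t - z)\<^sup>2)))" by (fact cf)
      fix t :: complex assume t: "t \<in> sphere 0 1 - {1}"
      have "\<delta> \<le> norm (t - z)" "\<delta> / 2 \<le> norm (t - y)"
        using circle_dist_ge[of t z] circle_dist_ge[of t y] t ny \<delta> unfolding \<delta>_def by (auto simp: field_simps)
      then have "norm (t / ((t - y) * (t - z)\<^sup>2)) \<le> 1 / (\<delta> / 2 * \<delta>\<^sup>2)"
        using t \<delta> unfolding norm_divide norm_mult norm_power
        by (intro frac_le mult_mono power_mono) auto
      then show "norm (h t * (t / ((t - y) * (t - z)\<^sup>2))) \<le> B * (1 / (\<delta> / 2 * \<delta>\<^sup>2))"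
        unfolding norm_mult[of "h t"] using B[OF t] \<open>0 \<le> B\<close> by (intro mult_mono) auto
    qed
    ultimately show ?thesis by (simp only: norm_mult) (intro mult_left_mono norm_ge_zero)
  qed
  have "((\<lambda>y. norm (y - z) * (B * (1 / (\<delta> / 2 * \<delta>\<^sup>2)))) \<longlongrightarrow> norm (z - z) * (B * (1 / (\<delta> / 2 * \<delta>\<^sup>2)))) (at z)"
    by (intro tendsto_intros)
  then have lim: "((\<lambda>y. norm (y - z) * (B * (1 / (\<delta> / 2 * \<delta>\<^sup>2)))) \<longlongrightarrow> 0) (at z)" by simp
  have "((\<lambda>y. (cauchy_transform h y - cauchy_transform h z) / (y - z) - ?D) \<longlongrightarrow> 0) (at z)"
    by (rule Lim_null_comparison[OF _ lim])
       (use near \<delta> in \<open>auto simp: eventually_at intro!: exI[of _ "\<delta> / 2"]\<close>)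
  then show ?thesis by (simp add: has_field_derivative_iff LIM_zero_iff)
qed

lemma cauchy_transform_holomorphic:
  "circle_fun h \<Longrightarrow> cauchy_transform h holomorphic_on ball 0 1"
  by (auto simp: holomorphic_on_open intro: cauchy_transform_has_derivative)

lemma disc_fun_has_derivative:
  assumes "disc_fun f" "z \<in> ball 0 1"
  shows "(f has_field_derivative circle_mean (\<lambda>t. f t * (t / (t - z)\<^sup>2))) (at z)"
proof (rule has_field_derivative_transform_within_open)
  show "(cauchy_transform f has_field_derivative circle_mean (\<lambda>t. f t * (t / (t - z)\<^sup>2))) (at z)"
    by (intro cauchy_transform_has_derivative disc_fun_circle_fun assms)
  show "cauchy_transform f w = f w" if "w \<in> ball 0 1" for w
    using disc_fun_cauchy[OF assms(1) that] by (simp add: cauchy_transform_def)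
qed (use assms in auto)

section \<open>The Poisson kernel and kernels of its size\<close>

lemma circle_mean_of_real:
  fixes g :: "complex \<Rightarrow> real"
  assumes "circle_fun g"
  shows "circle_mean (\<lambda>t. complex_of_real (g t)) = of_real (circle_mean g)"
  unfolding circle_mean_def
  using integral_linear[OF circle_fun_integrable[OF assms] bounded_linear_of_real]
  by (simp add: o_def)

lemma circle_continuous_inverse_dist:
  assumes "z \<in> ball 0 1"
  shows "continuous_on (sphere 0 1) (\<lambda>t. 1 / (norm (t - z :: complex))\<^sup>2)"
  using assms by (intro continuous_intros) auto

text \<open>On the circle \<open>(norm (t - z))^2 = (t - z) * (1 - cnj z * t) / t\<close>. The
  integrand is thus the Cauchy kernel at \<open>z\<close> applied to
  \<open>1 / (1 - cnj z * t)\<close>, which is analytic in the disc and continuous on its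
  closure.\<close>

lemma poisson_kernel_mean:
  assumes z: "z \<in> ball 0 1"
  shows "circle_mean (\<lambda>t. 1 / (norm (t - z))\<^sup>2) = 1 / (1 - (norm z)\<^sup>2)"
proof -
  have ne: "1 - cnj z * w \<noteq> 0" if "w \<in> cball 0 1" for w
  proof
    assume "1 - cnj z * w = 0"
    then have "norm z * norm w = 1" by (metis complex_mod_cnj eq_iff_diff_eq_0 norm_mult norm_one)
    moreover have "norm z * norm w \<le> norm z * 1" using that by (intro mult_left_mono) auto
    ultimately show False using z by simp
  qed
  have "circle_mean (\<lambda>t. complex_of_real (1 / (norm (t - z))\<^sup>2))
      = circle_mean (\<lambda>t. 1 / (1 - cnj z * t) * (t / (t - z)))"
  proof (rule circle_mean_cong)
    fix t :: complex assume t: "t \<in> sphere 0 1 - {1}"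
    then have "t * cnj t = 1"
      using complex_norm_square[of t] by simp
    moreover have "t \<noteq> 0" "t - z \<noteq> 0" "1 - cnj z * t \<noteq> 0"
      using t z ne[of t] by auto
    moreover have "complex_of_real ((norm (t - z))\<^sup>2) = (t - z) * cnj (t - z)"
      using complex_norm_square by blast
    moreover have "t * cnj (t - z) = 1 - cnj z * t"
      using \<open>t * cnj t = 1\<close> by (simp add: algebra_simps)
    ultimately show "complex_of_real (1 / (norm (t - z))\<^sup>2) = 1 / (1 - cnj z * t) * (t / (t - z))"
      by (simp add: divide_simps)
  qed
  also have "\<dots> = 1 / (1 - cnj z * z)"
    by (rule cauchy_formula_circle_mean[OF _ _ z])
       (use ne in \<open>auto intro!: continuous_intros holomorphic_intros\<close>)
  also have "\<dots> = complex_of_real (1 / (1 - (norm z)\<^sup>2))"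
    by (simp add: mult.commute flip: complex_norm_square)
  finally show ?thesis
    using circle_mean_of_real[OF circle_fun_continuous[OF circle_continuous_inverse_dist[OF z]]]
    by (metis of_real_eq_iff)
qed

lemma punctured_circle_near:
  assumes "z \<in> ball 0 (1::real)"
  obtains t0 where "t0 \<in> sphere 0 1 - {1::complex}" "norm (t0 - z) \<le> 2 * (1 - norm z)"
proof (cases "z = of_real (norm z)")
  case False
  define t0 where "t0 = z / of_real (norm z)"
  have z0: "norm z \<noteq> 0" using False by auto
  have "t0 - z = t0 * of_real (1 - norm z)" using z0 by (simp add: t0_def field_simps)
  moreover have "norm t0 = 1" using z0 by (simp add: t0_def norm_divide)
  ultimately have "norm (t0 - z) = 1 - norm z" using assms
    by (simp add: norm_mult del: of_real_diff)
  moreover have "t0 \<noteq> 1" using False z0 by (auto simp: t0_def)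
  ultimately show ?thesis using that[of t0] \<open>norm t0 = 1\<close> assms by auto
next
  case True
  define y where "y = (1 - norm z) / 2"
  \<comment> \<open>Numerator and denominator are conjugate, so the point lies on the circle;
    \<open>t0 - 1 = 2 * \<i> * y / (1 - \<i> * y)\<close> has norm at most
    \<open>2 * y = 1 - norm z\<close>.\<close>
  define t0 where "t0 = (1 + \<i> * of_real y) / (1 - \<i> * of_real y)"
  have y: "0 < y" using assms by (simp add: y_def)
  have ny: "norm (1 + \<i> * of_real y) = norm (1 - \<i> * of_real y)" "1 \<le> norm (1 - \<i> * of_real y)"
    by (auto simp: cmod_def)
  have ne: "1 - \<i> * of_real y \<noteq> 0" using ny by auto
  have t1: "t0 - 1 = 2 * \<i> * of_real y / (1 - \<i> * of_real y)"
    using ne by (simp add: t0_def field_simps)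
  then have "norm (t0 - 1) \<le> 2 * y / 1"
    using y ny by (simp only: norm_divide norm_mult) (intro divide_mono, auto)
  moreover have "norm (1 - z) = 1 - norm z"
    using assms by (subst True) (metis abs_of_nonneg diff_ge_0_iff_ge less_eq_real_def mem_ball_0 norm_of_real of_real_1 of_real_diff)
  ultimately have "norm (t0 - z) \<le> 2 * (1 - norm z)"
    using norm_triangle_ineq[of "t0 - 1" "1 - z"] by (simp add: y_def)
  moreover have "t0 \<noteq> 1" using t1 y ne by auto
  moreover have "norm t0 = 1" using ny by (simp add: t0_def norm_divide)
  ultimately show ?thesis using that[of t0] by auto
qed

text \<open>Splitting at distance \<open>sqrt (1 - norm z)\<close> costs half of the exponent, but needs no more
  than the Poisson kernel.\<close>
lemma singular_kernel_bound:
  assumes d: "0 < (d::real)" and \<delta>: "0 < \<delta>" and \<alpha>: "0 < \<alpha>" "\<alpha> \<le> 1"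
  shows "d powr \<alpha> / d\<^sup>2 \<le> \<delta> powr (\<alpha> / 2 - 1) + \<delta> powr (\<alpha> / 2) * (1 / d\<^sup>2)"
proof -
  have sq: "(d\<^sup>2) powr (\<alpha> / 2) = d powr \<alpha>" 
    using d powr_powr[of d 2 "\<alpha> / 2"] by simp
  show ?thesis
  proof (cases "\<delta> \<le> d\<^sup>2")
    case True
    have "d powr \<alpha> / d\<^sup>2 = (d\<^sup>2) powr (\<alpha> / 2 - 1)"
      using d by (simp add: powr_diff sq)
    also have "\<dots> \<le> \<delta> powr (\<alpha> / 2 - 1)"
      using True \<delta> \<alpha> by (intro powr_mono2') auto
    finally show ?thesis using d by (simp add: add_increasing2)
  next
    case False
    have "d powr \<alpha> = (d\<^sup>2) powr (\<alpha> / 2)" by (simp add: sq)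
    also have "\<dots> \<le> \<delta> powr (\<alpha> / 2)" using False \<alpha> by (intro powr_mono2) auto
    finally have "d powr \<alpha> / d\<^sup>2 \<le> \<delta> powr (\<alpha> / 2) * (1 / d\<^sup>2)" using d by (simp add: divide_right_mono)
    then show ?thesis by (simp add: add_increasing)
  qed
qed

text \<open>Since \<open>t0\<close> lies within twice \<open>1 - norm z\<close> of \<open>z\<close>,
  one has \<open>norm (t - t0) \<le> 3 * norm (t - z)\<close>, and the increment of \<open>h\<close>
  can be measured from \<open>z\<close>. The two terms of \<open>singular_kernel_bound\<close> then
  have means of the same order, the second by the Poisson mean; this gives 6 = 3 + 3.\<close>

lemma circle_mean_hoelder_kernel:
  assumes h: "circle_hoelder \<alpha> K h" and \<alpha>: "0 < \<alpha>" "\<alpha> \<le> 1"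
    and z: "z \<in> ball 0 1"
    and t0: "t0 \<in> sphere 0 1 - {1}" "norm (t0 - z) \<le> 2 * (1 - norm z)"
    and k: "circle_fun k" "\<And>t. t \<in> sphere 0 1 - {1} \<Longrightarrow> norm (k t) \<le> A / (norm (t - z))\<^sup>2" "0 \<le> A"
  shows "norm (circle_mean (\<lambda>t. (h t - h t0) * k t)) \<le> 6 * A * K * (1 - norm z) powr (\<alpha> / 2 - 1)"
proof -
  define \<delta> where "\<delta> = 1 - norm z"
  have \<delta>: "0 < \<delta>" using z by (simp add: \<delta>_def)
  have K: "0 \<le> K" using circle_hoelder_nonneg[OF h] .
  let ?g = "\<lambda>t. 3 * A * K * (\<delta> powr (\<alpha> / 2 - 1)) + 3 * A * K * \<delta> powr (\<alpha> / 2) * (1 / (norm (t - z))\<^sup>2)"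
  have cg: "circle_fun (\<lambda>t. 1 / (norm (t - z))\<^sup>2)"
    by (intro circle_fun_continuous circle_continuous_inverse_dist z)
  have "norm (circle_mean (\<lambda>t. (h t - h t0) * k t)) \<le> circle_mean ?g"
  proof (rule circle_mean_norm_le)
    show "circle_fun (\<lambda>t. (h t - h t0) * k t)"
      by (intro circle_fun_mult circle_fun_diff circle_fun_const k circle_hoelder_circle_fun[OF h \<alpha>(1)])
    show "circle_fun ?g" by (intro circle_fun_add circle_fun_mult circle_fun_const cg)
    fix t :: complex assume t: "t \<in> sphere 0 1 - {1}"
    have d: "\<delta> \<le> norm (t - z)" using t circle_dist_ge[of t z] by (auto simp: \<delta>_def)
    have "norm (t - t0) \<le> norm (t - z) + norm (t0 - z)"
      using norm_triangle_ineq4[of "t - z" "t0 - z"] by simp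
    also have "\<dots> \<le> 3 * norm (t - z)" using t0 d by (simp add: \<delta>_def)
    finally have "norm (t - t0) powr \<alpha> \<le> (3 * norm (t - z)) powr \<alpha>" using \<alpha> by (intro powr_mono2) auto
    also have "\<dots> = 3 powr \<alpha> * norm (t - z) powr \<alpha>" by (simp add: powr_mult)
    also have "\<dots> \<le> 3 powr 1 * norm (t - z) powr \<alpha>" using \<alpha> by (intro mult_right_mono powr_mono) auto
    finally have le: "norm (t - t0) powr \<alpha> \<le> 3 * norm (t - z) powr \<alpha>" by simp
    have "norm (h t - h t0) \<le> K * norm (t - t0) powr \<alpha>" using h t t0 by (auto simp: circle_hoelder_def)
    also have "\<dots> \<le> K * (3 * norm (t - z) powr \<alpha>)" by (intro mult_left_mono le K)
    finally have "norm (h t - h t0) * norm (k t) \<le> K * (3 * norm (t - z) powr \<alpha>) * (A / (norm (t - z))\<^sup>2)"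
      using k(2)[OF t] K by (intro mult_mono) auto
    also have "\<dots> = 3 * A * K * (norm (t - z) powr \<alpha> / (norm (t - z))\<^sup>2)" by simp
    also have "\<dots> \<le> 3 * A * K * (\<delta> powr (\<alpha> / 2 - 1) + \<delta> powr (\<alpha> / 2) * (1 / (norm (t - z))\<^sup>2))"
      using d \<delta> \<alpha> K k(3) by (intro mult_left_mono singular_kernel_bound) auto
    also have "\<dots> = ?g t" by (simp add: algebra_simps)
    finally show "norm ((h t - h t0) * k t) \<le> ?g t" by (simp add: norm_mult)
  qed
  also have "circle_mean ?g = 3 * A * K * (\<delta> powr (\<alpha> / 2 - 1)) + 3 * A * K * \<delta> powr (\<alpha> / 2) * (1 / (1 - (norm z)\<^sup>2))"
    unfolding poisson_kernel_mean[OF z, symmetric]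
    by (subst circle_mean_add)
       (intro circle_fun_mult circle_fun_const cg, intro circle_fun_mult circle_fun_const cg,
        simp only: circle_mean_const, simp only: circle_mean_def integral_mult_right)
  also have "\<dots> \<le> 3 * A * K * (\<delta> powr (\<alpha> / 2 - 1)) + 3 * A * K * \<delta> powr (\<alpha> / 2) * (1 / \<delta>)"
  proof -
    have "(norm z)\<^sup>2 \<le> norm z" using z by (simp add: power2_eq_square mult_left_le_one_le)
    then have "1 / (1 - (norm z)\<^sup>2) \<le> 1 / \<delta>" using \<delta> by (intro divide_left_mono) (auto simp: \<delta>_def)
    then show ?thesis using K k(3) by (intro add_left_mono mult_left_mono) auto
  qed
  also have "\<dots> = 6 * A * K * \<delta> powr (\<alpha> / 2 - 1)" using \<delta> by (simp add: powr_diff)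
  finally show ?thesis by (simp add: \<delta>_def)
qed

section \<open>Regularity of bounded analytic functions\<close>

text \<open>The derivative bound is integrated along the radius. Its antiderivative
  \<open>- (C / \<beta>) * (1 - s) powr \<beta>\<close> stays finite at the boundary because
  \<open>\<beta> > 0\<close>.\<close>

lemma radial_growth_bound:
  assumes f: "f holomorphic_on ball 0 1"
    and bd: "\<And>z. z \<in> ball 0 1 \<Longrightarrow> norm (deriv f z) \<le> C * (1 - norm z) powr (\<beta> - 1)"
    and \<beta>: "0 < \<beta>" "\<beta> \<le> 1" and C: "0 \<le> C" and z: "z \<in> ball 0 1" and d: "0 < d" "d \<le> 1"
  shows "norm (f z - f (of_real (1 - d) * z)) \<le> C / \<beta> * d powr \<beta>"
proof -
  have sz: "of_real s * z \<in> ball 0 1" if "0 \<le> s" "s \<le> 1" for s :: real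
  proof -
    have "s * norm z \<le> 1 * norm z" using that by (intro mult_right_mono) auto
    then show ?thesis using that z by (simp add: norm_mult)
  qed
  let ?\<phi> = "\<lambda>s. - (C / \<beta>) * (1 - s) powr \<beta>"
  have "norm (f (of_real 1 * z) - f (of_real (1 - d) * z)) \<le> ?\<phi> 1 - ?\<phi> (1 - d)"
  proof (rule differentiable_bound_general[where f="\<lambda>s. f (of_real s * z)" and \<phi>="?\<phi>"
        and f'="\<lambda>s. z * deriv f (of_real s * z)" and \<phi>'="\<lambda>s. C * (1 - s) powr (\<beta> - 1)"])
    show "1 - d < 1" using d by simp
    show "continuous_on {1 - d..1} (\<lambda>s. f (of_real s * z))"
      by (rule continuous_on_compose2[OF holomorphic_on_imp_continuous_on[OF f]])
         (use d sz in \<open>auto intro!: continuous_intros\<close>)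
    show "continuous_on {1 - d..1} ?\<phi>"
      using \<beta> by (intro continuous_intros continuous_on_powr') auto
    fix s assume s: "1 - d < s" "s < 1"
    then have szb: "of_real s * z \<in> ball 0 1" using d by (intro sz) auto
    have "(f has_field_derivative deriv f (of_real s * z)) (at (of_real s * z))"
      using holomorphic_derivI[OF f _ szb] by simp
    moreover have "((\<lambda>s. of_real s * z) has_vector_derivative z) (at s)"
      unfolding has_vector_derivative_def
      by (auto intro!: derivative_eq_intros simp: scaleR_conv_of_real)
    ultimately show "((\<lambda>s. f (of_real s * z)) has_vector_derivative z * deriv f (of_real s * z)) (at s)"
      using field_vector_diff_chain_at[of "\<lambda>s. of_real s * z" z s f] by (simp add: o_def)
    show "(?\<phi> has_vector_derivative C * (1 - s) powr (\<beta> - 1)) (at s)"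
      unfolding has_real_derivative_iff_has_vector_derivative[symmetric]
      using s \<beta> by (auto intro!: derivative_eq_intros simp: powr_diff)
    have "s * norm z \<le> s * 1" using s z d by (intro mult_left_mono) auto
    then have le: "1 - s \<le> 1 - norm (of_real s * z)"
      using s d by (simp add: norm_mult)
    have "norm (z * deriv f (of_real s * z)) \<le> 1 * norm (deriv f (of_real s * z))"
      unfolding norm_mult using z by (intro mult_right_mono) auto
    also have "\<dots> \<le> C * (1 - norm (of_real s * z)) powr (\<beta> - 1)" using bd[OF szb] by simp
    also have "\<dots> \<le> C * (1 - s) powr (\<beta> - 1)"
      using le s \<beta> C by (intro mult_left_mono powr_mono2') auto
    finally show "norm (z * deriv f (of_real s * z)) \<le> C * (1 - s) powr (\<beta> - 1)" .
  qed
  then show ?thesis using \<beta> by simp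
qed

text \<open>Hardy and Littlewood: move both points radially inwards by their distance.\<close>
lemma hardy_littlewood:
  assumes f: "f holomorphic_on ball 0 1"
    and bd: "\<And>z. z \<in> ball 0 1 \<Longrightarrow> norm (deriv f z) \<le> C * (1 - norm z) powr (\<beta> - 1)"
    and \<beta>: "0 < \<beta>" "\<beta> \<le> 1" and C: "0 \<le> C" and z: "z \<in> ball 0 1" and w: "w \<in> ball 0 1"
  shows "norm (f z - f w) \<le> (1 + 2 / \<beta>) * C * norm (z - w) powr \<beta>"
proof (cases "z = w")
  case False
  \<comment> \<open>Truncation at 1 keeps the contraction factor \<open>1 - d\<close> nonnegative.
    In the final constant \<open>1 + 2 / \<beta>\<close> each radial move contributes
    \<open>1 / \<beta>\<close>, and the passage between the moved points contributes 1.\<close>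
  define d where "d = min (norm (z - w)) 1"
  have d: "0 < d" "d \<le> 1" "d \<le> norm (z - w)" using False by (auto simp: d_def)
  let ?z = "of_real (1 - d) * z" and ?w = "of_real (1 - d) * w"
  have mid: "norm (f ?z - f ?w) \<le> C * d powr \<beta>"
  proof (cases "d = 1")
    case True
    then show ?thesis using C by simp
  next
    case False
    have sub: "y \<in> ball 0 1" if "y \<in> cball 0 (1 - d)" for y :: complex using that d by auto
    have in_cb: "of_real (1 - d) * y \<in> cball 0 (1 - d)" if "y \<in> ball 0 1" for y :: complex
      using that d mult_left_mono[of "norm y" 1 "1 - d"] by (simp add: norm_mult del: of_real_diff)
    \<comment> \<open>The moved points lie in the convex disc of radius \<open>1 - d\<close>, where
      the derivative is at most \<open>C * d powr (\<beta> - 1)\<close>; their distance is at most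
      \<open>d\<close>.\<close>
    have "norm (f ?z - f ?w) \<le> (C * d powr (\<beta> - 1)) * norm (?z - ?w)"
    proof (rule field_differentiable_bound[where S="cball 0 (1 - d)" and f'="deriv f"])
      fix y :: complex assume y: "y \<in> cball 0 (1 - d)"
      show "(f has_field_derivative deriv f y) (at y within cball 0 (1 - d))"
        using holomorphic_derivI[OF f _ sub[OF y]] has_field_derivative_at_within by blast
      have "norm (deriv f y) \<le> C * (1 - norm y) powr (\<beta> - 1)" using bd[OF sub[OF y]] .
      also have "\<dots> \<le> C * d powr (\<beta> - 1)"
        using y d \<beta> C by (intro mult_left_mono powr_mono2') auto
      finally show "norm (deriv f y) \<le> C * d powr (\<beta> - 1)" .
    qed (use in_cb z w in auto)
    also have "norm (?z - ?w) = (1 - d) * norm (z - w)"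
      using d by (simp add: norm_mult del: of_real_diff flip: right_diff_distrib)
    also have "(1 - d) * norm (z - w) \<le> 1 * d"
      using d False by (intro mult_mono) (auto simp: d_def)
    also have "C * d powr (\<beta> - 1) * (1 * d) = C * d powr \<beta>" using d by (simp add: powr_diff)
    finally show ?thesis using C d by (simp add: mult_left_mono)
  qed
  have "norm (f z - f w) \<le> norm (f z - f ?z) + norm (f ?z - f ?w) + norm (f w - f ?w)"
    using norm_triangle_ineq[of "f z - f ?z + (f ?z - f ?w)" "f ?w - f w"]
      norm_triangle_ineq[of "f z - f ?z" "f ?z - f ?w"] by (simp add: norm_minus_commute)
  also have "\<dots> \<le> C / \<beta> * d powr \<beta> + C * d powr \<beta> + C / \<beta> * d powr \<beta>"
    using d by (intro add_mono mid radial_growth_bound[OF f bd \<beta> C] z w)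
  also have "\<dots> = (1 + 2 / \<beta>) * C * d powr \<beta>" using \<beta> by (simp add: field_simps)
  also have "\<dots> \<le> (1 + 2 / \<beta>) * C * norm (z - w) powr \<beta>"
    using d \<beta> C by (intro mult_left_mono powr_mono2) auto
  finally show ?thesis .
qed simp

lemma eventually_at_left_unit: "eventually (\<lambda>r::real. 0 < r \<and> r < 1) (at_left 1)"
  using eventually_at_left_real[of 0 1] by (auto elim: eventually_mono)

lemma radial_tendsto:
  assumes "continuous_on (cball 0 1 - {1}) f" "t \<in> sphere 0 1 - {1::complex}"
  shows "((\<lambda>r. f (of_real r * t)) \<longlongrightarrow> f t) (at_left 1)"
proof (rule continuous_on_tendsto_compose[OF assms(1)])
  have "((\<lambda>r. of_real r * t) \<longlongrightarrow> of_real 1 * t) (at_left 1)"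
    by (intro tendsto_intros)
  then show "((\<lambda>r. of_real r * t) \<longlongrightarrow> t) (at_left 1)" by simp
  show "t \<in> cball 0 1 - {1}" using assms by auto
  show "\<forall>\<^sub>F r in at_left 1. of_real r * t \<in> cball 0 1 - {1}"
    using eventually_at_left_unit
  proof (rule eventually_mono)
    fix r :: real assume r: "0 < r \<and> r < 1"
    then have "norm (of_real r * t) = r" using assms by (simp add: norm_mult)
    then show "of_real r * t \<in> cball 0 1 - {1}" using r by auto
  qed
qed

text \<open>The interior estimate is applied to \<open>r * t\<close> and \<open>r * t'\<close>,
  which are no further apart than \<open>t\<close> and \<open>t'\<close>; letting \<open>r\<close>
  tend to 1 carries it to the boundary values.\<close>

lemma disc_fun_circle_hoelder:
  assumes f: "disc_fun f"
    and bd: "\<And>z. z \<in> ball 0 1 \<Longrightarrow> norm (deriv f z) \<le> C * (1 - norm z) powr (\<beta> - 1)"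
    and \<beta>: "0 < \<beta>" "\<beta> \<le> 1" and C: "0 \<le> C"
  shows "\<exists>L. circle_hoelder \<beta> L f"
proof -
  obtain B where B: "\<And>t. t \<in> cball 0 1 - {1} \<Longrightarrow> norm (f t) \<le> B"
    using f unfolding disc_fun_def bounded_iff by blast
  define L where "L = max B ((1 + 2 / \<beta>) * C)"
  have "circle_hoelder \<beta> L f"
    unfolding circle_hoelder_def
  proof (intro conjI ballI)
    fix t assume t: "t \<in> sphere 0 1 - {1::complex}"
    show "norm (f t) \<le> L" using B[of t] t by (auto simp: L_def)
    fix t' assume t': "t' \<in> sphere 0 1 - {1::complex}"
    have lim: "((\<lambda>r. norm (f (of_real r * t) - f (of_real r * t'))) \<longlongrightarrow> norm (f t - f t')) (at_left 1)"
      using f t t' by (intro tendsto_intros radial_tendsto) (auto simp: disc_fun_def)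
    have "eventually (\<lambda>r. norm (f (of_real r * t) - f (of_real r * t')) \<le> (1 + 2 / \<beta>) * C * norm (t - t') powr \<beta>) (at_left 1)"
      using eventually_at_left_unit
    proof (rule eventually_mono)
      fix r :: real assume r: "0 < r \<and> r < 1"
      have "norm (f (of_real r * t) - f (of_real r * t')) \<le> (1 + 2 / \<beta>) * C * norm (of_real r * t - of_real r * t') powr \<beta>"
        using f r t t' by (intro hardy_littlewood[OF _ bd \<beta> C]) (auto simp: disc_fun_def norm_mult)
      also have "norm (of_real r * t - of_real r * t') = r * norm (t - t')"
        using r by (simp add: norm_mult flip: right_diff_distrib)
      also have "(1 + 2 / \<beta>) * C * (r * norm (t - t')) powr \<beta> \<le> (1 + 2 / \<beta>) * C * norm (t - t') powr \<beta>"
        using r \<beta> C by (intro mult_left_mono powr_mono2) (auto intro: mult_left_le_one_le)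
      finally show "norm (f (of_real r * t) - f (of_real r * t')) \<le> (1 + 2 / \<beta>) * C * norm (t - t') powr \<beta>" .
    qed
    from tendsto_upperbound[OF lim this]
    have "norm (f t - f t') \<le> (1 + 2 / \<beta>) * C * norm (t - t') powr \<beta>" by simp
    also have "\<dots> \<le> L * norm (t - t') powr \<beta>" by (intro mult_right_mono) (auto simp: L_def)
    finally show "norm (f t - f t') \<le> L * norm (t - t') powr \<beta>" .
  qed
  then show ?thesis by blast
qed

text \<open>Taylor expansion of the differentiated geometric series with exact remainder. Stopping
  at order \<open>c\<close> makes the remainder divisible by \<open>u ^ c\<close>, which later
  cancels a factor \<open>inverse t ^ c\<close>.\<close>

lemma inverse_square_expansion:
  fixes u :: "'a::field"
  assumes "1 - u \<noteq> 0"
  shows "1 / (1 - u)\<^sup>2 = (\<Sum>k<c. of_nat (Suc k) * u ^ k) + u ^ c * ((of_nat (Suc c) - of_nat c * u) / (1 - u)\<^sup>2)"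
proof (induction c)
  case (Suc c)
  have "of_nat (Suc c) - of_nat c * u
      = of_nat (Suc c) * (1 - u)\<^sup>2 + u * (of_nat (Suc (Suc c)) - of_nat (Suc c) * u)"
    by (simp add: algebra_simps power2_eq_square)
  then have "(of_nat (Suc c) - of_nat c * u) / (1 - u)\<^sup>2
      = of_nat (Suc c) + u * ((of_nat (Suc (Suc c)) - of_nat (Suc c) * u) / (1 - u)\<^sup>2)"
    using assms by (simp add: add_divide_distrib)
  then show ?case by (subst Suc.IH) (simp add: algebra_simps)
qed simp

text \<open>Up to finitely many Fourier coefficients \<open>t ^ c * h (1 / t)\<close> is analytic outside the disc,
  and that part does not contribute to the integral.\<close>
lemma exterior_kernel_bounded:
  assumes h: "disc_fun h"
  obtains B where "0 \<le> B"
    "\<And>z. z \<in> ball 0 1 \<Longrightarrow> norm (circle_mean (\<lambda>t. t ^ c * h (inverse t) * (t / (t - z)\<^sup>2))) \<le> B"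
proof -
  obtain H where H: "\<And>t. t \<in> cball 0 1 - {1} \<Longrightarrow> norm (h t) \<le> H"
    using h unfolding disc_fun_def bounded_iff by blast
  have "0 \<le> H" using order_trans[OF norm_ge_zero H[of "-1"]] by simp
  define B where "B = (\<Sum>k<c. real (Suc k) * H)"
  have ch: "circle_fun h" using disc_fun_circle_fun[OF h] .
  have "norm (circle_mean (\<lambda>t. t ^ c * h (inverse t) * (t / (t - z)\<^sup>2))) \<le> B" if z: "z \<in> ball 0 1" for z
  proof -
    \<comment> \<open>The integrand after \<open>t\<close> has been replaced by
      \<open>inverse t\<close>; \<open>?R\<close> is the remainder of the expansion at
      \<open>u = z * t\<close> with \<open>t ^ c\<close> divided out.\<close>
    let ?g = "\<lambda>t. inverse t ^ c * h t * (inverse t / (inverse t - z)\<^sup>2)"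
    let ?R = "\<lambda>t. z ^ c * ((of_nat (Suc c) - of_nat c * (z * t)) / (1 - z * t)\<^sup>2)"
    have ne: "1 - z * t \<noteq> 0" if "t \<in> cball 0 1" for t
    proof
      assume "1 - z * t = 0"
      then have "norm z * norm t = 1" by (metis eq_iff_diff_eq_0 norm_mult norm_one)
      moreover have "norm z * norm t \<le> norm z * 1" using that by (intro mult_left_mono) auto
      ultimately show False using z by simp
    qed
    \<comment> \<open>The inverted kernel is \<open>t / (1 - z * t)^2\<close>. Its terms of order
      below \<open>c\<close> yield finitely many means of \<open>h\<close> against fixed powers,
      with weights bounded because \<open>norm z < 1\<close>. In the rest a factor \<open>t\<close>
      is left over, so its mean vanishes.\<close>
    have g_eq: "?g t = (\<Sum>k<c. of_nat (Suc k) * z ^ k * (h t * (inverse t ^ c * t ^ Suc k))) + t ^ 1 * (h t * ?R t)"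
      if t: "t \<in> sphere 0 1 - {1}" for t
    proof -
      have t0: "t \<noteq> 0" and n: "1 - z * t \<noteq> 0" using t ne[of t] by auto
      have "inverse t - z = (1 - z * t) / t" using t0 by (simp add: field_simps)
      then have "inverse t / (inverse t - z)\<^sup>2 = t * (1 / (1 - z * t)\<^sup>2)"
        using t0 n by (simp add: power_divide) (simp add: field_simps power2_eq_square)
      also have "\<dots> = t * ((\<Sum>k<c. of_nat (Suc k) * (z * t) ^ k) + (z * t) ^ c * ((of_nat (Suc c) - of_nat c * (z * t)) / (1 - z * t)\<^sup>2))"
        by (subst inverse_square_expansion[OF n, of c]) simp
      finally have "?g t = inverse t ^ c * h t * (t * ((\<Sum>k<c. of_nat (Suc k) * (z * t) ^ k) + (z * t) ^ c * ((of_nat (Suc c) - of_nat c * (z * t)) / (1 - z * t)\<^sup>2)))"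
        by simp
      also have "\<dots> = (\<Sum>k<c. of_nat (Suc k) * z ^ k * (h t * (inverse t ^ c * t ^ Suc k))) + (inverse t ^ c * t ^ c) * (t ^ 1 * (h t * ?R t))"
        by (simp only: distrib_left sum_distrib_left power_mult_distrib power_Suc power_one_right mult_ac)
      also have "inverse t ^ c * t ^ c = 1" using t0 by (simp flip: power_mult_distrib)
      finally show ?thesis by simp
    qed
    have cz: "continuous_on (sphere 0 1) (\<lambda>t. inverse t ^ c * t ^ Suc k :: complex)" for k
      by (intro continuous_intros) auto
    have hR: "disc_fun (\<lambda>t. h t * ?R t)"
      using ne by (intro disc_fun_mult h disc_fun_continuous continuous_intros holomorphic_intros) auto
    have "circle_fun (\<lambda>t. t ^ c * h (inverse t) * (t / (t - z)\<^sup>2))"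
      using z by (intro circle_fun_mult circle_fun_inverse ch circle_fun_continuous continuous_intros) auto
    from circle_mean_inverse[OF this]
    have "circle_mean (\<lambda>t. t ^ c * h (inverse t) * (t / (t - z)\<^sup>2)) = circle_mean ?g" by simp
    also have "\<dots> = circle_mean (\<lambda>t. (\<Sum>k<c. of_nat (Suc k) * z ^ k * (h t * (inverse t ^ c * t ^ Suc k))) + t ^ 1 * (h t * ?R t))"
      by (intro circle_mean_cong g_eq)
    also have "\<dots> = circle_mean (\<lambda>t. \<Sum>k<c. of_nat (Suc k) * z ^ k * (h t * (inverse t ^ c * t ^ Suc k))) + circle_mean (\<lambda>t. t ^ 1 * (h t * ?R t))"
      by (intro circle_mean_add circle_fun_sum circle_fun_mult circle_fun_const ch circle_fun_continuous[OF cz]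
           disc_fun_circle_fun[OF hR] circle_fun_continuous[where g="\<lambda>t. t ^ 1"] continuous_intros)
    also have "circle_mean (\<lambda>t. t ^ 1 * (h t * ?R t)) = 0" by (intro disc_fun_mean_zero hR) auto
    also have "circle_mean (\<lambda>t. \<Sum>k<c. of_nat (Suc k) * z ^ k * (h t * (inverse t ^ c * t ^ Suc k)))
        = (\<Sum>k<c. of_nat (Suc k) * z ^ k * circle_mean (\<lambda>t. h t * (inverse t ^ c * t ^ Suc k)))"
      unfolding circle_mean_cmult[symmetric]
      by (intro circle_mean_sum circle_fun_mult circle_fun_const ch circle_fun_continuous[OF cz]) auto
    also have "norm (\<dots> + 0) \<le> B"
      unfolding B_def add_0_right
    proof (rule sum_norm_le)
      fix k
      have "norm (circle_mean (\<lambda>t. h t * (inverse t ^ c * t ^ Suc k))) \<le> H"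
      proof (rule circle_mean_norm_le_const)
        show "circle_fun (\<lambda>t. h t * (inverse t ^ c * t ^ Suc k))"
          by (intro circle_fun_mult[OF ch] circle_fun_continuous[OF cz])
        fix t :: complex assume "t \<in> sphere 0 1 - {1}"
        then show "norm (h t * (inverse t ^ c * t ^ Suc k)) \<le> H"
          using H[of t] by (simp add: norm_mult norm_power norm_inverse)
      qed
      moreover have "norm (of_nat (Suc k) * z ^ k) \<le> real (Suc k) * 1"
        unfolding norm_mult norm_of_nat norm_power using z by (intro mult_left_mono power_le_one) auto
      ultimately show "norm (of_nat (Suc k) * z ^ k * circle_mean (\<lambda>t. h t * (inverse t ^ c * t ^ Suc k))) \<le> real (Suc k) * H"
        unfolding norm_mult[of "of_nat (Suc k) * z ^ k"]
        using mult_mono'[of "norm (of_nat (Suc k) * z ^ k)" "real (Suc k) * 1"] by simp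
    qed
    finally show ?thesis .
  qed
  moreover have "0 \<le> B" unfolding B_def using \<open>0 \<le> H\<close> by (intro sum_nonneg) auto
  ultimately show ?thesis using that by blast
qed

lemma kernel_norm:
  "t \<in> sphere 0 1 - {1::complex} \<Longrightarrow> norm (t / (t - z)\<^sup>2) = 1 / (norm (t - z))\<^sup>2"
  by (simp add: norm_divide norm_power)

lemma disc_fun_regularity:
  assumes f: "disc_fun f" and I: "finite I" and h: "\<And>i. i \<in> I \<Longrightarrow> disc_fun (h i)"
    and g: "\<And>i. i \<in> I \<Longrightarrow> circle_hoelder \<alpha> K (g i)" and \<alpha>: "0 < \<alpha>" "\<alpha> \<le> 1"
    and eq: "\<And>t. t \<in> sphere 0 1 - {1} \<Longrightarrow> t powi k * f t = (\<Sum>i\<in>I. h i (inverse t) * g i t)"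
  shows "\<exists>L. circle_hoelder (\<alpha> / 2) L f"
proof -
  \<comment> \<open>Here \<open>k = a - c\<close> and at most one of \<open>a\<close>,
    \<open>c\<close> is positive: a positive power stays with \<open>f\<close>, a negative one is
    moved to the exterior functions, so all exponents become nonnegative.\<close>
  define a c where "a = nat k" and "c = nat (- k)"
  define X where "X t = t ^ a * f t" for t
  define Y where "Y i t = t ^ c * h i (inverse t)" for i t
  have X: "disc_fun X"
    unfolding X_def by (intro disc_fun_mult f disc_fun_continuous continuous_intros holomorphic_intros)
  have XY: "X t = (\<Sum>i\<in>I. Y i t * g i t)" if t: "t \<in> sphere 0 1 - {1}" for t
  proof -
    have "t \<noteq> 0" using t by auto
    then have "t ^ a = t ^ c * t powi k"
      unfolding a_def c_def by (cases "k \<ge> 0") (auto simp: power_int_def field_simps)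
    then show ?thesis
      using eq[OF t] by (simp add: X_def Y_def mult.assoc flip: sum_distrib_left)
  qed
  have "\<forall>i\<in>I. \<exists>B. 0 \<le> B \<and> (\<forall>z\<in>ball 0 1. norm (circle_mean (\<lambda>t. Y i t * (t / (t - z)\<^sup>2))) \<le> B)"
  proof
    fix i assume "i \<in> I"
    from exterior_kernel_bounded[OF h[OF this], of c]
    show "\<exists>B. 0 \<le> B \<and> (\<forall>z\<in>ball 0 1. norm (circle_mean (\<lambda>t. Y i t * (t / (t - z)\<^sup>2))) \<le> B)"
      unfolding Y_def by metis
  qed
  from bchoice[OF this] obtain B where B: "\<And>i. i \<in> I \<Longrightarrow> 0 \<le> B i"
    "\<And>i z. i \<in> I \<Longrightarrow> z \<in> ball 0 1 \<Longrightarrow> norm (circle_mean (\<lambda>t. Y i t * (t / (t - z)\<^sup>2))) \<le> B i"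
    by blast
  have cY: "circle_fun (Y i)" if "i \<in> I" for i
    unfolding Y_def using h[OF that]
    by (intro circle_fun_mult circle_fun_inverse disc_fun_circle_fun circle_fun_continuous continuous_intros)
  have "\<forall>i\<in>I. \<exists>A. 0 \<le> A \<and> (\<forall>t\<in>sphere 0 1 - {1}. norm (Y i t) \<le> A)"
  proof
    fix i assume "i \<in> I"
    from cY[OF this] obtain A where A: "\<And>t. t \<in> sphere 0 1 - {1} \<Longrightarrow> norm (Y i t) \<le> A"
      unfolding circle_fun_def bounded_iff by blast
    have "0 \<le> A" using order_trans[OF norm_ge_zero A[of "-1"]] by simp
    with A show "\<exists>A. 0 \<le> A \<and> (\<forall>t\<in>sphere 0 1 - {1}. norm (Y i t) \<le> A)" by blast
  qed
  from bchoice[OF this] obtain A where A: "\<And>i. i \<in> I \<Longrightarrow> 0 \<le> A i"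
    "\<And>i t. i \<in> I \<Longrightarrow> t \<in> sphere 0 1 - {1} \<Longrightarrow> norm (Y i t) \<le> A i"
    by blast
  define C where "C = (\<Sum>i\<in>I. 6 * A i * K + K * B i)"
  have K: "0 \<le> K" if "i \<in> I" for i using circle_hoelder_nonneg[OF g[OF that]] .
  have C: "0 \<le> C" unfolding C_def using A B K by (intro sum_nonneg) (auto intro!: add_nonneg_nonneg mult_nonneg_nonneg)
  have "norm (deriv X z) \<le> C * (1 - norm z) powr (\<alpha> / 2 - 1)" if z: "z \<in> ball 0 1" for z
  proof -
    obtain t0 where t0: "t0 \<in> sphere 0 1 - {1::complex}" "norm (t0 - z) \<le> 2 * (1 - norm z)"
      using punctured_circle_near[OF z] .
    have cYk: "circle_fun (\<lambda>t. Y i t * (t / (t - z)\<^sup>2))" if "i \<in> I" for i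
      using z by (intro circle_fun_mult cY that circle_fun_continuous continuous_intros) auto
    have cg: "circle_fun (g i)" if "i \<in> I" for i using circle_hoelder_circle_fun[OF g[OF that] \<alpha>(1)] .
    have "deriv X z = circle_mean (\<lambda>t. X t * (t / (t - z)\<^sup>2))"
      using disc_fun_has_derivative[OF X z] by (rule DERIV_imp_deriv)
    also have "\<dots> = circle_mean (\<lambda>t. \<Sum>i\<in>I. (g i t - g i t0) * (Y i t * (t / (t - z)\<^sup>2)) + g i t0 * (Y i t * (t / (t - z)\<^sup>2)))"
      by (rule circle_mean_cong)
         (simp only: XY sum_distrib_right, simp only: left_diff_distrib diff_add_cancel, simp only: mult_ac)
    also have "\<dots> = (\<Sum>i\<in>I. circle_mean (\<lambda>t. (g i t - g i t0) * (Y i t * (t / (t - z)\<^sup>2)) + g i t0 * (Y i t * (t / (t - z)\<^sup>2))))"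
      by (intro circle_mean_sum I circle_fun_add circle_fun_mult[OF _ cYk] circle_fun_diff circle_fun_const cg)
    also have "\<dots> = (\<Sum>i\<in>I. circle_mean (\<lambda>t. (g i t - g i t0) * (Y i t * (t / (t - z)\<^sup>2))) + g i t0 * circle_mean (\<lambda>t. Y i t * (t / (t - z)\<^sup>2)))"
      unfolding circle_mean_cmult[symmetric]
      by (intro sum.cong refl circle_mean_add circle_fun_mult[OF _ cYk] circle_fun_diff circle_fun_const cg)
    also have "norm \<dots> \<le> (\<Sum>i\<in>I. (6 * A i * K + K * B i) * (1 - norm z) powr (\<alpha> / 2 - 1))"
    proof (rule sum_norm_le)
      fix i assume i: "i \<in> I"
      have 1: "norm (circle_mean (\<lambda>t. (g i t - g i t0) * (Y i t * (t / (t - z)\<^sup>2)))) \<le> 6 * A i * K * (1 - norm z) powr (\<alpha> / 2 - 1)"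
      proof (rule circle_mean_hoelder_kernel[OF g[OF i] \<alpha> z t0 cYk[OF i] _ A(1)[OF i]])
        fix t :: complex assume t: "t \<in> sphere 0 1 - {1}"
        have "norm (Y i t) * norm (t / (t - z)\<^sup>2) \<le> A i * (1 / (norm (t - z))\<^sup>2)"
          unfolding kernel_norm[OF t] using A(2)[OF i t] by (intro mult_right_mono) auto
        then show "norm (Y i t * (t / (t - z)\<^sup>2)) \<le> A i / (norm (t - z))\<^sup>2"
          by (simp only: norm_mult[of "Y i t"]) simp
      qed
      have "norm (g i t0 * circle_mean (\<lambda>t. Y i t * (t / (t - z)\<^sup>2))) \<le> K * B i * 1"
        unfolding norm_mult using g[OF i] t0 B(2)[OF i z] K[OF i]
        by (simp add: mult_mono circle_hoelder_def)
      \<comment> \<open>The exponent is negative and \<open>1 - norm z \<le> 1\<close>, so the power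
        is at least 1 and absorbs the bounded term.\<close>
      also have "\<dots> \<le> K * B i * (1 - norm z) powr (\<alpha> / 2 - 1)"
        using powr_mono2'[of "\<alpha> / 2 - 1" "1 - norm z" 1] z \<alpha> K[OF i] B(1)[OF i]
        by (intro mult_left_mono) auto
      finally show "norm (circle_mean (\<lambda>t. (g i t - g i t0) * (Y i t * (t / (t - z)\<^sup>2))) + g i t0 * circle_mean (\<lambda>t. Y i t * (t / (t - z)\<^sup>2)))
           \<le> (6 * A i * K + K * B i) * (1 - norm z) powr (\<alpha> / 2 - 1)"
        unfolding distrib_right using 1 by (intro norm_triangle_le add_mono)
    qed
    finally show ?thesis by (simp add: C_def sum_distrib_right)
  qed
  from disc_fun_circle_hoelder[OF X this _ _ C] \<alpha>
  obtain L where L: "circle_hoelder (\<alpha> / 2) L X" by auto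
  \<comment> \<open>Back from \<open>X\<close> to \<open>f\<close>: on the circle the factor
    \<open>inverse t ^ a\<close> is Hoelder.\<close>
  from circle_hoelder_mult[OF circle_hoelder_inverse[OF circle_hoelder_power[of "\<alpha> / 2" a]] L] \<alpha>
  obtain L' where L': "circle_hoelder (\<alpha> / 2) L' (\<lambda>t. inverse t ^ a * X t)" by auto
  have "inverse t ^ a * X t = f t" if "t \<in> sphere 0 1 - {1}" for t
  proof -
    have "t \<noteq> 0" using that by auto
    then show ?thesis by (simp add: X_def field_simps)
  qed
  with L' have "circle_hoelder (\<alpha> / 2) L' f" by (simp add: circle_hoelder_def)
  then show ?thesis by blast
qed

section \<open>The additive problem on the circle\<close>

text \<open>The transform of a constant has derivative zero, so \<open>h t0\<close> may be
  subtracted under the kernel of the derivative. The resulting growth bound makes the transform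
  Hoelder, hence uniformly continuous, on the open disc, and so it extends to the closed one.
  \<open>C\<close> is quantified before \<open>h\<close> for the sake of uniformity.\<close>

lemma cauchy_transform_extension:
  assumes \<alpha>: "0 < \<alpha>" "\<alpha> \<le> 1"
  shows "\<exists>C\<ge>0. \<forall>K h. circle_hoelder \<alpha> K h \<longrightarrow>
    (\<exists>u. continuous_on (cball 0 1) u \<and> u holomorphic_on ball 0 1 \<and>
      (\<forall>z\<in>ball 0 1. u z = cauchy_transform h z) \<and> (\<forall>z\<in>cball 0 1. norm (u z) \<le> C * K))"
proof -
  define \<beta> where "\<beta> = \<alpha> / 2"
  \<comment> \<open>The summand 1 accounts for the value at 0, \<open>1 + 2 / \<beta>\<close> is the
    Hardy-Littlewood constant, and 6 comes from the kernel estimate.\<close>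
  define C where "C = 1 + (1 + 2 / \<beta>) * 6"
  have \<beta>: "0 < \<beta>" "\<beta> \<le> 1" using \<alpha> by (auto simp: \<beta>_def)
  have "\<exists>u. continuous_on (cball 0 1) u \<and> u holomorphic_on ball 0 1 \<and>
      (\<forall>z\<in>ball 0 1. u z = cauchy_transform h z) \<and> (\<forall>z\<in>cball 0 1. norm (u z) \<le> C * K)"
    if h: "circle_hoelder \<alpha> K h" for K h
  proof -
    have K: "0 \<le> K" using circle_hoelder_nonneg[OF h] .
    have ch: "circle_fun h" using circle_hoelder_circle_fun[OF h \<alpha>(1)] .
    note hol = cauchy_transform_holomorphic[OF ch]
    have bd: "norm (deriv (cauchy_transform h) z) \<le> 6 * K * (1 - norm z) powr (\<beta> - 1)" if z: "z \<in> ball 0 1" for z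
    proof -
      obtain t0 where t0: "t0 \<in> sphere 0 1 - {1::complex}" "norm (t0 - z) \<le> 2 * (1 - norm z)"
        using punctured_circle_near[OF z] .
      have ck: "circle_fun (\<lambda>t. t / (t - z)\<^sup>2)"
        using z by (intro circle_fun_continuous continuous_intros) auto
      have "disc_fun (\<lambda>t. 1)" by (intro disc_fun_continuous) auto
      from disc_fun_has_derivative[OF this z]
      have "circle_mean (\<lambda>t. 1 * (t / (t - z)\<^sup>2)) = 0" using DERIV_unique DERIV_const by blast
      then have k0: "circle_mean (\<lambda>t. t / (t - z)\<^sup>2) = 0" by simp
      have "deriv (cauchy_transform h) z = circle_mean (\<lambda>t. h t * (t / (t - z)\<^sup>2))"
        using cauchy_transform_has_derivative[OF ch z] by (rule DERIV_imp_deriv)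
      also have "\<dots> = circle_mean (\<lambda>t. (h t - h t0) * (t / (t - z)\<^sup>2) + h t0 * (t / (t - z)\<^sup>2))"
        by (simp only: left_diff_distrib diff_add_cancel)
      also have "\<dots> = circle_mean (\<lambda>t. (h t - h t0) * (t / (t - z)\<^sup>2)) + circle_mean (\<lambda>t. h t0 * (t / (t - z)\<^sup>2))"
        by (intro circle_mean_add circle_fun_mult[OF _ ck] circle_fun_diff ch circle_fun_const)
      also have "circle_mean (\<lambda>t. h t0 * (t / (t - z)\<^sup>2)) = 0"
        by (simp only: circle_mean_cmult k0 mult_zero_right)
      finally show ?thesis
        using circle_mean_hoelder_kernel[OF h \<alpha> z t0 ck, of 1] by (simp add: kernel_norm \<beta>_def del: norm_divide)
    qed
    have hl: "norm (cauchy_transform h z - cauchy_transform h w) \<le> (1 + 2 / \<beta>) * (6 * K) * norm (z - w) powr \<beta>"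
      if "z \<in> ball 0 1" "w \<in> ball 0 1" for z w
      by (rule hardy_littlewood[OF hol bd \<beta> _ that]) (use K in auto)
    have "uniformly_continuous_on (ball 0 1) (cauchy_transform h)"
      unfolding uniformly_continuous_on_def
    proof (intro allI impI)
      fix e :: real assume e: "0 < e"
      \<comment> \<open>The summand 1 keeps \<open>M\<close> positive when
        \<open>K = 0\<close>.\<close>
      define M where "M = (1 + 2 / \<beta>) * (6 * K) + 1"
      have M: "0 < M" using K \<beta> by (simp add: M_def add_nonneg_pos)
      define d where "d = (e / M) powr (1 / \<beta>)"
      have "dist (cauchy_transform h y) (cauchy_transform h x) < e"
        if "x \<in> ball 0 1" "y \<in> ball 0 1" "dist y x < d" for x y
      proof -
        have "norm (cauchy_transform h y - cauchy_transform h x) \<le> (1 + 2 / \<beta>) * (6 * K) * norm (y - x) powr \<beta>"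
          using hl that by blast
        also have "\<dots> \<le> M * norm (y - x) powr \<beta>" by (intro mult_right_mono) (auto simp: M_def)
        also have "norm (y - x) powr \<beta> < d powr \<beta>"
          using that \<beta> by (intro powr_less_mono2) (auto simp: dist_norm)
        also have "d powr \<beta> = e / M" using \<beta> e M by (simp add: d_def powr_powr)
        finally show ?thesis using M by (simp add: dist_norm)
      qed
      moreover have "0 < d" using e M by (simp add: d_def)
      ultimately show "\<exists>d>0. \<forall>x\<in>ball 0 1. \<forall>x'\<in>ball 0 1. dist x' x < d \<longrightarrow>
          dist (cauchy_transform h x') (cauchy_transform h x) < e" by blast
    qed
    then obtain u where u: "uniformly_continuous_on (closure (ball 0 1)) u"
      and ueq: "\<And>z. z \<in> ball 0 1 \<Longrightarrow> cauchy_transform h z = u z"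
      by (rule uniformly_continuous_on_extension_on_closure) blast
    have uc: "continuous_on (cball 0 1) u"
      using uniformly_continuous_imp_continuous[OF u] by simp
    have "norm (cauchy_transform h 0) \<le> K"
      unfolding cauchy_transform_def
    proof (rule circle_mean_norm_le_const)
      show "circle_fun (\<lambda>t. h t * (t / (t - 0)))"
        by (intro circle_fun_mult ch circle_fun_continuous continuous_intros) auto
      show "norm (h t * (t / (t - 0))) \<le> K" if "t \<in> sphere 0 1 - {1}" for t
        using h that by (auto simp: circle_hoelder_def)
    qed
    have ball_bd: "norm (u z) \<le> C * K" if z: "z \<in> ball 0 1" for z
    proof -
      have "norm (cauchy_transform h z - cauchy_transform h 0) \<le> (1 + 2 / \<beta>) * (6 * K) * norm (z - 0) powr \<beta>"
        using hl[OF z, of 0] by simp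
      also have "\<dots> \<le> (1 + 2 / \<beta>) * (6 * K) * 1"
        using K \<beta> z powr_mono2[of \<beta> "norm z" 1] by (intro mult_left_mono) auto
      finally show ?thesis
        using \<open>norm (cauchy_transform h 0) \<le> K\<close> norm_triangle_sub[of "cauchy_transform h z" "cauchy_transform h 0"]
        unfolding ueq[OF z, symmetric] C_def by (simp add: algebra_simps)
    qed
    have "norm (u z) \<le> C * K" if "z \<in> cball 0 1" for z
      by (rule continuous_on_closure_norm_le[of "ball 0 1" u])
         (use uc ball_bd that in \<open>auto\<close>)
    moreover have "u holomorphic_on ball 0 1"
      using holomorphic_transform[OF hol ueq] .
    ultimately show ?thesis using uc ueq by auto
  qed
  moreover have "0 \<le> C" using \<beta> by (simp add: C_def)
  ultimately show ?thesis by blast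
qed

text \<open>Two geometric series, in \<open>z * inverse t\<close> and in \<open>cnj z * t\<close>;
  the constant term occurs in both, whence the \<open>- 1\<close>.\<close>

lemma poisson_kernel_decomposition:
  assumes z: "z \<in> ball 0 1" and t: "t \<in> sphere 0 (1::real)"
  shows "complex_of_real ((1 - (norm z)\<^sup>2) / (norm (t - z))\<^sup>2)
    = 1 / (1 - z * inverse t) + 1 / (1 - cnj z * t) - 1"
proof -
  have tt: "t * cnj t = 1" using complex_norm_square[of t] t by simp
  then have it: "inverse t = cnj t" by (rule inverse_unique)
  have tz: "t - z \<noteq> 0" using z t by auto
  have e: "1 - z * cnj t = (t - z) * cnj t" "1 - cnj z * t = cnj (t - z) * t"
    using tt by (auto simp: algebra_simps)
  have t0: "t \<noteq> 0" "cnj t \<noteq> 0" using t by auto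
  have n1: "1 - z * cnj t \<noteq> 0" "1 - cnj z * t \<noteq> 0" unfolding e using tz t0 by (simp_all only: mult_eq_0_iff complex_cnj_zero_iff simp_thms)
  have prod: "(1 - z * cnj t) * (1 - cnj z * t) = (t - z) * cnj (t - z)"
  proof -
    have "(t - z) * cnj t * (cnj (t - z) * t) = (t - z) * cnj (t - z) * (t * cnj t)"
      by (simp only: mult_ac)
    then show ?thesis unfolding e tt by simp
  qed
  have "1 / (1 - z * cnj t) + 1 / (1 - cnj z * t) - 1 = (1 - z * cnj z) / ((1 - z * cnj t) * (1 - cnj z * t))"
    using n1 tt by (simp add: divide_simps) (simp add: algebra_simps)
  also have "\<dots> = complex_of_real ((1 - (norm z)\<^sup>2) / (norm (t - z))\<^sup>2)"
    unfolding prod of_real_divide of_real_diff complex_norm_square by simp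
  finally show ?thesis by (simp add: it)
qed

text \<open>The kernel has mean 1, so only increments of \<open>h\<close> count. The numerator
  \<open>1 - r^2 \<le> 2 * (1 - r)\<close> raises the exponent \<open>\<alpha> / 2 - 1\<close> of
  the kernel estimate to \<open>\<alpha> / 2\<close>, which tends to 0 with the explicit rate
  below.\<close>

lemma poisson_limit:
  assumes h: "circle_hoelder \<alpha> K h" and \<alpha>: "0 < \<alpha>" "\<alpha> \<le> 1" and t0: "t0 \<in> sphere 0 1 - {1}"
  shows "((\<lambda>r. circle_mean (\<lambda>t. h t * complex_of_real ((1 - (norm (of_real r * t0))\<^sup>2) / (norm (t - of_real r * t0))\<^sup>2)))
      \<longlongrightarrow> h t0) (at_left 1)"
proof -
  have K: "0 \<le> K" using circle_hoelder_nonneg[OF h] .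
  let ?P = "\<lambda>r t. complex_of_real ((1 - (norm (of_real r * t0))\<^sup>2) / (norm (t - of_real r * t0))\<^sup>2)"
  have bd: "norm (circle_mean (\<lambda>t. h t * ?P r t) - h t0) \<le> 12 * K * (1 - r) powr (\<alpha> / 2)" if r: "0 < r" "r < 1" for r
  proof -
    define z where "z = of_real r * t0"
    have nz: "norm z = r" using t0 r by (simp add: z_def norm_mult)
    have z: "z \<in> ball 0 1" using nz r by simp
    define P where "P t = complex_of_real ((1 - (norm z)\<^sup>2) / (norm (t - z))\<^sup>2)" for t
    have cP: "circle_fun P"
      unfolding P_def using z by (intro circle_fun_continuous continuous_intros) auto
    have A: "0 \<le> 1 - r\<^sup>2" using r by (simp add: power_le_one)
    have "circle_mean P = of_real (circle_mean (\<lambda>t. (1 - (norm z)\<^sup>2) / (norm (t - z))\<^sup>2))"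
      unfolding P_def using z by (intro circle_mean_of_real circle_fun_continuous continuous_intros) auto
    also have "circle_mean (\<lambda>t. (1 - (norm z)\<^sup>2) * (1 / (norm (t - z))\<^sup>2)) = (1 - (norm z)\<^sup>2) * circle_mean (\<lambda>t. 1 / (norm (t - z))\<^sup>2)"
      unfolding circle_mean_def by (rule integral_mult_right)
    then have "circle_mean (\<lambda>t. (1 - (norm z)\<^sup>2) / (norm (t - z))\<^sup>2) = 1"
      using poisson_kernel_mean[OF z] r by (simp add: nz power2_eq_1_iff)
    finally have P1: "circle_mean P = 1" by simp
    have "circle_mean (\<lambda>t. h t * P t) = circle_mean (\<lambda>t. (h t - h t0) * P t + h t0 * P t)"
      by (simp only: left_diff_distrib diff_add_cancel)
    also have "\<dots> = circle_mean (\<lambda>t. (h t - h t0) * P t) + circle_mean (\<lambda>t. h t0 * P t)"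
      by (intro circle_mean_add circle_fun_mult[OF _ cP] circle_fun_diff circle_fun_const circle_hoelder_circle_fun[OF h \<alpha>(1)])
    finally have "circle_mean (\<lambda>t. h t * P t) - h t0 = circle_mean (\<lambda>t. (h t - h t0) * P t)"
      by (simp add: circle_mean_cmult P1)
    also have "norm \<dots> \<le> 6 * (1 - r\<^sup>2) * K * (1 - norm z) powr (\<alpha> / 2 - 1)"
    proof (rule circle_mean_hoelder_kernel[OF h \<alpha> z t0 _ cP _ A])
      have "t0 - z = of_real (1 - r) * t0" by (simp add: z_def algebra_simps)
      then show "norm (t0 - z) \<le> 2 * (1 - norm z)" using t0 r nz by (simp add: norm_mult del: of_real_diff)
      show "norm (P t) \<le> (1 - r\<^sup>2) / (norm (t - z))\<^sup>2" for t
        unfolding P_def norm_of_real nz using A by simp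
    qed
    also have "\<dots> \<le> 6 * (2 * (1 - r)) * K * (1 - norm z) powr (\<alpha> / 2 - 1)"
    proof -
      have "1 - r\<^sup>2 = (1 + r) * (1 - r)" by (simp add: algebra_simps power2_eq_square)
      also have "\<dots> \<le> 2 * (1 - r)" using r by (intro mult_right_mono) auto
      finally show ?thesis using K by (intro mult_right_mono mult_left_mono) auto
    qed
    also have "\<dots> = 12 * K * ((1 - r) * (1 - r) powr (\<alpha> / 2 - 1))" by (simp add: nz)
    also have "(1 - r) * (1 - r) powr (\<alpha> / 2 - 1) = (1 - r) powr (\<alpha> / 2)"
      using r by (simp add: powr_diff)
    finally show ?thesis by (simp add: P_def z_def)
  qed
  have "((\<lambda>r. 12 * K * (1 - r) powr (\<alpha> / 2)) \<longlongrightarrow> 12 * K * (1 - 1) powr (\<alpha> / 2)) (at_left 1)"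
    using \<alpha> by (intro tendsto_intros tendsto_powr') (auto intro!: eventually_mono[OF eventually_at_left_unit])
  then have lim: "((\<lambda>r. 12 * K * (1 - r) powr (\<alpha> / 2)) \<longlongrightarrow> 0) (at_left 1)" by simp
  have "((\<lambda>r. circle_mean (\<lambda>t. h t * ?P r t) - h t0) \<longlongrightarrow> 0) (at_left 1)"
    by (rule Lim_null_comparison[OF eventually_mono[OF eventually_at_left_unit] lim]) (use bd in blast)
  then show ?thesis by (simp add: LIM_zero_iff)
qed

text \<open>Multiplication by \<open>p ^ a\<close> deletes the first \<open>a\<close> terms of the
  geometric series; the deleted terms are the Fourier coefficients that the moment conditions
  address.\<close>

lemma geometric_tail:
  fixes p :: "'a::field"
  assumes "1 - p \<noteq> 0"
  shows "p ^ a * (1 / (1 - p)) = 1 / (1 - p) - (\<Sum>k<a. p ^ k)"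
  using assms by (auto simp: sum_gp_strict diff_divide_distrib)

text \<open>The moment conditions annihilate exactly the Fourier
  coefficients that neither side can produce.\<close>
lemma circle_hoelder_decomposition_aux:
  assumes \<alpha>: "0 < \<alpha>" "\<alpha> \<le> 1" and ac: "0 < a + c"
  shows "\<exists>C\<ge>0. \<forall>K h. circle_hoelder \<alpha> K h \<longrightarrow>
     (\<forall>k. 1 \<le> k \<and> k < a \<longrightarrow> circle_mean (\<lambda>t. h t * inverse t ^ k) = 0) \<longrightarrow>
     (\<forall>k. 1 \<le> k \<and> k < c \<longrightarrow> circle_mean (\<lambda>t. h t * t ^ k) = 0) \<longrightarrow>
     (0 < a \<and> 0 < c \<longrightarrow> circle_mean h = 0) \<longrightarrow>
    (\<exists>u v. continuous_on (cball 0 1) u \<and> u holomorphic_on ball 0 1 \<and> (\<forall>z\<in>cball 0 1. norm (u z) \<le> C * K) \<and>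
      continuous_on (cball 0 1) v \<and> v holomorphic_on ball 0 1 \<and> (\<forall>z\<in>cball 0 1. norm (v z) \<le> C * K) \<and>
      (\<forall>t\<in>sphere 0 1 - {1}. h t = t ^ a * u t + inverse t ^ c * v (inverse t)))"
proof -
  obtain C0 where C0: "0 \<le> C0" and ext: "\<And>K h. circle_hoelder \<alpha> K h \<Longrightarrow>
    (\<exists>u. continuous_on (cball 0 1) u \<and> u holomorphic_on ball 0 1 \<and>
      (\<forall>z\<in>ball 0 1. u z = cauchy_transform h z) \<and> (\<forall>z\<in>cball 0 1. norm (u z) \<le> C0 * K))"
    using cauchy_transform_extension[OF \<alpha>] by (elim exE conjE) simp
  \<comment> \<open>The factor 2 of the product rule times the constant \<open>2 * Suc k\<close> of
    a power, with \<open>k \<le> a + c\<close>.\<close>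
  define m where "m = 4 * real (Suc (a + c))"
  have pow: "circle_hoelder \<alpha> (m * K) (\<lambda>t. inverse t ^ k * g t)" 
    if "circle_hoelder \<alpha> K g" "k \<le> a + c" for K g k
  proof -
    have "circle_hoelder \<alpha> (2 * (2 * real (Suc k)) * K) (\<lambda>t. inverse t ^ k * g t)"
      using \<alpha> by (intro circle_hoelder_mult circle_hoelder_inverse[OF circle_hoelder_power] that) auto
    then show ?thesis
      by (rule circle_hoelder_mono)
         (use that circle_hoelder_nonneg[OF that(1)] in \<open>auto simp: m_def intro!: mult_right_mono\<close>)
  qed
  have "\<exists>u v. continuous_on (cball 0 1) u \<and> u holomorphic_on ball 0 1 \<and> (\<forall>z\<in>cball 0 1. norm (u z) \<le> C0 * m * K) \<and>
      continuous_on (cball 0 1) v \<and> v holomorphic_on ball 0 1 \<and> (\<forall>z\<in>cball 0 1. norm (v z) \<le> C0 * m * K) \<and>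
      (\<forall>t\<in>sphere 0 1 - {1}. h t = t ^ a * u t + inverse t ^ c * v (inverse t))"
    if h: "circle_hoelder \<alpha> K h"
      and ca: "\<And>k. 1 \<le> k \<Longrightarrow> k < a \<Longrightarrow> circle_mean (\<lambda>t. h t * inverse t ^ k) = 0"
      and cb: "\<And>k. 1 \<le> k \<Longrightarrow> k < c \<Longrightarrow> circle_mean (\<lambda>t. h t * t ^ k) = 0"
      and cc: "0 < a \<Longrightarrow> 0 < c \<Longrightarrow> circle_mean h = 0" for K h
  proof -
    have ch: "circle_fun h" using circle_hoelder_circle_fun[OF h \<alpha>(1)] .
    \<comment> \<open>\<open>u\<close> will be the Cauchy transform of \<open>h\<close> with
      \<open>t ^ a\<close> divided out, and \<open>v\<close> that of the reflected \<open>h\<close>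
      with \<open>t ^ c\<close> divided out.\<close>
    define h1 where "h1 t = inverse t ^ a * h t" for t
    define h2 where "h2 t = inverse t ^ c * h (inverse t)" for t
    have h1: "circle_hoelder \<alpha> (m * K) h1" unfolding h1_def by (intro pow h) auto
    have h2: "circle_hoelder \<alpha> (m * K) h2" unfolding h2_def by (intro pow circle_hoelder_inverse h) auto
    obtain u where u: "continuous_on (cball 0 1) u" "u holomorphic_on ball 0 1"
      "\<And>z. z \<in> ball 0 1 \<Longrightarrow> u z = cauchy_transform h1 z" "\<And>z. z \<in> cball 0 1 \<Longrightarrow> norm (u z) \<le> C0 * (m * K)"
      using ext[OF h1] by blast
    obtain v where v: "continuous_on (cball 0 1) v" "v holomorphic_on ball 0 1"
      "\<And>z. z \<in> ball 0 1 \<Longrightarrow> v z = cauchy_transform h2 z" "\<And>z. z \<in> cball 0 1 \<Longrightarrow> norm (v z) \<le> C0 * (m * K)"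
      using ext[OF h2] by blast
    \<comment> \<open>Inside the disc the two pieces, the second taken at \<open>cnj z\<close>, add
      up to the Poisson integral of \<open>h\<close>. Radial limits then give the identity on the
      circle, where conjugation is inversion.\<close>
    have inner: "z ^ a * u z + cnj z ^ c * v (cnj z)
        = circle_mean (\<lambda>t. h t * complex_of_real ((1 - (norm z)\<^sup>2) / (norm (t - z))\<^sup>2))"
      if z: "z \<in> ball 0 1" for z
    proof -
      have cz: "cnj z \<in> ball 0 1" using z by simp
      have ne: "1 - z * inverse t \<noteq> 0" "1 - cnj z * t \<noteq> 0" if "t \<in> sphere 0 1" for t
      proof -
        have "norm (z * inverse t) < 1" "norm (cnj z * t) < 1"
          using that z by (simp_all add: norm_mult norm_inverse)
        then show "1 - z * inverse t \<noteq> 0" "1 - cnj z * t \<noteq> 0" by auto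
      qed
      have c1: "circle_fun (\<lambda>t. 1 / (1 - z * inverse t))"
        using ne by (intro circle_fun_continuous continuous_intros) auto
      have c2: "circle_fun (\<lambda>t. 1 / (1 - cnj z * t))"
        using ne by (intro circle_fun_continuous continuous_intros) auto
      have cp: "circle_fun (\<lambda>t. h t * inverse t ^ k)" "circle_fun (\<lambda>t. h t * t ^ k)" for k
        by (intro circle_fun_mult ch circle_fun_continuous continuous_intros; force)+
      have A1: "z ^ a * u z = circle_mean (\<lambda>t. h t * (1 / (1 - z * inverse t)) - (\<Sum>k<a. z ^ k * (h t * inverse t ^ k)))"
        unfolding u(3)[OF z] cauchy_transform_def h1_def circle_mean_cmult[symmetric]
      proof (rule circle_mean_cong)
        fix t :: complex assume t: "t \<in> sphere 0 1 - {1}"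
        have "t \<noteq> 0" "t - z \<noteq> 0" and n: "1 - z * inverse t \<noteq> 0" using t z ne by auto
        then have "t / (t - z) = 1 / (1 - z * inverse t)" by (simp add: field_simps)
        then have "z ^ a * (inverse t ^ a * h t * (t / (t - z))) = h t * ((z * inverse t) ^ a * (1 / (1 - z * inverse t)))"
          by (simp add: power_mult_distrib)
        also have "\<dots> = h t * (1 / (1 - z * inverse t)) - (\<Sum>k<a. z ^ k * (h t * inverse t ^ k))"
          unfolding geometric_tail[OF n] by (simp only: right_diff_distrib sum_distrib_left power_mult_distrib mult_ac)
        finally show "z ^ a * (inverse t ^ a * h t * (t / (t - z))) = h t * (1 / (1 - z * inverse t)) - (\<Sum>k<a. z ^ k * (h t * inverse t ^ k))" .
      qed
      have "circle_fun (\<lambda>t. t ^ c * h t * (inverse t / (inverse t - cnj z)))"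
      proof (intro circle_fun_mult ch circle_fun_continuous continuous_intros ballI)
        fix t :: complex assume t: "t \<in> sphere 0 1"
        have "norm (inverse t) = 1" using t by (simp add: norm_inverse)
        then show "inverse t - cnj z \<noteq> 0" using cz by auto
      qed auto
      from circle_mean_inverse[OF this]
      have refl: "cauchy_transform h2 (cnj z) = circle_mean (\<lambda>t. t ^ c * h t * (inverse t / (inverse t - cnj z)))"
        by (simp add: cauchy_transform_def h2_def)
      have A2: "cnj z ^ c * v (cnj z) = circle_mean (\<lambda>t. h t * (1 / (1 - cnj z * t)) - (\<Sum>k<c. cnj z ^ k * (h t * t ^ k)))"
        unfolding v(3)[OF cz] refl circle_mean_cmult[symmetric]
      proof (rule circle_mean_cong)
        fix t :: complex assume t: "t \<in> sphere 0 1 - {1}"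
        have t0: "t \<noteq> 0" and n: "1 - cnj z * t \<noteq> 0" using t z ne by auto
        have "inverse t - cnj z = (1 - cnj z * t) / t" using t0 by (simp add: field_simps)
        then have "inverse t / (inverse t - cnj z) = 1 / (1 - cnj z * t)" using t0 by simp
        then have "cnj z ^ c * (t ^ c * h t * (inverse t / (inverse t - cnj z))) = h t * ((cnj z * t) ^ c * (1 / (1 - cnj z * t)))"
          by (simp add: power_mult_distrib)
        also have "\<dots> = h t * (1 / (1 - cnj z * t)) - (\<Sum>k<c. cnj z ^ k * (h t * t ^ k))"
          unfolding geometric_tail[OF n] by (simp only: right_diff_distrib sum_distrib_left power_mult_distrib mult_ac)
        finally show "cnj z ^ c * (t ^ c * h t * (inverse t / (inverse t - cnj z))) = h t * (1 / (1 - cnj z * t)) - (\<Sum>k<c. cnj z ^ k * (h t * t ^ k))" .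
      qed
      have s1: "circle_mean (\<lambda>t. \<Sum>k<a. z ^ k * (h t * inverse t ^ k)) = (if 0 < a then circle_mean h else 0)"
      proof -
        have "circle_mean (\<lambda>t. \<Sum>k<a. z ^ k * (h t * inverse t ^ k)) = (\<Sum>k<a. z ^ k * circle_mean (\<lambda>t. h t * inverse t ^ k))"
          unfolding circle_mean_cmult[symmetric]
          by (intro circle_mean_sum circle_fun_mult[OF circle_fun_const] cp) auto
        also have "\<dots> = (\<Sum>k<a. if k = 0 then circle_mean h else 0)"
          by (intro sum.cong refl) (use ca in auto)
        finally show ?thesis by simp
      qed
      have s2: "circle_mean (\<lambda>t. \<Sum>k<c. cnj z ^ k * (h t * t ^ k)) = (if 0 < c then circle_mean h else 0)"
      proof -
        have "circle_mean (\<lambda>t. \<Sum>k<c. cnj z ^ k * (h t * t ^ k)) = (\<Sum>k<c. cnj z ^ k * circle_mean (\<lambda>t. h t * t ^ k))"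
          unfolding circle_mean_cmult[symmetric]
          by (intro circle_mean_sum circle_fun_mult[OF circle_fun_const] cp) auto
        also have "\<dots> = (\<Sum>k<c. if k = 0 then circle_mean h else 0)"
          by (intro sum.cong refl) (use cb in auto)
        finally show ?thesis by simp
      qed
      have cs: "circle_fun (\<lambda>t. \<Sum>k<a. z ^ k * (h t * inverse t ^ k))" "circle_fun (\<lambda>t. \<Sum>k<c. cnj z ^ k * (h t * t ^ k))"
        by (intro circle_fun_sum circle_fun_mult[OF circle_fun_const] cp)+
      note hk = circle_fun_mult[OF ch c1] circle_fun_mult[OF ch c2]
      have "circle_mean (\<lambda>t. h t * complex_of_real ((1 - (norm z)\<^sup>2) / (norm (t - z))\<^sup>2))
          = circle_mean (\<lambda>t. h t * (1 / (1 - z * inverse t)) + h t * (1 / (1 - cnj z * t)) - h t)"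
        by (rule circle_mean_cong)
           (subst poisson_kernel_decomposition[OF z], auto simp: algebra_simps simp del: of_real_divide)
      also have "\<dots> = circle_mean (\<lambda>t. h t * (1 / (1 - z * inverse t))) + circle_mean (\<lambda>t. h t * (1 / (1 - cnj z * t))) - circle_mean h"
        by (simp only: circle_mean_diff circle_mean_add hk ch circle_fun_add)
      finally have "circle_mean (\<lambda>t. h t * complex_of_real ((1 - (norm z)\<^sup>2) / (norm (t - z))\<^sup>2))
          = circle_mean (\<lambda>t. h t * (1 / (1 - z * inverse t))) + circle_mean (\<lambda>t. h t * (1 / (1 - cnj z * t))) - circle_mean h" .
      moreover have "z ^ a * u z = circle_mean (\<lambda>t. h t * (1 / (1 - z * inverse t))) - (if 0 < a then circle_mean h else 0)"
        unfolding A1 s1[symmetric] by (intro circle_mean_diff hk cs)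
      moreover have "cnj z ^ c * v (cnj z) = circle_mean (\<lambda>t. h t * (1 / (1 - cnj z * t))) - (if 0 < c then circle_mean h else 0)"
        unfolding A2 s2[symmetric] by (intro circle_mean_diff hk cs)
      \<comment> \<open>The coefficient of index 0 occurs in both series and is deleted once for
        each of \<open>a\<close>, \<open>c\<close> that is positive. If exactly one is positive, it
        is counted once, as it should be; if both are, it is zero by \<open>cc\<close>;
        \<open>ac\<close> excludes \<open>a = c = 0\<close>, where it would be counted
        twice.\<close>
      ultimately show ?thesis using cc ac by (auto split: if_splits)
    qed
    have "h t = t ^ a * u t + inverse t ^ c * v (inverse t)" if t: "t \<in> sphere 0 1 - {1}" for t
    proof -
      have it: "cnj t = inverse t"
        using t complex_norm_square[of t] by (intro inverse_unique[symmetric]) simp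
      have it': "inverse t \<in> sphere 0 1 - {1}" using inverse_punctured_circle[OF t] .
      have ru: "((\<lambda>r. u (of_real r * t)) \<longlongrightarrow> u t) (at_left 1)"
        by (rule radial_tendsto[OF _ t]) (rule continuous_on_subset[OF u(1)], auto)
      have rv: "((\<lambda>r. v (of_real r * inverse t)) \<longlongrightarrow> v (inverse t)) (at_left 1)"
        by (rule radial_tendsto[OF _ it']) (rule continuous_on_subset[OF v(1)], auto)
      have "((\<lambda>r. (of_real r * t) ^ a * u (of_real r * t) + (of_real r * inverse t) ^ c * v (of_real r * inverse t))
          \<longlongrightarrow> (of_real 1 * t) ^ a * u t + (of_real 1 * inverse t) ^ c * v (inverse t)) (at_left 1)"
        by (intro tendsto_intros ru rv)
      moreover have "((\<lambda>r. (of_real r * t) ^ a * u (of_real r * t) + (of_real r * inverse t) ^ c * v (of_real r * inverse t))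
          \<longlongrightarrow> h t) (at_left 1)"
      proof (rule Lim_transform_eventually[OF poisson_limit[OF h \<alpha> t]])
        show "\<forall>\<^sub>F r in at_left 1. circle_mean (\<lambda>ta. h ta * complex_of_real ((1 - (norm (of_real r * t))\<^sup>2) / (norm (ta - of_real r * t))\<^sup>2))
            = (of_real r * t) ^ a * u (of_real r * t) + (of_real r * inverse t) ^ c * v (of_real r * inverse t)"
          using eventually_at_left_unit
        proof (rule eventually_mono)
          fix r :: real assume "0 < r \<and> r < 1"
          then have "of_real r * t \<in> ball 0 1" using t by (simp add: norm_mult)
          from inner[OF this] show "circle_mean (\<lambda>ta. h ta * complex_of_real ((1 - (norm (of_real r * t))\<^sup>2) / (norm (ta - of_real r * t))\<^sup>2))
            = (of_real r * t) ^ a * u (of_real r * t) + (of_real r * inverse t) ^ c * v (of_real r * inverse t)"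
            by (simp only: complex_cnj_mult complex_cnj_complex_of_real it)
        qed
      qed
      ultimately show ?thesis using tendsto_unique[of "at_left (1::real)"] by (simp add: trivial_limit_at_left_real)
    qed
    moreover have "norm (u z) \<le> C0 * m * K" "norm (v z) \<le> C0 * m * K" if "z \<in> cball 0 1" for z
      using u(4) v(4) that by (simp_all only: mult.assoc)
    ultimately show ?thesis
      by (rule_tac x=u in exI, rule_tac x=v in exI) (intro conjI ballI u(1,2) v(1,2))
  qed
  moreover have "0 \<le> C0 * m" using C0 by (simp add: m_def)
  ultimately show ?thesis by (intro exI[of _ "C0 * m"] conjI allI impI) simp_all
qed

text \<open>For \<open>a = c = 0\<close> the constant term may go to either piece. The case
  \<open>c = 1\<close>, which carries no moment condition when \<open>a = 0\<close>, assigns it to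
  \<open>u\<close>; the spare factor \<open>inverse t\<close> is then absorbed into
  \<open>v\<close>.\<close>

lemma circle_hoelder_decomposition:
  assumes \<alpha>: "0 < \<alpha>" "\<alpha> \<le> 1"
  shows "\<exists>C\<ge>0. \<forall>K h. circle_hoelder \<alpha> K h \<longrightarrow>
     (\<forall>k. 1 \<le> k \<and> k < a \<longrightarrow> circle_mean (\<lambda>t. h t * inverse t ^ k) = 0) \<longrightarrow>
     (\<forall>k. 1 \<le> k \<and> k < c \<longrightarrow> circle_mean (\<lambda>t. h t * t ^ k) = 0) \<longrightarrow>
     (0 < a \<and> 0 < c \<longrightarrow> circle_mean h = 0) \<longrightarrow>
    (\<exists>u v. continuous_on (cball 0 1) u \<and> u holomorphic_on ball 0 1 \<and> (\<forall>z\<in>cball 0 1. norm (u z) \<le> C * K) \<and>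
      continuous_on (cball 0 1) v \<and> v holomorphic_on ball 0 1 \<and> (\<forall>z\<in>cball 0 1. norm (v z) \<le> C * K) \<and>
      (\<forall>t\<in>sphere 0 1 - {1}. h t = t ^ a * u t + inverse t ^ c * v (inverse t)))"
proof (cases "0 < a + c")
  case True
  then show ?thesis by (rule circle_hoelder_decomposition_aux[OF \<alpha>])
next
  case False
  then have ac: "a = 0" "c = 0" by auto
  obtain C where C: "0 \<le> C" "\<And>K h. circle_hoelder \<alpha> K h \<Longrightarrow>
    (\<exists>u v. continuous_on (cball 0 1) u \<and> u holomorphic_on ball 0 1 \<and> (\<forall>z\<in>cball 0 1. norm (u z) \<le> C * K) \<and>
      continuous_on (cball 0 1) v \<and> v holomorphic_on ball 0 1 \<and> (\<forall>z\<in>cball 0 1. norm (v z) \<le> C * K) \<and>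
      (\<forall>t\<in>sphere 0 1 - {1}. h t = t ^ 0 * u t + inverse t ^ 1 * v (inverse t)))"
    using circle_hoelder_decomposition_aux[OF \<alpha>, of 0 1] by auto
  show ?thesis unfolding ac
  proof (intro exI[of _ C] conjI allI impI C(1))
    fix K h assume "circle_hoelder \<alpha> K h"
    from C(2)[OF this] obtain u v where u: "continuous_on (cball 0 1) u" "u holomorphic_on ball 0 1" "\<forall>z\<in>cball 0 1. norm (u z) \<le> C * K"
      and v: "continuous_on (cball 0 1) v" "v holomorphic_on ball 0 1" "\<forall>z\<in>cball 0 1. norm (v z) \<le> C * K"
      and e: "\<forall>t\<in>sphere 0 1 - {1}. h t = t ^ 0 * u t + inverse t ^ 1 * v (inverse t)" by blast
    show "\<exists>u v. continuous_on (cball 0 1) u \<and> u holomorphic_on ball 0 1 \<and> (\<forall>z\<in>cball 0 1. norm (u z) \<le> C * K) \<and>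
      continuous_on (cball 0 1) v \<and> v holomorphic_on ball 0 1 \<and> (\<forall>z\<in>cball 0 1. norm (v z) \<le> C * K) \<and>
      (\<forall>t\<in>sphere 0 1 - {1}. h t = t ^ 0 * u t + inverse t ^ 0 * v (inverse t))"
    proof (rule exI[of _ u], rule exI[of _ "\<lambda>z. z * v z"], intro conjI u)
      show "continuous_on (cball 0 1) (\<lambda>z. z * v z)" "(\<lambda>z. z * v z) holomorphic_on ball 0 1"
        by (intro continuous_intros holomorphic_intros v)+
      show "\<forall>z\<in>cball 0 1. norm (z * v z) \<le> C * K"
      proof
        fix z :: complex assume z: "z \<in> cball 0 1"
        have "norm (z * v z) \<le> norm (v z)"
          using z mult_left_le_one_le[of "norm (v z)" "norm z"] by (simp add: norm_mult)
        also have "\<dots> \<le> C * K" using v(3) z by blast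
        finally show "norm (z * v z) \<le> C * K" .
      qed
      show "\<forall>t\<in>sphere 0 1 - {1}. h t = t ^ 0 * u t + inverse t ^ 0 * (inverse t * v (inverse t))"
        using e by simp
    qed
  qed
qed

section \<open>Necessity of the moment conditions on the circle\<close>

lemma circle_mean_split_zero:
  assumes "disc_fun u" "disc_fun v" "1 \<le> p" "1 \<le> q"
  shows "circle_mean (\<lambda>t. t ^ p * u t + inverse t ^ q * v (inverse t)) = 0"
proof -
  have c: "circle_fun (\<lambda>t. t ^ p * u t)" "circle_fun (\<lambda>t. t ^ q * v t)"
    by (intro circle_fun_mult disc_fun_circle_fun assms circle_fun_continuous continuous_intros)+
  have "circle_mean (\<lambda>t. t ^ p * u t + inverse t ^ q * v (inverse t))
      = circle_mean (\<lambda>t. t ^ p * u t) + circle_mean (\<lambda>t. inverse t ^ q * v (inverse t))"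
    by (intro circle_mean_add c circle_fun_inverse[OF c(2)])
  also have "circle_mean (\<lambda>t. inverse t ^ q * v (inverse t)) = circle_mean (\<lambda>t. t ^ q * v t)"
    using circle_mean_inverse[OF c(2)] .
  finally show ?thesis using assms by (simp add: disc_fun_mean_zero)
qed

text \<open>After multiplication by the test power, \<open>u\<close> carries a positive power of
  \<open>t\<close> and \<open>v\<close> a positive power of \<open>inverse t\<close>, precisely
  because the index lies strictly between \<open>- c\<close> and \<open>a\<close>; both means are
  then zero.\<close>

lemma circle_decomposition_moments:
  assumes u: "disc_fun u" and v: "disc_fun v"
    and e: "\<And>t. t \<in> sphere 0 1 - {1} \<Longrightarrow> h t = t ^ a * u t + inverse t ^ c * v (inverse t)"
  shows "1 \<le> k \<Longrightarrow> k < a \<Longrightarrow> circle_mean (\<lambda>t. h t * inverse t ^ k) = 0"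
    and "1 \<le> k \<Longrightarrow> k < c \<Longrightarrow> circle_mean (\<lambda>t. h t * t ^ k) = 0"
    and "0 < a \<Longrightarrow> 0 < c \<Longrightarrow> circle_mean h = 0"
proof -
  assume k: "1 \<le> k" "k < a"
  have "circle_mean (\<lambda>t. h t * inverse t ^ k) = circle_mean (\<lambda>t. t ^ (a - k) * u t + inverse t ^ (c + k) * v (inverse t))"
  proof (rule circle_mean_cong)
    fix t :: complex assume t: "t \<in> sphere 0 1 - {1}"
    then have "t ^ a * inverse t ^ k = t ^ (a - k)"
      using k by (subst power_diff) (auto simp: divide_inverse power_inverse)
    moreover have "h t * inverse t ^ k = (t ^ a * inverse t ^ k) * u t + (inverse t ^ c * inverse t ^ k) * v (inverse t)"
      unfolding e[OF t] distrib_right by (simp only: mult_ac)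
    ultimately show "h t * inverse t ^ k = t ^ (a - k) * u t + inverse t ^ (c + k) * v (inverse t)"
      by (simp only: power_add)
  qed
  also have "\<dots> = 0" using k by (intro circle_mean_split_zero u v) auto
  finally show "circle_mean (\<lambda>t. h t * inverse t ^ k) = 0" .
next
  assume k: "1 \<le> k" "k < c"
  have "circle_mean (\<lambda>t. h t * t ^ k) = circle_mean (\<lambda>t. t ^ (a + k) * u t + inverse t ^ (c - k) * v (inverse t))"
  proof (rule circle_mean_cong)
    fix t :: complex assume t: "t \<in> sphere 0 1 - {1}"
    then have "inverse t ^ c * t ^ k = inverse t ^ (c - k)"
      using k by (subst power_diff) (auto simp: divide_inverse power_inverse)
    moreover have "h t * t ^ k = (t ^ a * t ^ k) * u t + (inverse t ^ c * t ^ k) * v (inverse t)"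
      unfolding e[OF t] distrib_right by (simp only: mult_ac)
    ultimately show "h t * t ^ k = t ^ (a + k) * u t + inverse t ^ (c - k) * v (inverse t)"
      by (simp only: power_add)
  qed
  also have "\<dots> = 0" using k by (intro circle_mean_split_zero u v) auto
  finally show "circle_mean (\<lambda>t. h t * t ^ k) = 0" .
next
  assume k: "0 < a" "0 < c"
  have "circle_mean h = circle_mean (\<lambda>t. t ^ a * u t + inverse t ^ c * v (inverse t))"
    by (rule circle_mean_cong) (rule e)
  also have "\<dots> = 0" using k by (intro circle_mean_split_zero u v) auto
  finally show "circle_mean h = 0" .
qed

section \<open>From the line to the circle\<close>

definition cayley_inv :: "complex \<Rightarrow> complex" where
  "cayley_inv w = \<i> * (1 + w) / (1 - w)"

text \<open>Reflection exchanges the half-planes and becomes inversion, so minus functions can be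
  handled as plus functions. At \<open>\<i>\<close> and \<open>- \<i>\<close> both sides are 0 by
  the convention for division by zero.\<close>

lemma bfun_uminus: "bfun (- z) = inverse (bfun z)"
proof -
  have "- z - \<i> = - (z + \<i>)" "- z + \<i> = - (z - \<i>)" by auto
  then show ?thesis unfolding bfun_def inverse_divide by (simp only: minus_divide_divide)
qed

lemma upper_cl_ne: "z \<in> upper_cl \<Longrightarrow> z + \<i> \<noteq> 0"
  by (auto simp: upper_cl_def complex_eq_iff)

lemma bfun_upper_cl:
  assumes "z \<in> upper_cl"
  shows "bfun z \<in> cball 0 1 - {1}"
proof -
  have ne: "z + \<i> \<noteq> 0" using upper_cl_ne[OF assms] .
  have "(norm (z - \<i>))\<^sup>2 \<le> (norm (z + \<i>))\<^sup>2"
    unfolding cmod_power2 using assms by (simp add: upper_cl_def power2_eq_square algebra_simps)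
  then have "norm (z - \<i>) \<le> norm (z + \<i>)" using norm_ge_zero power2_le_imp_le by blast
  then have "norm (bfun z) \<le> 1" using ne by (simp add: bfun_def norm_divide divide_le_eq)
  moreover have "bfun z \<noteq> 1"
  proof
    assume "bfun z = 1"
    then have "z - \<i> = z + \<i>" using ne by (simp add: bfun_def)
    then show False by (simp add: complex_eq_iff)
  qed
  ultimately show ?thesis by simp
qed

lemma bfun_upper_hp:
  assumes "z \<in> upper_hp"
  shows "bfun z \<in> ball 0 1"
proof -
  have ne: "z + \<i> \<noteq> 0" using assms by (intro upper_cl_ne) (auto simp: upper_hp_def upper_cl_def)
  have "(norm (z - \<i>))\<^sup>2 < (norm (z + \<i>))\<^sup>2"
    unfolding cmod_power2 using assms by (simp add: upper_hp_def power2_eq_square algebra_simps)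
  then have "norm (z - \<i>) < norm (z + \<i>)" using norm_ge_zero power2_less_imp_less by blast
  then show ?thesis using ne by (simp add: bfun_def norm_divide divide_less_eq)
qed

lemma bfun_real: "bfun (of_real x) \<in> sphere 0 1 - {1}"
proof -
  have "bfun (of_real x) \<in> cball 0 1 - {1}" by (intro bfun_upper_cl) (simp add: upper_cl_def)
  moreover have "norm (complex_of_real x - \<i>) = norm (complex_of_real x + \<i>)" "complex_of_real x + \<i> \<noteq> 0"
    by (auto simp: cmod_def complex_eq_iff)
  then have "norm (bfun (of_real x)) = 1" by (simp add: bfun_def norm_divide)
  ultimately show ?thesis by simp
qed

lemma cayley_inv_bfun: "z + \<i> \<noteq> 0 \<Longrightarrow> cayley_inv (bfun z) = z"
proof -
  assume ne: "z + \<i> \<noteq> 0"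
  have "1 + bfun z = 2 * z / (z + \<i>)" "1 - bfun z = 2 * \<i> / (z + \<i>)"
    using ne by (auto simp: bfun_def field_simps)
  then show ?thesis using ne by (simp add: cayley_inv_def)
qed

lemma bfun_cayley_inv: "w \<noteq> 1 \<Longrightarrow> bfun (cayley_inv w) = w"
proof -
  assume "w \<noteq> 1"
  then have ne: "1 - w \<noteq> 0" by simp
  have "cayley_inv w - \<i> = 2 * \<i> * w / (1 - w)" "cayley_inv w + \<i> = 2 * \<i> / (1 - w)"
    using ne by (auto simp: cayley_inv_def field_simps)
  then show ?thesis using ne by (simp add: bfun_def)
qed

lemma Im_cayley_inv: "Im (cayley_inv w) = (1 - (norm w)\<^sup>2) / (norm (1 - w))\<^sup>2"
  unfolding cayley_inv_def cmod_power2
  by (simp add: Im_divide power2_eq_square) (simp add: algebra_simps)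

lemma cayley_inv_upper_cl: "w \<in> cball 0 1 \<Longrightarrow> cayley_inv w \<in> upper_cl"
  by (simp add: upper_cl_def Im_cayley_inv power_le_one)

lemma cayley_inv_upper_hp: "w \<in> ball 0 1 \<Longrightarrow> cayley_inv w \<in> upper_hp"
  by (auto simp: upper_hp_def Im_cayley_inv power_less_one_iff abs_square_less_1 intro!: divide_pos_pos)

lemma cayley_inv_real:
  assumes "t \<in> sphere 0 1 - {1}"
  shows "complex_of_real (Re (cayley_inv t)) = cayley_inv t"
  using assms by (simp add: complex_eq_iff Im_cayley_inv)

lemma bfun_Re_cayley_inv:
  "t \<in> sphere 0 1 - {1} \<Longrightarrow> bfun (of_real (Re (cayley_inv t))) = t"
  by (simp only: cayley_inv_real) (auto simp: bfun_cayley_inv)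

lemma Re_cayley_inv_bfun: "Re (cayley_inv (bfun (of_real x))) = x"
  by (subst cayley_inv_bfun) (auto simp: complex_eq_iff)

lemma cayley_inv_inverse:
  assumes "t \<in> sphere 0 1 - {1}"
  shows "cayley_inv (inverse t) = - cayley_inv t"
proof -
  have "cayley_inv (inverse t) = cayley_inv (bfun (- cayley_inv t))"
    using assms by (simp add: bfun_uminus bfun_cayley_inv)
  also have "\<dots> = - cayley_inv t"
    using assms by (intro cayley_inv_bfun) (auto simp: complex_eq_iff Im_cayley_inv)
  finally show ?thesis .
qed

lemma cayley_inv_continuous: "continuous_on (cball 0 1 - {1}) cayley_inv"
  unfolding cayley_inv_def by (intro continuous_intros) auto

lemma cayley_inv_holomorphic: "cayley_inv holomorphic_on ball 0 1"
  unfolding cayley_inv_def by (intro holomorphic_intros) auto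

section \<open>Transfer of function classes between the half-planes and the disc\<close>

lemma norm_matrix_entry_le: "norm (A $ i $ j) \<le> norm (A :: 'a::real_normed_vector ^ 'n ^ 'm)"
  by (rule order_trans[OF Finite_Cartesian_Product.norm_nth_le Finite_Cartesian_Product.norm_nth_le])

lemma plus_fun_disc_fun:
  assumes "plus_fun F"
  shows "disc_fun (\<lambda>w. F (cayley_inv w) $ i $ j)"
proof -
  have F: "continuous_on upper_cl F" "bounded (F ` upper_cl)" "(\<lambda>z. F z $ i $ j) holomorphic_on upper_hp"
    using assms by (auto simp: plus_fun_def cont_bdd_analytic_def)
  obtain B where B: "\<And>z. z \<in> upper_cl \<Longrightarrow> norm (F z) \<le> B" using F(2) unfolding bounded_iff by blast
  have "continuous_on (cball 0 1 - {1}) (\<lambda>w. F (cayley_inv w))"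
    by (rule continuous_on_compose2[OF F(1) cayley_inv_continuous]) (auto intro: cayley_inv_upper_cl)
  then have "continuous_on (cball 0 1 - {1}) (\<lambda>w. F (cayley_inv w) $ i $ j)"
    by (intro continuous_intros)
  moreover have "(\<lambda>w. F (cayley_inv w) $ i $ j) holomorphic_on ball 0 1"
    using holomorphic_on_compose_gen[OF cayley_inv_holomorphic F(3)] cayley_inv_upper_hp
    by (auto simp: o_def image_subset_iff)
  moreover have "norm (F (cayley_inv w) $ i $ j) \<le> B" if "w \<in> cball 0 1 - {1}" for w
    using order_trans[OF norm_matrix_entry_le B[OF cayley_inv_upper_cl]] that by blast
  ultimately show ?thesis unfolding disc_fun_def bounded_iff by blast
qed

lemma minus_fun_iff_plus_fun: "minus_fun F \<longleftrightarrow> plus_fun (\<lambda>z. F (- z))"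
proof -
  have img: "uminus ` upper_cl = lower_cl" "uminus ` lower_cl = upper_cl"
    "uminus ` upper_hp = lower_hp" "uminus ` lower_hp = upper_hp"
    by (auto simp: upper_cl_def lower_cl_def upper_hp_def lower_hp_def intro!: image_eqI[of _ uminus "- x" for x])
  have c: "continuous_on T (\<lambda>z. G (- z))" if "continuous_on S G" "uminus ` T \<subseteq> S"
    for S T and G :: "complex \<Rightarrow> 'a cmat"
    by (rule continuous_on_compose2[OF that(1) _ that(2)]) (intro continuous_intros)
  have h: "(\<lambda>z. g (- z)) holomorphic_on T" if "g holomorphic_on S" "uminus ` T \<subseteq> S" for S T and g :: "complex \<Rightarrow> complex"
    by (rule holomorphic_on_compose_gen[OF _ that(1) that(2), unfolded o_def]) (intro holomorphic_intros)
  have b: "F ` lower_cl = (\<lambda>z. F (- z)) ` upper_cl"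
    unfolding img(1)[symmetric] by (simp add: image_image)
  show ?thesis
    unfolding minus_fun_def plus_fun_def cont_bdd_analytic_def b
    using c[of lower_cl F upper_cl] c[of upper_cl "\<lambda>z. F (- z)" lower_cl]
      h[of "\<lambda>z. F z $ i $ j" lower_hp upper_hp for i j] h[of "\<lambda>z. F (- z) $ i $ j" upper_hp lower_hp for i j] img
    by auto
qed

lemma norm_matrix_le_sum: "norm (A :: 'a::real_normed_vector ^ 'n ^ 'm) \<le> (\<Sum>i\<in>UNIV. \<Sum>j\<in>UNIV. norm (A $ i $ j))"
proof -
  have "norm A \<le> (\<Sum>i\<in>UNIV. norm (A $ i))" unfolding norm_vec_def by (rule L2_set_le_sum) auto
  also have "\<dots> \<le> (\<Sum>i\<in>UNIV. \<Sum>j\<in>UNIV. norm (A $ i $ j))"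
    unfolding norm_vec_def[of "A $ i" for i] by (intro sum_mono L2_set_le_sum) auto
  finally show ?thesis .
qed

lemma norm_matrix_le_entries:
  fixes A :: "'a::real_normed_vector ^ 'n ^ 'm"
  assumes "\<And>i j. norm (A $ i $ j) \<le> B"
  shows "norm A \<le> real (CARD('m) * CARD('n)) * B"
proof -
  have "norm A \<le> (\<Sum>i\<in>(UNIV :: 'm set). \<Sum>j\<in>(UNIV :: 'n set). B)"
    by (rule order_trans[OF norm_matrix_le_sum]) (intro sum_mono assms)
  then show ?thesis by simp
qed

lemma bfun_continuous: "continuous_on upper_cl bfun"
  unfolding bfun_def using upper_cl_ne by (intro continuous_intros) auto

lemma bfun_holomorphic: "bfun holomorphic_on upper_hp"
  unfolding bfun_def using upper_cl_ne
  by (intro holomorphic_intros) (auto simp: upper_cl_def upper_hp_def)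

lemma plus_fun_from_disc:
  fixes u :: "'n::finite \<Rightarrow> 'n \<Rightarrow> complex \<Rightarrow> complex"
  assumes u: "\<And>i j. continuous_on (cball 0 1) (u i j)" "\<And>i j. u i j holomorphic_on ball 0 1"
  shows "plus_fun (\<lambda>z. \<chi> i j. u i j (bfun z))"
proof -
  have comp: "continuous_on upper_cl (\<lambda>z. u i j (bfun z))" for i j
    by (rule continuous_on_compose2[OF u(1) bfun_continuous]) (use bfun_upper_cl in blast)
  have hol: "(\<lambda>z. u i j (bfun z)) holomorphic_on upper_hp" for i j
    using holomorphic_on_compose_gen[OF bfun_holomorphic u(2)] bfun_upper_hp
    by (auto simp: o_def image_subset_iff)
  have "bounded (u i j ` cball 0 1)" for i j
    by (intro compact_imp_bounded compact_continuous_image u compact_cball)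
  then have "\<forall>i j. \<exists>B. \<forall>z\<in>cball 0 1. norm (u i j z) \<le> B" unfolding bounded_iff by blast
  then obtain B where B: "\<And>i j z. z \<in> cball 0 1 \<Longrightarrow> norm (u i j z) \<le> B i j" by metis
  have "norm (\<chi> i j. u i j (bfun z)) \<le> (\<Sum>i\<in>UNIV. \<Sum>j\<in>UNIV. B i j)" if "z \<in> upper_cl" for z
    using B bfun_upper_cl[OF that] by (intro order_trans[OF norm_matrix_le_sum] sum_mono) auto
  then have "bounded ((\<lambda>z. \<chi> i j. u i j (bfun z)) ` upper_cl)" unfolding bounded_iff by blast
  then show ?thesis
    unfolding plus_fun_def cont_bdd_analytic_def
    using comp hol by (auto intro!: continuous_on_vec_lambda)
qed

text \<open>The Hoelder estimate on the line is measured in the distance of the images under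
  \<open>bfun\<close>, which is the distance on the circle; constant and exponent carry over
  unchanged.\<close>

lemma hoelder_bounded_circle_hoelder:
  assumes "hoelder_bounded \<mu> K f"
  shows "circle_hoelder \<mu> K (\<lambda>t. f (Re (cayley_inv t)) $ i $ j)"
  unfolding circle_hoelder_def
proof (intro conjI ballI)
  fix t :: complex assume t: "t \<in> sphere 0 1 - {1}"
  show "norm (f (Re (cayley_inv t)) $ i $ j) \<le> K"
    using assms order_trans[OF norm_matrix_entry_le] unfolding hoelder_bounded_def by blast
  fix t' :: complex assume t': "t' \<in> sphere 0 1 - {1}"
  have "norm (f (Re (cayley_inv t)) $ i $ j - f (Re (cayley_inv t')) $ i $ j)
      \<le> norm (f (Re (cayley_inv t)) - f (Re (cayley_inv t')))"
    using norm_matrix_entry_le[of "f (Re (cayley_inv t)) - f (Re (cayley_inv t'))" i j] by simp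
  also have "\<dots> \<le> K * norm (bfun (of_real (Re (cayley_inv t))) - bfun (of_real (Re (cayley_inv t')))) powr \<mu>"
    using assms by (simp add: hoelder_bounded_def)
  also have "\<dots> = K * norm (t - t') powr \<mu>" by (simp only: bfun_Re_cayley_inv[OF t] bfun_Re_cayley_inv[OF t'])
  finally show "norm (f (Re (cayley_inv t)) $ i $ j - f (Re (cayley_inv t')) $ i $ j) \<le> K * norm (t - t') powr \<mu>" .
qed

section \<open>Line integrals as moments on the circle\<close>

lemma cis_arctan_bfun: "cis (2 * pi * (arctan x / pi + 1 / 2)) = bfun (of_real x)"
proof -
  have s: "sqrt (1 + x\<^sup>2) \<noteq> 0" "(sqrt (1 + x\<^sup>2))\<^sup>2 = 1 + x\<^sup>2"
    by (auto simp: add_nonneg_eq_0_iff)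
  \<comment> \<open>The argument of \<open>b x\<close> is \<open>pi + 2 * arctan x\<close>, because
    \<open>b x = - (1 + \<i> * x) / (1 - \<i> * x)\<close>.\<close>
  have "2 * pi * (arctan x / pi + 1 / 2) = pi + (arctan x + arctan x)" by (simp add: field_simps)
  then have "cis (2 * pi * (arctan x / pi + 1 / 2)) = - (cis (arctan x))\<^sup>2"
    by (simp only: cis_mult[symmetric]) (simp add: power2_eq_square)
  also have "cis (arctan x) = (1 + \<i> * of_real x) / of_real (sqrt (1 + x\<^sup>2))"
    by (auto simp: complex_eq_iff cos_arctan sin_arctan)
  also have "- (\<dots>)\<^sup>2 = - ((1 + \<i> * of_real x)\<^sup>2 / of_real (1 + x\<^sup>2))"
    by (simp only: power_divide of_real_power[symmetric] s)
  also have "of_real (1 + x\<^sup>2) = (1 + \<i> * of_real x) * (1 - \<i> * of_real x)"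
    by (simp add: algebra_simps power2_eq_square)
  also have "- ((1 + \<i> * of_real x)\<^sup>2 / ((1 + \<i> * of_real x) * (1 - \<i> * of_real x))) = bfun (of_real x)"
  proof -
    have n: "complex_of_real x - \<i> \<noteq> 0" "complex_of_real x + \<i> \<noteq> 0"
      by (auto simp: complex_eq_iff)
    have e: "1 + \<i> * complex_of_real x = \<i> * (complex_of_real x - \<i>)"
      "1 - \<i> * complex_of_real x = - (\<i> * (complex_of_real x + \<i>))"
      by (auto simp: algebra_simps)
    show ?thesis unfolding bfun_def power2_eq_square e using n by (simp add: divide_simps)
  qed
  finally show ?thesis .
qed

lemma arctan_image: "(\<lambda>x. arctan x / pi + 1 / 2) ` UNIV = {0<..<1}"
proof
  show "(\<lambda>x. arctan x / pi + 1 / 2) ` UNIV \<subseteq> {0<..<1}"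
  proof (clarify)
    fix x
    have "- (1 / 2) < arctan x / pi" "arctan x / pi < 1 / 2"
      using arctan_bounded[of x] by (auto simp: field_simps)
    then show "arctan x / pi + 1 / 2 \<in> {0<..<1}" unfolding greaterThanLessThan_iff by linarith
  qed
  show "{0<..<1} \<subseteq> (\<lambda>x. arctan x / pi + 1 / 2) ` UNIV"
  proof
    fix s :: real assume s: "s \<in> {0<..<1}"
    have "- (pi / 2) < pi * (s - 1 / 2)" "pi * (s - 1 / 2) < pi / 2"
      using s by (auto simp: field_simps)
    then have "arctan (tan (pi * (s - 1 / 2))) = pi * (s - 1 / 2)" by (intro arctan_tan) auto
    then have "s = arctan (tan (pi * (s - 1 / 2))) / pi + 1 / 2" by simp
    then show "s \<in> (\<lambda>x. arctan x / pi + 1 / 2) ` UNIV" by blast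
  qed
qed

text \<open>The substitution \<open>s = arctan x / pi + 1 / 2\<close> has density
  \<open>1 / (pi * (1 + x^2))\<close>: normalized arc length becomes the Cauchy distribution on the
  line.\<close>

lemma integral_line_circle_mean:
  fixes g :: "complex \<Rightarrow> complex"
  assumes g: "circle_fun g"
  shows "integral UNIV (\<lambda>x::real. g (bfun (of_real x)) / of_real (x\<^sup>2 + 1)) = of_real pi * circle_mean g"
proof -
  let ?w = "\<lambda>x::real. 1 / (pi * (1 + x\<^sup>2))"
  have "(\<lambda>x. \<bar>?w x\<bar> *\<^sub>R g (cis (2 * pi * (arctan x / pi + 1 / 2)))) absolutely_integrable_on UNIV \<and>
      integral UNIV (\<lambda>x. \<bar>?w x\<bar> *\<^sub>R g (cis (2 * pi * (arctan x / pi + 1 / 2)))) = circle_mean g"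
  proof (subst has_absolute_integral_change_of_variables_real
          [where g="\<lambda>x. arctan x / pi + 1 / 2" and f="\<lambda>s. g (cis (2 * pi * s))"])
    show "((\<lambda>x. arctan x / pi + 1 / 2) has_field_derivative ?w x) (at x within UNIV)" for x :: real
    proof (rule DERIV_cong)
      show "((\<lambda>x. arctan x / pi + 1 / 2) has_field_derivative inverse (1 + x\<^sup>2) / pi + 0) (at x)"
        by (intro DERIV_add DERIV_cdivide DERIV_arctan DERIV_const)
      show "inverse (1 + x\<^sup>2) / pi + 0 = ?w x"
        by (simp only: divide_inverse inverse_mult_distrib mult_ac add_0_right mult_1_left)
    qed
    show "inj (\<lambda>x. arctan x / pi + 1 / 2)" by (rule injI) (simp add: arctan_eq_iff)
    show "(\<lambda>s. g (cis (2 * pi * s))) absolutely_integrable_on (\<lambda>x. arctan x / pi + 1 / 2) ` UNIV \<and>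
      integral ((\<lambda>x. arctan x / pi + 1 / 2) ` UNIV) (\<lambda>s. g (cis (2 * pi * s))) = circle_mean g"
      unfolding arctan_image using circle_fun_absolutely_integrable[OF g] by (simp add: circle_mean_def)
  qed auto
  then have "circle_mean g = integral UNIV (\<lambda>x. \<bar>?w x\<bar> *\<^sub>R g (bfun (of_real x)))"
    unfolding cis_arctan_bfun by (elim conjE) (rule sym)
  also have "(\<lambda>x. \<bar>?w x\<bar> *\<^sub>R g (bfun (of_real x))) = (\<lambda>x. inverse (of_real pi) * (g (bfun (of_real x)) / of_real (x\<^sup>2 + 1)))"
  proof
    fix x :: real
    have "\<bar>?w x\<bar> = inverse pi * inverse (x\<^sup>2 + 1)"
    proof -
      have "0 < ?w x" by (simp add: add_pos_nonneg)
      then have "\<bar>?w x\<bar> = ?w x" by (rule abs_of_pos)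
      also have "?w x = inverse pi * inverse (x\<^sup>2 + 1)"
        by (simp only: divide_inverse inverse_mult_distrib add.commute mult_1_left)
      finally show ?thesis .
    qed
    then show "\<bar>?w x\<bar> *\<^sub>R g (bfun (of_real x)) = inverse (of_real pi) * (g (bfun (of_real x)) / of_real (x\<^sup>2 + 1))"
      by (simp only: scaleR_conv_of_real divide_inverse of_real_mult of_real_inverse mult_ac)
  qed
  also have "integral UNIV \<dots> = inverse (of_real pi) * integral UNIV (\<lambda>x. g (bfun (of_real x)) / of_real (x\<^sup>2 + 1))"
    by (rule integral_mult_right)
  finally show ?thesis by simp
qed

text \<open>By the binomial theorem the powers of \<open>p + d\<close> up to order \<open>k\<close>
  are combinations of the powers of \<open>p\<close> up to the same order, so the vanishing of all
  moments below \<open>n\<close> survives a shift.\<close>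

lemma circle_mean_power_shift:
  assumes g: "circle_fun g" and p: "circle_fun p"
    and z: "\<And>k. k < n \<Longrightarrow> circle_mean (\<lambda>t. g t * p t ^ k) = 0" and k: "k < n"
  shows "circle_mean (\<lambda>t. g t * (p t + d) ^ k) = (0::complex)"
proof -
  have pk: "circle_fun (\<lambda>t. p t ^ k)" for k
    by (induction k) (auto intro: circle_fun_const circle_fun_mult p)
  have "circle_mean (\<lambda>t. g t * (p t + d) ^ k) = circle_mean (\<lambda>t. \<Sum>j\<le>k. (of_nat (k choose j) * d ^ (k - j)) * (g t * p t ^ j))"
    by (intro circle_mean_cong) (simp only: binomial_ring sum_distrib_left mult_ac)
  also have "\<dots> = (\<Sum>j\<le>k. (of_nat (k choose j) * d ^ (k - j)) * circle_mean (\<lambda>t. g t * p t ^ j))"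
    unfolding circle_mean_cmult[symmetric]
    by (intro circle_mean_sum circle_fun_mult[OF circle_fun_const] circle_fun_mult g pk) auto
  also have "\<dots> = 0" using z k by (intro sum.neutral) auto
  finally show ?thesis .
qed

lemma circle_mean_power_shift_iff:
  assumes g: "circle_fun g" and p: "circle_fun p"
  shows "(\<forall>k<n. circle_mean (\<lambda>t. g t * (p t + d) ^ k) = (0::complex)) \<longleftrightarrow>
    (\<forall>k<n. circle_mean (\<lambda>t. g t * p t ^ k) = 0)"
proof
  assume "\<forall>k<n. circle_mean (\<lambda>t. g t * (p t + d) ^ k) = 0"
  then have "circle_mean (\<lambda>t. g t * (p t + d + (- d)) ^ k) = 0" if "k < n" for k
    using that by (intro circle_mean_power_shift[OF g circle_fun_add[OF p circle_fun_const]]) auto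
  then show "\<forall>k<n. circle_mean (\<lambda>t. g t * p t ^ k) = 0" by simp
next
  assume "\<forall>k<n. circle_mean (\<lambda>t. g t * p t ^ k) = 0"
  then show "\<forall>k<n. circle_mean (\<lambda>t. g t * (p t + d) ^ k) = 0"
    using circle_mean_power_shift[OF g p] by blast
qed

text \<open>On the line, \<open>inverse (b x) - 1 = 2 * \<i> / (x - \<i>)\<close> and \<open>1 - b x = 2 * \<i> / (x + \<i>)\<close>, so the
  integrals of the theorem are moments of the circle function.\<close>
lemma line_integral_plus:
  assumes g: "circle_fun g"
  shows "integral UNIV (\<lambda>x::real. g (bfun (of_real x)) / (of_real x - \<i>) ^ (k + 2))
    = of_real pi / (2 * \<i>) ^ k * circle_mean (\<lambda>t. (g t * inverse t) * (inverse t + (-1)) ^ k)"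
proof -
  have "integral UNIV (\<lambda>x::real. g (bfun (of_real x)) / (of_real x - \<i>) ^ (k + 2))
     = integral UNIV (\<lambda>x::real. (1 / (2 * \<i>) ^ k * (g (bfun (of_real x)) * inverse (bfun (of_real x)) * (inverse (bfun (of_real x)) + (-1)) ^ k)) / of_real (x\<^sup>2 + 1))"
  proof (rule integral_cong)
    fix x :: real
    let ?x = "complex_of_real x"
    have n: "?x - \<i> \<noteq> 0" "?x + \<i> \<noteq> 0" by (auto simp: complex_eq_iff)
    have q: "of_real (x\<^sup>2 + 1) = (?x - \<i>) * (?x + \<i>)" by (simp add: algebra_simps power2_eq_square)
    have i: "inverse (bfun ?x) = (?x + \<i>) / (?x - \<i>)" by (simp add: bfun_def)
    have i1: "inverse (bfun ?x) + (-1) = 2 * \<i> / (?x - \<i>)" unfolding i using n by (simp add: field_simps)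
    have "1 / (2 * \<i>) ^ k * (g (bfun ?x) * inverse (bfun ?x) * (inverse (bfun ?x) + (-1)) ^ k) / of_real (x\<^sup>2 + 1)
        = g (bfun ?x) * ((?x + \<i>) / (?x - \<i>) / ((?x - \<i>) * (?x + \<i>))) * (1 / (2 * \<i>) ^ k * (2 * \<i> / (?x - \<i>)) ^ k)"
      unfolding i1 q by (simp add: i)
    also have "1 / (2 * \<i>) ^ k * (2 * \<i> / (?x - \<i>)) ^ k = 1 / (?x - \<i>) ^ k" by (simp add: power_divide)
    \<comment> \<open>The weight \<open>1 / (x^2 + 1)\<close> times \<open>inverse (b x)\<close> is
      \<open>1 / (x - \<i>)^2\<close>; this accounts for the extra factor \<open>inverse t\<close>
      and for the exponent \<open>k + 2\<close>.\<close>
    also have "(?x + \<i>) / (?x - \<i>) / ((?x - \<i>) * (?x + \<i>)) = 1 / (?x - \<i>)\<^sup>2"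
      using n by (simp add: power2_eq_square)
    also have "g (bfun ?x) * (1 / (?x - \<i>)\<^sup>2) * (1 / (?x - \<i>) ^ k) = g (bfun ?x) / (?x - \<i>) ^ (k + 2)"
      unfolding power_add by (simp add: mult.commute)
    finally show "g (bfun ?x) / (?x - \<i>) ^ (k + 2)
        = 1 / (2 * \<i>) ^ k * (g (bfun ?x) * inverse (bfun ?x) * (inverse (bfun ?x) + (-1)) ^ k) / of_real (x\<^sup>2 + 1)"
      by (rule sym)
  qed
  also have "\<dots> = of_real pi * circle_mean (\<lambda>t. 1 / (2 * \<i>) ^ k * (g t * inverse t * (inverse t + (-1)) ^ k))"
    by (rule integral_line_circle_mean)
       (intro circle_fun_mult g circle_fun_const circle_fun_continuous continuous_intros; force)
  finally show ?thesis unfolding circle_mean_cmult by simp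
qed

lemma line_integral_minus:
  assumes g: "circle_fun g"
  shows "integral UNIV (\<lambda>x::real. g (bfun (of_real x)) / (of_real x + \<i>) ^ (k + 2))
    = of_real pi / (- 2 * \<i>) ^ k * circle_mean (\<lambda>t. (g t * t) * (t + (-1)) ^ k)"
proof -
  have "integral UNIV (\<lambda>x::real. g (bfun (of_real x)) / (of_real x + \<i>) ^ (k + 2))
     = integral UNIV (\<lambda>x::real. (1 / (- 2 * \<i>) ^ k * (g (bfun (of_real x)) * bfun (of_real x) * (bfun (of_real x) + (-1)) ^ k)) / of_real (x\<^sup>2 + 1))"
  proof (rule integral_cong)
    fix x :: real
    let ?x = "complex_of_real x"
    have n: "?x - \<i> \<noteq> 0" "?x + \<i> \<noteq> 0" by (auto simp: complex_eq_iff)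
    have q: "of_real (x\<^sup>2 + 1) = (?x - \<i>) * (?x + \<i>)" by (simp add: algebra_simps power2_eq_square)
    have i: "bfun ?x = (?x - \<i>) / (?x + \<i>)" by (simp add: bfun_def)
    have i1: "bfun ?x + (-1) = - 2 * \<i> / (?x + \<i>)" unfolding i using n by (simp add: field_simps)
    have "1 / (- 2 * \<i>) ^ k * (g (bfun ?x) * bfun ?x * (bfun ?x + (-1)) ^ k) / of_real (x\<^sup>2 + 1)
        = g (bfun ?x) * (bfun ?x / ((?x - \<i>) * (?x + \<i>))) * (1 / (- 2 * \<i>) ^ k * (- 2 * \<i> / (?x + \<i>)) ^ k)"
      unfolding i1 q by simp
    also have "1 / (- 2 * \<i>) ^ k * (- 2 * \<i> / (?x + \<i>)) ^ k = 1 / (?x + \<i>) ^ k"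
      unfolding power_divide by simp
    also have "bfun ?x / ((?x - \<i>) * (?x + \<i>)) = 1 / (?x + \<i>)\<^sup>2"
      unfolding i using n by (simp add: power2_eq_square)
    also have "g (bfun ?x) * (1 / (?x + \<i>)\<^sup>2) * (1 / (?x + \<i>) ^ k) = g (bfun ?x) / (?x + \<i>) ^ (k + 2)"
      unfolding power_add by (simp add: mult.commute)
    finally show "g (bfun ?x) / (?x + \<i>) ^ (k + 2)
        = 1 / (- 2 * \<i>) ^ k * (g (bfun ?x) * bfun ?x * (bfun ?x + (-1)) ^ k) / of_real (x\<^sup>2 + 1)"
      by (rule sym)
  qed
  also have "\<dots> = of_real pi * circle_mean (\<lambda>t. 1 / (- 2 * \<i>) ^ k * (g t * t * (t + (-1)) ^ k))"
    by (rule integral_line_circle_mean)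
       (intro circle_fun_mult g circle_fun_const circle_fun_continuous continuous_intros)
  finally show ?thesis unfolding circle_mean_cmult by simp
qed

lemma all_ge_1_less_iff:
  "(\<forall>r::nat. 1 \<le> r \<and> r < a \<longrightarrow> P r) \<longleftrightarrow> (\<forall>k<a - 1. P (Suc k))"
proof (intro iffI allI impI)
  fix r assume A: "\<forall>k<a - 1. P (Suc k)" "1 \<le> r \<and> r < a"
  then obtain k where "r = Suc k" by (cases r) auto
  with A show "P r" by auto
qed auto

text \<open>The index \<open>r = k + 1\<close> on the line corresponds to
  \<open>(inverse t - 1) ^ k\<close> with weight \<open>inverse t\<close>. The shift turns these
  into pure powers, and the weight raises the exponents to the range from 1 to
  \<open>a - 1\<close>.\<close>

lemma moments_plus_iff:
  assumes g: "circle_fun g"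
  shows "(\<forall>r::nat. 1 \<le> r \<and> r < a \<longrightarrow>
      integral UNIV (\<lambda>x::real. g (bfun (of_real x)) / (of_real x - \<i>) ^ (r + 1)) = 0) \<longleftrightarrow>
    (\<forall>k. 1 \<le> k \<and> k < a \<longrightarrow> circle_mean (\<lambda>t. g t * inverse t ^ k) = 0)"
proof -
  have ci: "circle_fun (\<lambda>t::complex. inverse t)" by (intro circle_fun_continuous continuous_intros) auto
  have "(\<forall>k<a - 1. integral UNIV (\<lambda>x::real. g (bfun (of_real x)) / (of_real x - \<i>) ^ (Suc k + 1)) = 0) \<longleftrightarrow>
    (\<forall>k<a - 1. circle_mean (\<lambda>t. (g t * inverse t) * (inverse t + (-1)) ^ k) = 0)"
    using line_integral_plus[OF g] by simp
  also have "\<dots> \<longleftrightarrow> (\<forall>k<a - 1. circle_mean (\<lambda>t. (g t * inverse t) * inverse t ^ k) = 0)"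
    by (intro circle_mean_power_shift_iff circle_fun_mult g ci)
  also have "\<dots> \<longleftrightarrow> (\<forall>k<a - 1. circle_mean (\<lambda>t. g t * inverse t ^ Suc k) = 0)"
    by (simp add: mult.assoc)
  finally show ?thesis unfolding all_ge_1_less_iff .
qed

lemma moments_minus_iff:
  assumes g: "circle_fun g"
  shows "(\<forall>r::nat. 1 \<le> r \<and> r < c \<longrightarrow>
      integral UNIV (\<lambda>x::real. g (bfun (of_real x)) / (of_real x + \<i>) ^ (r + 1)) = 0) \<longleftrightarrow>
    (\<forall>k. 1 \<le> k \<and> k < c \<longrightarrow> circle_mean (\<lambda>t. g t * t ^ k) = 0)"
proof -
  have ci: "circle_fun (\<lambda>t::complex. t)" by (intro circle_fun_continuous continuous_intros)
  have "(\<forall>k<c - 1. integral UNIV (\<lambda>x::real. g (bfun (of_real x)) / (of_real x + \<i>) ^ (Suc k + 1)) = 0) \<longleftrightarrow>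
    (\<forall>k<c - 1. circle_mean (\<lambda>t. (g t * t) * (t + (-1)) ^ k) = 0)"
    using line_integral_minus[OF g] by simp
  also have "\<dots> \<longleftrightarrow> (\<forall>k<c - 1. circle_mean (\<lambda>t. (g t * t) * t ^ k) = 0)"
    by (intro circle_mean_power_shift_iff circle_fun_mult g ci)
  also have "\<dots> \<longleftrightarrow> (\<forall>k<c - 1. circle_mean (\<lambda>t. g t * t ^ Suc k) = 0)"
    by (simp add: mult.assoc)
  finally show ?thesis unfolding all_ge_1_less_iff .
qed

section \<open>Matrix functions\<close>

lemma matrix_inv_both:
  assumes "invertible (A :: 'a::semiring_1 ^ 'n ^ 'm)"
  shows "A ** matrix_inv A = mat 1" "matrix_inv A ** A = mat 1"
proof -
  have "A ** matrix_inv A = mat 1 \<and> matrix_inv A ** A = mat 1"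
    unfolding matrix_inv_def using assms unfolding invertible_def by (rule someI_ex)
  then show "A ** matrix_inv A = mat 1" "matrix_inv A ** A = mat 1" by auto
qed

lemma matrix_inv_unique:
  assumes "A ** B = mat 1" "B ** A = mat (1::'a::semiring_1)"
  shows "matrix_inv A = (B :: 'a ^ 'n ^ 'n)"
proof -
  have inv: "invertible A" using assms invertible_def by blast
  have "matrix_inv A = matrix_inv A ** (A ** B)" using assms by simp
  also have "\<dots> = (matrix_inv A ** A) ** B" by (rule matrix_mul_assoc)
  also have "\<dots> = B" using matrix_inv_both[OF inv] by simp
  finally show ?thesis .
qed

text \<open>Cramer's rule presents the entries as quotients of polynomials in the entries of
  \<open>A\<close>, so continuity and analyticity pass to the inverse.\<close>

lemma matrix_inv_entry:
  fixes A :: "'n::finite cmat"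
  assumes "invertible A"
  shows "matrix_inv A $ i $ j = det (\<chi> k l. if l = i then axis j 1 $ k else A $ k $ l) / det A"
proof -
  have d: "det A \<noteq> 0" using assms by (simp add: invertible_det_nz)
  have "A *v (matrix_inv A *v axis j 1) = axis j 1"
    using matrix_inv_both[OF assms] by (simp add: matrix_vector_mul_assoc)
  then have "matrix_inv A *v axis j 1 = (\<chi> i. det (\<chi> k l. if l = i then axis j 1 $ k else A $ k $ l) / det A)"
    unfolding cramer[OF d] .
  then have "(matrix_inv A *v axis j 1) $ i = det (\<chi> k l. if l = i then axis j 1 $ k else A $ k $ l) / det A"
    by simp
  moreover have "(matrix_inv A *v axis j 1) $ i = matrix_inv A $ i $ j"
    by (simp add: matrix_vector_mult_def axis_def if_distrib[of "(*) x" for x] cong: if_cong)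
  ultimately show ?thesis by simp
qed

lemma continuous_on_det:
  fixes F :: "complex \<Rightarrow> 'n::finite cmat"
  assumes "\<And>i j. continuous_on S (\<lambda>z. F z $ i $ j)"
  shows "continuous_on S (\<lambda>z. det (F z))"
  unfolding det_def by (intro continuous_intros assms)

lemma holomorphic_on_det:
  fixes F :: "complex \<Rightarrow> 'n::finite cmat"
  assumes "\<And>i j. (\<lambda>z. F z $ i $ j) holomorphic_on S"
  shows "(\<lambda>z. det (F z)) holomorphic_on S"
  unfolding det_def by (intro holomorphic_intros assms)

lemma continuous_on_matrixI:
  fixes F :: "complex \<Rightarrow> 'n::finite cmat"
  assumes "\<And>i j. continuous_on S (\<lambda>z. F z $ i $ j)"
  shows "continuous_on S F"
proof -
  have "continuous_on S (\<lambda>z. \<chi> i j. F z $ i $ j)" by (intro continuous_on_vec_lambda assms)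
  then show ?thesis by simp
qed

text \<open>Boundedness of the inverse is a separate assumption: on a noncompact closed half-plane
  it does not follow from pointwise invertibility.\<close>

lemma cont_bdd_analytic_matrix_inv:
  assumes F: "cont_bdd_analytic U C F" and "U \<subseteq> C" and inv: "\<And>z. z \<in> C \<Longrightarrow> invertible (F z)"
    and bd: "bounded ((\<lambda>z. matrix_inv (F z)) ` C)"
  shows "cont_bdd_analytic U C (\<lambda>z. matrix_inv (F z))"
proof -
  have c: "continuous_on C (\<lambda>z. F z $ i $ j)" for i j
    using F unfolding cont_bdd_analytic_def by (intro continuous_intros) auto
  have h: "(\<lambda>z. F z $ i $ j) holomorphic_on U" for i j using F by (simp add: cont_bdd_analytic_def)
  have nz: "det (F z) \<noteq> 0" if "z \<in> C" for z using inv[OF that] by (simp add: invertible_det_nz)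
  let ?D = "\<lambda>i j z. det (\<chi> k l. if l = i then axis j 1 $ k else F z $ k $ l) / det (F z)"
  have ce: "continuous_on C (\<lambda>z. (\<chi> k l. if l = i then axis j 1 $ k else F z $ k $ l) $ k $ l)" for i j k l
    by (cases "l = i") (simp_all add: c)
  have he: "(\<lambda>z. (\<chi> k l. if l = i then axis j 1 $ k else F z $ k $ l) $ k $ l) holomorphic_on U" for i j k l
    by (cases "l = i") (simp_all add: h)
  have cD: "continuous_on C (?D i j)" for i j
    using nz by (intro continuous_on_divide continuous_on_det c ce) auto
  have hD: "?D i j holomorphic_on U" for i j
    using nz \<open>U \<subseteq> C\<close> by (intro holomorphic_on_divide holomorphic_on_det h he) auto
  have "continuous_on C (\<lambda>z. matrix_inv (F z) $ i $ j)" for i j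
    by (rule continuous_on_eq[OF cD[of i j]]) (simp add: matrix_inv_entry inv)
  moreover have "(\<lambda>z. matrix_inv (F z) $ i $ j) holomorphic_on U" for i j
    by (rule holomorphic_transform[OF hD[of i j]]) (use inv \<open>U \<subseteq> C\<close> in \<open>auto simp: matrix_inv_entry subset_iff\<close>)
  ultimately show ?thesis
    unfolding cont_bdd_analytic_def using bd by (intro conjI allI continuous_on_matrixI)
qed

text \<open>The norm is the Euclidean norm of the entries. Passing through entries costs
  \<open>CARD('n)\<close> for the sum and its square for the number of entries; a crude constant is
  enough.\<close>

lemma norm_matrix_mult_le:
  fixes A B :: "'n::finite cmat"
  shows "norm (A ** B) \<le> real CARD('n) ^ 3 * norm A * norm B"
proof -
  have "norm ((A ** B) $ i $ j) \<le> real CARD('n) * (norm A * norm B)" for i j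
  proof -
    have "norm ((A ** B) $ i $ j) \<le> (\<Sum>k\<in>(UNIV::'n set). norm A * norm B)"
      unfolding matrix_matrix_mult_def
      by (simp only: vec_lambda_beta, intro sum_norm_le)
         (auto simp: norm_mult intro!: mult_mono norm_matrix_entry_le)
    then show ?thesis by simp
  qed
  from norm_matrix_le_entries[of "A ** B", OF this] show ?thesis by (simp add: power3_eq_cube mult_ac)
qed

lemma cont_bdd_analytic_mult:
  assumes F: "cont_bdd_analytic U C F" and G: "cont_bdd_analytic U C G"
  shows "cont_bdd_analytic U C (\<lambda>z. F z ** G z :: 'n::finite cmat)"
  unfolding cont_bdd_analytic_def
proof (intro conjI allI)
  have Fc: "continuous_on C F" "continuous_on C G" and Fb: "bounded (F ` C)" "bounded (G ` C)"
    and Fh: "\<And>i j. (\<lambda>z. F z $ i $ j) holomorphic_on U" "\<And>i j. (\<lambda>z. G z $ i $ j) holomorphic_on U"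
    using F G unfolding cont_bdd_analytic_def by simp_all
  have c: "continuous_on C (\<lambda>z. F z $ i $ j)" "continuous_on C (\<lambda>z. G z $ i $ j)" for i j
    by (intro continuous_intros Fc)+
  show "continuous_on C (\<lambda>z. F z ** G z)"
    unfolding matrix_matrix_mult_def
    by (rule continuous_on_matrixI, unfold vec_lambda_beta) (intro continuous_on_sum continuous_on_mult c)
  obtain A where A: "\<And>z. z \<in> C \<Longrightarrow> norm (F z) \<le> A" using Fb(1) unfolding bounded_iff by blast
  obtain B where B: "\<And>z. z \<in> C \<Longrightarrow> norm (G z) \<le> B" using Fb(2) unfolding bounded_iff by blast
  have "norm (F z ** G z) \<le> real CARD('n) ^ 3 * A * B" if "z \<in> C" for z
    using A[OF that] B[OF that] order_trans[OF norm_ge_zero A[OF that]]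
    by (intro order_trans[OF norm_matrix_mult_le] mult_mono mult_left_mono) auto
  then show "bounded ((\<lambda>z. F z ** G z) ` C)" unfolding bounded_iff by blast
  show "(\<lambda>z. (F z ** G z) $ i $ j) holomorphic_on U" for i j
    unfolding matrix_matrix_mult_def vec_lambda_beta
    by (intro holomorphic_on_sum holomorphic_on_mult Fh)
qed

lemma cont_bdd_analytic_add_scaleR:
  assumes F: "cont_bdd_analytic U C F" and G: "cont_bdd_analytic U C G"
  shows "cont_bdd_analytic U C (\<lambda>z. F z + (r::real) *\<^sub>R G z)"
  unfolding cont_bdd_analytic_def
proof (intro conjI allI)
  show "continuous_on C (\<lambda>z. F z + r *\<^sub>R G z)"
    using F G unfolding cont_bdd_analytic_def by (intro continuous_intros) simp_all
  show "bounded ((\<lambda>z. F z + r *\<^sub>R G z) ` C)"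
    using F G unfolding cont_bdd_analytic_def by (intro bounded_plus_comp bounded_scaleR_comp) auto
  show "(\<lambda>z. (F z + r *\<^sub>R G z) $ i $ j) holomorphic_on U" for i j
    using F G unfolding cont_bdd_analytic_def 
    by (simp add: scaleR_conv_of_real holomorphic_on_add holomorphic_on_mult holomorphic_on_const)
qed

lemma norm_matrix_vector_le:
  fixes A :: "'n::finite cmat"
  shows "norm (A *v x) \<le> real CARD('n) ^ 2 * norm A * norm x"
proof -
  have *: "norm ((A *v x) $ i) \<le> real CARD('n) * (norm A * norm x)" for i
  proof -
    have "norm ((A *v x) $ i) \<le> (\<Sum>k\<in>(UNIV::'n set). norm A * norm x)"
      unfolding matrix_vector_mult_def
      by (simp only: vec_lambda_beta, intro sum_norm_le)
         (auto simp: norm_mult intro!: mult_mono norm_matrix_entry_le Finite_Cartesian_Product.norm_nth_le)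
    then show ?thesis by simp
  qed
  have "norm (A *v x) \<le> (\<Sum>i\<in>(UNIV::'n set). norm ((A *v x) $ i))"
    unfolding norm_vec_def[of "A *v x"] by (rule L2_set_le_sum) auto
  also have "\<dots> \<le> (\<Sum>i\<in>(UNIV::'n set). real CARD('n) * (norm A * norm x))"
    by (intro sum_mono *)
  finally show ?thesis by (simp add: power2_eq_square mult_ac)
qed

lemma matrix_add_right_distrib:
  "(A + B) ** C = A ** C + B ** (C :: 'a::semiring_1 ^ 'n ^ 'm)"
  by (simp add: matrix_matrix_mult_def vec_eq_iff distrib_right sum.distrib)

text \<open>A kernel vector satisfies \<open>x = - (matrix_inv A ** E) *v x\<close> with a
  contraction and so vanishes. The inverse \<open>Y\<close> then satisfies
  \<open>Y = matrix_inv A - (matrix_inv A ** E) ** Y\<close>, where the last term is absorbed. The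
  sixth power stems from two uses of the product constant \<open>CARD('n) ^ 3\<close>.\<close>

lemma invertible_perturbation:
  fixes A E :: "'n::finite cmat"
  assumes A: "invertible A" and E: "real CARD('n) ^ 6 * norm (matrix_inv A) * norm E \<le> 1 / 2"
  shows "invertible (A + E)" "norm (matrix_inv (A + E)) \<le> 2 * norm (matrix_inv A)"
proof -
  let ?c = "real CARD('n)"
  have c1: "1 \<le> ?c" by (simp add: Suc_leI)
  have AE: "norm (matrix_inv A ** E) \<le> ?c ^ 3 * norm (matrix_inv A) * norm E" by (rule norm_matrix_mult_le)
  have half: "?c ^ 3 * norm (matrix_inv A ** E) \<le> 1 / 2"
  proof -
    have "?c ^ 3 * norm (matrix_inv A ** E) \<le> ?c ^ 3 * (?c ^ 3 * norm (matrix_inv A) * norm E)"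
      by (intro mult_left_mono AE) auto
    also have "\<dots> = ?c ^ 6 * norm (matrix_inv A) * norm E" by (simp add: mult.assoc flip: power_add)
    finally show ?thesis using E by simp
  qed
  have "x = 0" if x: "(A + E) *v x = 0" for x
  proof -
    have "A *v x = - (E *v x)" using x by (simp add: matrix_vector_mult_add_rdistrib eq_neg_iff_add_eq_0)
    then have "matrix_inv A *v (A *v x) = - ((matrix_inv A ** E) *v x)"
      by (simp add: matrix_vector_mul_assoc vec.neg)
    then have "x = - ((matrix_inv A ** E) *v x)"
      using matrix_inv_both[OF A] by (simp add: matrix_vector_mul_assoc)
    then have "norm x = norm (- ((matrix_inv A ** E) *v x))" by (rule arg_cong)
    also have "\<dots> = norm ((matrix_inv A ** E) *v x)" by simp
    also have "\<dots> \<le> ?c ^ 2 * norm (matrix_inv A ** E) * norm x" by (rule norm_matrix_vector_le)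
    also have "\<dots> \<le> ?c ^ 3 * norm (matrix_inv A ** E) * norm x"
      using c1 by (intro mult_right_mono power_increasing) auto
    also have "\<dots> \<le> 1 / 2 * norm x" using half by (intro mult_right_mono) auto
    finally show "x = 0" by simp
  qed
  then show inv: "invertible (A + E)"
    unfolding invertible_left_inverse matrix_left_invertible_ker by blast
  let ?Y = "matrix_inv (A + E)"
  have "A ** ?Y + E ** ?Y = mat 1"
    using matrix_inv_both(1)[OF inv] by (simp add: matrix_add_right_distrib)
  then have "matrix_inv A ** (A ** ?Y + E ** ?Y) = matrix_inv A" by simp
  then have "matrix_inv A ** (A ** ?Y) + matrix_inv A ** (E ** ?Y) = matrix_inv A"
    by (simp only: matrix_add_ldistrib)
  then have "?Y + (matrix_inv A ** E) ** ?Y = matrix_inv A"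
    using matrix_inv_both(2)[OF A] by (simp add: matrix_mul_assoc)
  then have "?Y = matrix_inv A - (matrix_inv A ** E) ** ?Y" by (simp only: eq_diff_eq)
  then have "norm ?Y = norm (matrix_inv A - (matrix_inv A ** E) ** ?Y)" by (rule arg_cong)
  also have "\<dots> \<le> norm (matrix_inv A) + norm ((matrix_inv A ** E) ** ?Y)"
    by (rule norm_triangle_ineq4)
  also have "norm ((matrix_inv A ** E) ** ?Y) \<le> ?c ^ 3 * norm (matrix_inv A ** E) * norm ?Y"
    by (rule norm_matrix_mult_le)
  also have "\<dots> \<le> 1 / 2 * norm ?Y" using half by (intro mult_right_mono) auto
  finally show "norm ?Y \<le> 2 * norm (matrix_inv A)" by simp
qed

section \<open>Diagonal matrices of powers of b\<close>

lemma diag_b_mult_right: "(A ** diag_b k z) $ i $ j = A $ i $ j * bfun z powi k j"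
  unfolding matrix_matrix_mult_def diag_b_def
  by (simp add: if_distrib[of "(*) x" for x] cong: if_cong)

lemma diag_b_mult_left: "(diag_b k z ** A) $ i $ j = bfun z powi k i * A $ i $ j"
  unfolding matrix_matrix_mult_def diag_b_def
  by (simp add: if_distrib[of "\<lambda>y. y * x" for x] cong: if_cong)

lemma bfun_real_nonzero: "bfun (complex_of_real x) \<noteq> 0"
  using bfun_real[of x] by auto

lemma diag_b_mult:
  "bfun z \<noteq> 0 \<Longrightarrow> diag_b k z ** diag_b l z = diag_b (\<lambda>i. k i + l i) z"
  by (simp add: vec_eq_iff diag_b_mult_left) (simp add: diag_b_def power_int_add)

lemma diag_b_zero: "diag_b (\<lambda>i. 0) z = mat 1"
  by (simp add: diag_b_def mat_def vec_eq_iff)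

text \<open>The exponents \<open>- min (k i) 0\<close> are nonnegative, so the diagonal entries are
  polynomials in \<open>bfun z\<close> and come from the closed disc.\<close>

lemma Lam_minus_inv_plus_fun: "plus_fun (Lam_minus_inv (k :: 'n::finite \<Rightarrow> int))"
proof -
  define u where "u i j w = (if i = j then w ^ nat (- min (k i) 0) else 0)" for i j and w :: complex
  have "plus_fun (\<lambda>z. \<chi> i j. u i j (bfun z))"
  proof (rule plus_fun_from_disc)
    fix i j
    show "continuous_on (cball 0 1) (u i j)" "u i j holomorphic_on ball 0 1"
      unfolding u_def[abs_def]
      by (cases "i = j"; auto intro!: continuous_intros holomorphic_intros)+
  qed
  moreover have "(\<chi> i j. u i j (bfun z)) = Lam_minus_inv k z" for z
    by (simp add: Lam_minus_inv_def diag_b_def u_def vec_eq_iff power_int_def)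
  ultimately show ?thesis by simp
qed

text \<open>The value \<open>bfun (- \<i>) = 0\<close> at the pole is harmless here: it makes the negative powers vanish
  there, which is their limit.\<close>
lemma Lam_plus_inv_minus_fun: "minus_fun (Lam_plus_inv (k :: 'n::finite \<Rightarrow> int))"
proof -
  define u where "u i j w = (if i = j then w ^ nat (max (k i) 0) else 0)" for i j and w :: complex
  have "plus_fun (\<lambda>z. \<chi> i j. u i j (bfun z))"
  proof (rule plus_fun_from_disc)
    fix i j
    show "continuous_on (cball 0 1) (u i j)" "u i j holomorphic_on ball 0 1"
      unfolding u_def[abs_def]
      by (cases "i = j"; auto intro!: continuous_intros holomorphic_intros)+
  qed
  moreover have "(\<chi> i j. u i j (bfun z)) = Lam_plus_inv k (- z)" for z
    by (auto simp: Lam_plus_inv_def diag_b_def u_def vec_eq_iff power_int_def bfun_uminus)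
  ultimately show ?thesis by (simp add: minus_fun_iff_plus_fun)
qed

section \<open>Hoelder regularity of the inverse factors\<close>

lemma circle_hoelder_cong:
  assumes "\<And>t. t \<in> sphere 0 1 - {1} \<Longrightarrow> f t = g t"
  shows "circle_hoelder \<alpha> K f \<longleftrightarrow> circle_hoelder \<alpha> K g"
  using assms by (simp add: circle_hoelder_def)

lemma circle_hoelder_uniform:
  fixes f :: "'n::finite \<Rightarrow> 'm::finite \<Rightarrow> complex \<Rightarrow> complex"
  assumes "\<And>i j. \<exists>L. circle_hoelder \<alpha> L (f i j)"
  shows "\<exists>L. \<forall>i j. circle_hoelder \<alpha> L (f i j)"
proof -
  have "\<forall>i. \<exists>g. \<forall>j. circle_hoelder \<alpha> (g j) (f i j)" by (intro allI choice assms)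
  then have "\<exists>L. \<forall>i j. circle_hoelder \<alpha> (L i j) (f i j)" by (rule choice)
  then obtain L where L: "\<And>i j. circle_hoelder \<alpha> (L i j) (f i j)" by blast
  have nn: "0 \<le> L i j" for i j using circle_hoelder_nonneg[OF L] .
  have "L i j \<le> (\<Sum>i\<in>UNIV. \<Sum>j\<in>UNIV. L i j)" for i j
  proof -
    have "L i j \<le> (\<Sum>j\<in>UNIV. L i j)" by (rule member_le_sum) (auto simp: nn)
    also have "\<dots> \<le> (\<Sum>i\<in>UNIV. \<Sum>j\<in>UNIV. L i j)"
      by (rule member_le_sum[where f="\<lambda>i. \<Sum>j\<in>UNIV. L i j"]) (auto intro!: sum_nonneg nn)
    finally show ?thesis .
  qed
  then show ?thesis using circle_hoelder_mono[OF L] by blast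
qed

lemma matrix_mult_entry: "(A ** B) $ i $ j = (\<Sum>k\<in>UNIV. A $ i $ k * B $ k $ j)"
  by (simp add: matrix_matrix_mult_def)

lemma diag_b_cancel: "bfun z \<noteq> 0 \<Longrightarrow> diag_b k z ** diag_b (\<lambda>i. - k i) z = mat 1"
  by (simp add: diag_b_mult diag_b_zero)

lemma diag_b_cancel': "bfun z \<noteq> 0 \<Longrightarrow> diag_b (\<lambda>i. - k i) z ** diag_b k z = mat 1"
  by (simp add: diag_b_mult diag_b_zero)

lemma matrix_cancel:
  fixes A B C :: "'n::finite cmat"
  shows "A ** B = mat 1 \<Longrightarrow> (C ** A) ** B = C"
  by (simp flip: matrix_mul_assoc)

text \<open>In both rearrangements the inverse of one factor is expressed by
  \<open>matrix_inv G\<close> and the other factor itself. The diagonal matrix acts on a single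
  column, respectively row, as a scalar power, which is the shape that
  \<open>disc_fun_regularity\<close> expects.\<close>

lemma factor_inverse:
  fixes A B :: "'n::finite cmat" and k :: "'n \<Rightarrow> int"
  assumes A: "invertible A" and B: "invertible B" and z: "bfun z \<noteq> 0"
  defines "G \<equiv> A ** diag_b k z ** B"
  shows "matrix_inv B ** diag_b (\<lambda>i. - k i) z = matrix_inv G ** A"
    and "matrix_inv A = diag_b k z ** B ** matrix_inv G"
proof -
  let ?D = "diag_b k z" and ?E = "diag_b (\<lambda>i. - k i) z"
  note a = matrix_inv_both[OF A] and b = matrix_inv_both[OF B] and d = diag_b_cancel[OF z, of k] diag_b_cancel'[OF z, of k]
  have "G ** (matrix_inv B ** ?E ** matrix_inv A) = mat 1" "(matrix_inv B ** ?E ** matrix_inv A) ** G = mat 1"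
    unfolding G_def by (simp_all add: matrix_mul_assoc matrix_cancel a b d)
  then have G: "matrix_inv G = matrix_inv B ** ?E ** matrix_inv A" by (rule matrix_inv_unique)
  show "matrix_inv B ** ?E = matrix_inv G ** A" "matrix_inv A = ?D ** B ** matrix_inv G"
    unfolding G by (simp_all add: matrix_mul_assoc matrix_cancel a b d)
qed

text \<open>The factors of a Hoelder matrix are only assumed to be bounded and continuous; analyticity on
  the two sides makes their inverses Hoelder as well, with half of the exponent.\<close>
lemma plus_factor_inverse_hoelder:
  fixes Gp Gm :: "complex \<Rightarrow> 'n::finite cmat"
  assumes \<mu>: "0 < \<mu>" "\<mu> \<le> 1" and Gm: "minus_factor Gm" and Gp: "plus_factor Gp"
    and eq: "\<And>x::real. G x = Gm (of_real x) ** Lam k (of_real x) ** Gp (of_real x)"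
    and G: "hoelder_bounded \<mu> K (\<lambda>x. matrix_inv (G x))"
  shows "\<exists>L. \<forall>i j. circle_hoelder (\<mu> / 2) L (\<lambda>t. matrix_inv (Gp (cayley_inv t)) $ i $ j)"
proof (rule circle_hoelder_uniform)
  fix i l
  show "\<exists>L. circle_hoelder (\<mu> / 2) L (\<lambda>t. matrix_inv (Gp (cayley_inv t)) $ i $ l)"
  \<comment> \<open>On column \<open>l\<close> the diagonal factor is the scalar
    \<open>t powi (- k l)\<close>. The functions \<open>h\<close> are the entries of
    \<open>Gm\<close> reflected into the disc, so \<open>h j (inverse t)\<close> is the boundary
    value of \<open>Gm\<close> itself.\<close>
  proof (rule disc_fun_regularity[where I="UNIV :: 'n set" and k="- k l" and K=K
        and h="\<lambda>j w. Gm (- cayley_inv w) $ j $ l" and g="\<lambda>j t. matrix_inv (G (Re (cayley_inv t))) $ i $ j", OF _ _ _ _ \<mu>])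
    show "disc_fun (\<lambda>w. matrix_inv (Gp (cayley_inv w)) $ i $ l)"
      using Gp by (intro plus_fun_disc_fun[of "\<lambda>z. matrix_inv (Gp z)"]) (simp add: plus_factor_def)
    show "disc_fun (\<lambda>w. Gm (- cayley_inv w) $ j $ l)" for j
      using Gm by (intro plus_fun_disc_fun[of "\<lambda>z. Gm (- z)"]) (simp add: minus_factor_def minus_fun_iff_plus_fun)
    show "circle_hoelder \<mu> K (\<lambda>t. matrix_inv (G (Re (cayley_inv t))) $ i $ j)" for j
      by (rule hoelder_bounded_circle_hoelder[OF G])
    fix t :: complex assume t: "t \<in> sphere 0 1 - {1}"
    define x where "x = Re (cayley_inv t)"
    have x: "cayley_inv t = of_real x" using cayley_inv_real[OF t] by (simp add: x_def)
    have b: "bfun (of_real x) = t" using bfun_Re_cayley_inv[OF t] by (simp add: x_def)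
    have "invertible (Gm (of_real x))" "invertible (Gp (of_real x))"
      using Gm Gp by (auto simp: minus_factor_def plus_factor_def lower_cl_def upper_cl_def)
    from factor_inverse(1)[OF this, of "of_real x" k] bfun_real_nonzero[of x]
    have "matrix_inv (Gp (of_real x)) ** diag_b (\<lambda>i. - k i) (of_real x) = matrix_inv (G x) ** Gm (of_real x)"
      by (simp add: eq Lam_def)
    then have "(matrix_inv (Gp (of_real x)) ** diag_b (\<lambda>i. - k i) (of_real x)) $ i $ l = (matrix_inv (G x) ** Gm (of_real x)) $ i $ l"
      by simp
    then show "t powi - k l * matrix_inv (Gp (cayley_inv t)) $ i $ l =
        (\<Sum>j\<in>UNIV. Gm (- cayley_inv (inverse t)) $ j $ l * matrix_inv (G (Re (cayley_inv t))) $ i $ j)"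
      unfolding diag_b_mult_right cayley_inv_inverse[OF t] b unfolding matrix_mult_entry
      by (simp add: x mult.commute)
  qed simp
qed

text \<open>Here the unknown is analytic in the lower half-plane. The argument is run in the
  reflected variable, with \<open>Gp\<close> in the exterior role, and the reflection is undone at
  the end.\<close>

lemma minus_factor_inverse_hoelder:
  fixes Gp Gm :: "complex \<Rightarrow> 'n::finite cmat"
  assumes \<mu>: "0 < \<mu>" "\<mu> \<le> 1" and Gm: "minus_factor Gm" and Gp: "plus_factor Gp"
    and eq: "\<And>x::real. G x = Gm (of_real x) ** Lam k (of_real x) ** Gp (of_real x)"
    and G: "hoelder_bounded \<mu> K (\<lambda>x. matrix_inv (G x))"
  shows "\<exists>L. \<forall>i j. circle_hoelder (\<mu> / 2) L (\<lambda>t. matrix_inv (Gm (cayley_inv t)) $ i $ j)"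
proof (rule circle_hoelder_uniform)
  fix l i
  have "\<exists>L. circle_hoelder (\<mu> / 2) L (\<lambda>t. matrix_inv (Gm (- cayley_inv t)) $ l $ i)"
  proof (rule disc_fun_regularity[where I="UNIV :: 'n set" and k="k l" and K=K
        and h="\<lambda>j w. Gp (cayley_inv w) $ l $ j" and g="\<lambda>j t. matrix_inv (G (Re (cayley_inv (inverse t)))) $ j $ i", OF _ _ _ _ \<mu>])
    show "disc_fun (\<lambda>w. matrix_inv (Gm (- cayley_inv w)) $ l $ i)"
      using Gm by (intro plus_fun_disc_fun[of "\<lambda>z. matrix_inv (Gm (- z))"]) (simp add: minus_factor_def minus_fun_iff_plus_fun)
    show "disc_fun (\<lambda>w. Gp (cayley_inv w) $ l $ j)" for j
      using Gp by (intro plus_fun_disc_fun) (simp add: plus_factor_def)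
    show "circle_hoelder \<mu> K (\<lambda>t. matrix_inv (G (Re (cayley_inv (inverse t)))) $ j $ i)" for j
      by (rule circle_hoelder_inverse[OF hoelder_bounded_circle_hoelder[OF G]])
    fix t :: complex assume t: "t \<in> sphere 0 1 - {1}"
    define x where "x = - Re (cayley_inv t)"
    have x: "- cayley_inv t = of_real x" using cayley_inv_real[OF t] by (simp add: x_def)
    have b: "bfun (of_real x) = inverse t" using bfun_Re_cayley_inv[OF t] by (simp add: x_def bfun_uminus)
    have t0: "t \<noteq> 0" using t by auto
    have "invertible (Gm (of_real x))" "invertible (Gp (of_real x))"
      using Gm Gp by (auto simp: minus_factor_def plus_factor_def lower_cl_def upper_cl_def)
    from factor_inverse(2)[OF this, of "of_real x" k] bfun_real_nonzero[of x]
    have "matrix_inv (Gm (of_real x)) = diag_b k (of_real x) ** (Gp (of_real x) ** matrix_inv (G x))"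
      by (simp add: eq Lam_def matrix_mul_assoc)
    then have "matrix_inv (Gm (of_real x)) $ l $ i = (diag_b k (of_real x) ** (Gp (of_real x) ** matrix_inv (G x))) $ l $ i"
      by simp
    also have "\<dots> = inverse t powi k l * (\<Sum>j\<in>UNIV. Gp (of_real x) $ l $ j * matrix_inv (G x) $ j $ i)"
      unfolding diag_b_mult_left b unfolding matrix_mult_entry ..
    finally have "t powi k l * matrix_inv (Gm (of_real x)) $ l $ i = (\<Sum>j\<in>UNIV. Gp (of_real x) $ l $ j * matrix_inv (G x) $ j $ i)"
      using t0 by (simp add: power_int_inverse)
    then show "t powi k l * matrix_inv (Gm (- cayley_inv t)) $ l $ i =
        (\<Sum>j\<in>UNIV. Gp (cayley_inv (inverse t)) $ l $ j * matrix_inv (G (Re (cayley_inv (inverse t)))) $ j $ i)"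
      unfolding cayley_inv_inverse[OF t] x by simp
  qed simp
  then obtain L where "circle_hoelder (\<mu> / 2) L (\<lambda>t. matrix_inv (Gm (- cayley_inv t)) $ l $ i)" ..
  then have "circle_hoelder (\<mu> / 2) L (\<lambda>t. matrix_inv (Gm (- cayley_inv (inverse t))) $ l $ i)"
    by (rule circle_hoelder_inverse)
  then have "circle_hoelder (\<mu> / 2) L (\<lambda>t. matrix_inv (Gm (cayley_inv t)) $ l $ i)"
    by (subst circle_hoelder_cong) (auto simp: cayley_inv_inverse)
  then show "\<exists>L. circle_hoelder (\<mu> / 2) L (\<lambda>t. matrix_inv (Gm (cayley_inv t)) $ l $ i)" ..
qed

text \<open>\<open>C\<close> does not depend on \<open>N\<close>, and the bound is linear in
  \<open>K\<close>; for the family \<open>N \<epsilon>\<close> this gives an estimate uniform in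
  \<epsilon>.\<close>

lemma conjugated_hoelder:
  fixes A B :: "complex \<Rightarrow> 'n::finite cmat"
  assumes \<mu>: "0 < \<mu>" "\<mu> \<le> 1"
    and A: "\<And>i j. circle_hoelder (\<mu> / 2) L1 (\<lambda>t. A (cayley_inv t) $ i $ j)"
    and B: "\<And>i j. circle_hoelder (\<mu> / 2) L2 (\<lambda>t. B (cayley_inv t) $ i $ j)"
  shows "\<exists>C\<ge>0. \<forall>K N. hoelder_bounded \<mu> K N \<longrightarrow> (\<forall>l j. circle_hoelder (\<mu> / 2) (C * K)
    (\<lambda>t. (A (of_real (Re (cayley_inv t))) ** N (Re (cayley_inv t)) ** B (of_real (Re (cayley_inv t)))) $ l $ j))"
proof -
  let ?n = "real CARD('n)"
  \<comment> \<open>Lowering the exponent of \<open>N\<close> doubles its constant, each of the two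
    products contributes another 2, and the double sum has \<open>?n\<^sup>2\<close> terms.\<close>
  define C where "C = 8 * ?n\<^sup>2 * L1 * L2"
  have "circle_hoelder (\<mu> / 2) (C * K)
    (\<lambda>t. (A (of_real (Re (cayley_inv t))) ** N (Re (cayley_inv t)) ** B (of_real (Re (cayley_inv t)))) $ l $ j)"
    if N: "hoelder_bounded \<mu> K N" for K N l j
  proof -
    have N': "circle_hoelder (\<mu> / 2) (2 * K) (\<lambda>t. N (Re (cayley_inv t)) $ a $ b)" for a b
      using \<mu> by (intro circle_hoelder_exponent[OF hoelder_bounded_circle_hoelder[OF N]]) auto
    have "circle_hoelder (\<mu> / 2) (\<Sum>b\<in>(UNIV::'n set). 2 * (\<Sum>a\<in>(UNIV::'n set). 2 * L1 * (2 * K)) * L2)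
      (\<lambda>t. \<Sum>b\<in>UNIV. (\<Sum>a\<in>UNIV. A (cayley_inv t) $ l $ a * N (Re (cayley_inv t)) $ a $ b) * B (cayley_inv t) $ b $ j)"
      by (intro circle_hoelder_sum circle_hoelder_mult A B N' finite)
    also have "(\<Sum>b\<in>(UNIV::'n set). 2 * (\<Sum>a\<in>(UNIV::'n set). 2 * L1 * (2 * K)) * L2) = C * K"
      by (simp add: C_def power2_eq_square)
    finally show ?thesis
      by (subst circle_hoelder_cong) (simp_all add: matrix_mult_entry cayley_inv_real)
  qed
  moreover have "0 \<le> C"
    using circle_hoelder_nonneg[OF A] circle_hoelder_nonneg[OF B] by (simp add: C_def)
  ultimately show ?thesis by blast
qed

section \<open>Solvability of the boundary value problem\<close>

definition moments_vanish :: "nat \<Rightarrow> nat \<Rightarrow> (complex \<Rightarrow> complex) \<Rightarrow> bool" where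
  "moments_vanish a c h \<longleftrightarrow>
     (\<forall>k. 1 \<le> k \<and> k < a \<longrightarrow> circle_mean (\<lambda>t. h t * inverse t ^ k) = 0) \<and>
     (\<forall>k. 1 \<le> k \<and> k < c \<longrightarrow> circle_mean (\<lambda>t. h t * t ^ k) = 0) \<and>
     (0 < a \<and> 0 < c \<longrightarrow> circle_mean h = 0)"

text \<open>\<open>nat\<close> cuts the exponents off at 0, so the first kind of condition is
  vacuous on rows with \<open>k l \<le> 0\<close> and the second on columns with
  \<open>k j \<ge> 0\<close>. The coefficient of index 0 is kept apart because it lies strictly
  between the two exponents only if both are positive.\<close>

lemma conditions_iff_moments:
  assumes M: "\<And>l j. circle_fun (\<lambda>t. M (Re (cayley_inv t)) $ l $ j)"
  shows "cond_a k M \<and> cond_b k M \<and> cond_c k M \<longleftrightarrow>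
    (\<forall>l j. moments_vanish (nat (k l)) (nat (- k j)) (\<lambda>t. M (Re (cayley_inv t)) $ l $ j))"
proof -
  have "(\<forall>r::nat. 2 \<le> k l \<and> 1 \<le> r \<and> int r \<le> k l - 1 \<longrightarrow> P r) \<longleftrightarrow> (\<forall>r. 1 \<le> r \<and> r < nat (k l) \<longrightarrow> P r)" for l P
    by (intro all_cong1 imp_cong) auto
  then have a: "cond_a k M \<longleftrightarrow> (\<forall>l j. \<forall>m. 1 \<le> m \<and> m < nat (k l) \<longrightarrow> circle_mean (\<lambda>t. M (Re (cayley_inv t)) $ l $ j * inverse t ^ m) = 0)"
    unfolding cond_a_def moments_plus_iff[OF M, symmetric] Re_cayley_inv_bfun by simp
  have "(\<forall>r::nat. k j \<le> -2 \<and> 1 \<le> r \<and> int r \<le> - k j - 1 \<longrightarrow> P r) \<longleftrightarrow> (\<forall>r. 1 \<le> r \<and> r < nat (- k j) \<longrightarrow> P r)" for j P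
    by (intro all_cong1 imp_cong) auto
  then have b: "cond_b k M \<longleftrightarrow> (\<forall>l j. \<forall>m. 1 \<le> m \<and> m < nat (- k j) \<longrightarrow> circle_mean (\<lambda>t. M (Re (cayley_inv t)) $ l $ j * t ^ m) = 0)"
    unfolding cond_b_def moments_minus_iff[OF M, symmetric] Re_cayley_inv_bfun by simp
  have "integral UNIV (\<lambda>\<tau>::real. M \<tau> $ l $ j / of_real (\<tau>\<^sup>2 + 1)) = of_real pi * circle_mean (\<lambda>t. M (Re (cayley_inv t)) $ l $ j)" for l j
    using integral_line_circle_mean[OF M[of l j]] unfolding Re_cayley_inv_bfun .
  then have c: "cond_c k M \<longleftrightarrow> (\<forall>l j. 0 < nat (k l) \<and> 0 < nat (- k j) \<longrightarrow> circle_mean (\<lambda>t. M (Re (cayley_inv t)) $ l $ j) = 0)"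
    unfolding cond_c_def by simp
  show ?thesis unfolding a b c moments_vanish_def by blast
qed

lemma Lam_plus_entry: "(Lam_plus k z ** A) $ l $ j = bfun z ^ nat (k l) * A $ l $ j"
  unfolding Lam_plus_def diag_b_mult_left by (auto simp: power_int_def max_def)

lemma Lam_minus_entry: "(A ** Lam_minus k z) $ l $ j = inverse (bfun z) ^ nat (- k j) * A $ l $ j"
  unfolding Lam_minus_def diag_b_mult_right by (auto simp: power_int_def min_def)

text \<open>Multiplication by the inverse factors gives \<open>M = (matrix_inv Gm ** N1m) **
  Lam_minus + Lam_plus ** (N1p ** matrix_inv Gp)\<close>. A diagonal matrix scales columns from the
  right and rows from the left, which decouples the entries.\<close>

lemma bvp_necessary:
  fixes Gp Gm :: "complex \<Rightarrow> 'n::finite cmat"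
  assumes Gm: "minus_factor Gm" and Gp: "plus_factor Gp"
    and s: "solves_bvp k Gm Gp N N1m N1p"
  defines "M \<equiv> \<lambda>x::real. matrix_inv (Gm (of_real x)) ** N x ** matrix_inv (Gp (of_real x))"
  shows "moments_vanish (nat (k l)) (nat (- k j)) (\<lambda>t. M (Re (cayley_inv t)) $ l $ j)"
proof -
  have "plus_fun (\<lambda>z. N1p z ** matrix_inv (Gp z))"
    using s Gp unfolding plus_fun_def solves_bvp_def plus_factor_def by (intro cont_bdd_analytic_mult) auto
  then have u: "disc_fun (\<lambda>w. (N1p (cayley_inv w) ** matrix_inv (Gp (cayley_inv w))) $ l $ j)"
    by (rule plus_fun_disc_fun)
  have "minus_fun (\<lambda>z. matrix_inv (Gm z) ** N1m z)"
    using s Gm unfolding minus_fun_def solves_bvp_def minus_factor_def by (intro cont_bdd_analytic_mult) auto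
  then have v: "disc_fun (\<lambda>w. (matrix_inv (Gm (- cayley_inv w)) ** N1m (- cayley_inv w)) $ l $ j)"
    unfolding minus_fun_iff_plus_fun by (rule plus_fun_disc_fun)
  have "M (Re (cayley_inv t)) $ l $ j =
      t ^ nat (k l) * (N1p (cayley_inv t) ** matrix_inv (Gp (cayley_inv t))) $ l $ j
      + inverse t ^ nat (- k j) * (matrix_inv (Gm (- cayley_inv (inverse t))) ** N1m (- cayley_inv (inverse t))) $ l $ j"
    if t: "t \<in> sphere 0 1 - {1}" for t
  proof -
    define x where "x = Re (cayley_inv t)"
    have x: "cayley_inv t = of_real x" using cayley_inv_real[OF t] by (simp add: x_def)
    have b: "bfun (of_real x) = t" using bfun_Re_cayley_inv[OF t] by (simp add: x_def)
    have i: "invertible (Gm (of_real x))" "invertible (Gp (of_real x))"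
      using Gm Gp by (auto simp: minus_factor_def plus_factor_def lower_cl_def upper_cl_def)
    have "N x = N1m (of_real x) ** Lam_minus k (of_real x) ** Gp (of_real x) + Gm (of_real x) ** Lam_plus k (of_real x) ** N1p (of_real x)"
      using s by (simp add: solves_bvp_def)
    then have "M x = (matrix_inv (Gm (of_real x)) ** N1m (of_real x)) ** Lam_minus k (of_real x)
        + Lam_plus k (of_real x) ** (N1p (of_real x) ** matrix_inv (Gp (of_real x)))"
      unfolding M_def
      by (simp add: matrix_add_ldistrib matrix_add_right_distrib matrix_mul_assoc matrix_cancel
          matrix_inv_both[OF i(1)] matrix_inv_both[OF i(2)])
    then have "M x $ l $ j = ((matrix_inv (Gm (of_real x)) ** N1m (of_real x)) ** Lam_minus k (of_real x)) $ l $ j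
        + (Lam_plus k (of_real x) ** (N1p (of_real x) ** matrix_inv (Gp (of_real x)))) $ l $ j"
      by simp
    then show ?thesis
      unfolding Lam_plus_entry Lam_minus_entry b cayley_inv_inverse[OF t] x_def[symmetric] x by simp
  qed
  from circle_decomposition_moments[OF u v this] show ?thesis
    unfolding moments_vanish_def by blast
qed

text \<open>The scalar solutions are assembled into matrices \<open>U\<close> and \<open>V\<close>;
  \<open>N1m = Gm ** V\<close> and \<open>N1p = U ** Gp\<close> then undo the multiplication by the
  inverse factors.\<close>

lemma bvp_sufficient:
  fixes Gp Gm :: "complex \<Rightarrow> 'n::finite cmat"
  assumes \<alpha>: "0 < \<alpha>" "\<alpha> \<le> 1" and Gm: "minus_factor Gm" and Gp: "plus_factor Gp"
  shows "\<exists>C\<ge>0. \<forall>K N. 0 \<le> K \<longrightarrow> (\<forall>l j. circle_hoelder \<alpha> K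
        (\<lambda>t. (matrix_inv (Gm (of_real (Re (cayley_inv t)))) ** N (Re (cayley_inv t)) ** matrix_inv (Gp (of_real (Re (cayley_inv t))))) $ l $ j)) \<longrightarrow>
      (\<forall>l j. moments_vanish (nat (k l)) (nat (- k j))
        (\<lambda>t. (matrix_inv (Gm (of_real (Re (cayley_inv t)))) ** N (Re (cayley_inv t)) ** matrix_inv (Gp (of_real (Re (cayley_inv t))))) $ l $ j)) \<longrightarrow>
      (\<exists>N1m N1p. solves_bvp k Gm Gp N N1m N1p \<and>
        (\<forall>z\<in>lower_cl. norm (N1m z) \<le> C * K) \<and> (\<forall>z\<in>upper_cl. norm (N1p z) \<le> C * K))"
proof -
  define dec where "dec a c C K h u v \<longleftrightarrow> continuous_on (cball 0 1) u \<and> u holomorphic_on ball 0 1 \<and> (\<forall>z\<in>cball 0 1. norm (u z) \<le> C * K) \<and>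
      continuous_on (cball 0 1) v \<and> v holomorphic_on ball 0 1 \<and> (\<forall>z\<in>cball 0 1. norm (v z) \<le> C * K) \<and>
      (\<forall>t\<in>sphere 0 1 - {1}. h t = t ^ a * u t + inverse t ^ c * v (inverse t))"
    for a c C K and h u v :: "complex \<Rightarrow> complex"
  have "\<exists>C. 0 \<le> C \<and> (\<forall>K h. circle_hoelder \<alpha> K h \<longrightarrow> moments_vanish a c h \<longrightarrow> (\<exists>u v. dec a c C K h u v))" for a c
    using circle_hoelder_decomposition[OF \<alpha>, of a c] unfolding dec_def moments_vanish_def imp_conjL .
  \<comment> \<open>The constants are selected as functions of the exponents alone, before
    \<open>K\<close> and \<open>h\<close> enter. Only finitely many pairs of exponents occur in a
    matrix, and \<open>C1\<close> adds up their constants.\<close>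
  then have "\<forall>a. \<exists>C. \<forall>c. 0 \<le> C c \<and> (\<forall>K h. circle_hoelder \<alpha> K h \<longrightarrow> moments_vanish a c h \<longrightarrow> (\<exists>u v. dec a c (C c) K h u v))"
    by (intro allI choice)
  then have "\<exists>C. \<forall>a c. 0 \<le> C a c \<and> (\<forall>K h. circle_hoelder \<alpha> K h \<longrightarrow> moments_vanish a c h \<longrightarrow> (\<exists>u v. dec a c (C a c) K h u v))"
    by (rule choice)
  then obtain C where C0: "\<And>a c. 0 \<le> C a c"
    and C: "\<And>a c K h. circle_hoelder \<alpha> K h \<Longrightarrow> moments_vanish a c h \<Longrightarrow> \<exists>u v. dec a c (C a c) K h u v"
    by blast
  have Gbd: "bounded (Gm ` lower_cl)" "bounded (Gp ` upper_cl)"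
    using Gm Gp by (auto simp: minus_factor_def plus_factor_def minus_fun_def plus_fun_def cont_bdd_analytic_def)
  obtain Bm where Bm: "0 < Bm" "\<And>z. z \<in> lower_cl \<Longrightarrow> norm (Gm z) \<le> Bm"
    using Gbd(1) unfolding bounded_pos by auto
  obtain Bp where Bp: "0 < Bp" "\<And>z. z \<in> upper_cl \<Longrightarrow> norm (Gp z) \<le> Bp"
    using Gbd(2) unfolding bounded_pos by auto
  define C1 where "C1 = (\<Sum>l\<in>UNIV. \<Sum>j\<in>UNIV. C (nat (k l)) (nat (- k j)))"
  have C1: "0 \<le> C1" unfolding C1_def by (intro sum_nonneg C0)
  define D where "D = real CARD('n) ^ 3 * (Bm + Bp) * C1"
  have D: "0 \<le> D" using Bm Bp C1 by (simp add: D_def)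
  have "\<exists>N1m N1p. solves_bvp k Gm Gp N N1m N1p \<and>
        (\<forall>z\<in>lower_cl. norm (N1m z) \<le> D * K) \<and> (\<forall>z\<in>upper_cl. norm (N1p z) \<le> D * K)"
    if K: "0 \<le> K" and h: "\<And>l j. circle_hoelder \<alpha> K
        (\<lambda>t. (matrix_inv (Gm (of_real (Re (cayley_inv t)))) ** N (Re (cayley_inv t)) ** matrix_inv (Gp (of_real (Re (cayley_inv t))))) $ l $ j)"
      and m: "\<And>l j. moments_vanish (nat (k l)) (nat (- k j))
        (\<lambda>t. (matrix_inv (Gm (of_real (Re (cayley_inv t)))) ** N (Re (cayley_inv t)) ** matrix_inv (Gp (of_real (Re (cayley_inv t))))) $ l $ j)"
    for K N
  proof -
    define M where "M x = matrix_inv (Gm (of_real x)) ** N x ** matrix_inv (Gp (of_real x))" for x :: real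
    define Q where "Q l j u v \<longleftrightarrow> dec (nat (k l)) (nat (- k j)) (C (nat (k l)) (nat (- k j))) K (\<lambda>t. M (Re (cayley_inv t)) $ l $ j) u v" for l j u v
    have "\<exists>u v. Q l j u v" for l j unfolding Q_def M_def by (rule C[OF h m])
    then obtain u v where Q: "\<And>l j. Q l j (u l j) (v l j)" by metis
    have u: "continuous_on (cball 0 1) (u l j)" "u l j holomorphic_on ball 0 1"
      and v: "continuous_on (cball 0 1) (v l j)" "v l j holomorphic_on ball 0 1"
      and ub: "\<And>z. z \<in> cball 0 1 \<Longrightarrow> norm (u l j z) \<le> C (nat (k l)) (nat (- k j)) * K"
      and vb: "\<And>z. z \<in> cball 0 1 \<Longrightarrow> norm (v l j z) \<le> C (nat (k l)) (nat (- k j)) * K"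
      and uv: "\<And>t. t \<in> sphere 0 1 - {1} \<Longrightarrow> M (Re (cayley_inv t)) $ l $ j
         = t ^ nat (k l) * u l j t + inverse t ^ nat (- k j) * v l j (inverse t)" for l j
      using Q[of l j] unfolding Q_def dec_def by simp_all
    define U where "U z = (\<chi> l j. u l j (bfun z))" for z
    define V where "V z = (\<chi> l j. v l j (bfun (- z)))" for z
    have pU: "plus_fun U" unfolding U_def by (rule plus_fun_from_disc[OF u])
    have mV: "minus_fun V"
      unfolding V_def minus_fun_iff_plus_fun minus_minus by (rule plus_fun_from_disc[OF v])
    have Ub: "norm (U z) \<le> C1 * K" if "z \<in> upper_cl" for z
    proof -
      have "norm (U z) \<le> (\<Sum>l\<in>UNIV. \<Sum>j\<in>UNIV. C (nat (k l)) (nat (- k j)) * K)"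
        using bfun_upper_cl[OF that] by (intro order_trans[OF norm_matrix_le_sum] sum_mono) (simp add: U_def ub)
      then show ?thesis by (simp add: C1_def sum_distrib_right)
    qed
    have Vb: "norm (V z) \<le> C1 * K" if "z \<in> lower_cl" for z
    proof -
      have "- z \<in> upper_cl" using that by (simp add: lower_cl_def upper_cl_def)
      then have "norm (V z) \<le> (\<Sum>l\<in>UNIV. \<Sum>j\<in>UNIV. C (nat (k l)) (nat (- k j)) * K)"
        using bfun_upper_cl by (intro order_trans[OF norm_matrix_le_sum] sum_mono) (simp add: V_def vb)
      then show ?thesis by (simp add: C1_def sum_distrib_right)
    qed
    have prod_bd: "real CARD('n) ^ 3 * norm X * norm Y \<le> D * K"
      if "norm X * norm Y \<le> (Bm + Bp) * (C1 * K)" for X Y :: "'n cmat"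
      using mult_left_mono[OF that, of "real CARD('n) ^ 3"] by (simp add: D_def mult_ac)
    have "solves_bvp k Gm Gp N (\<lambda>z. Gm z ** V z) (\<lambda>z. U z ** Gp z)"
      unfolding solves_bvp_def
    proof (intro conjI allI)
      show "minus_fun (\<lambda>z. Gm z ** V z)"
        using mV Gm unfolding minus_fun_def minus_factor_def by (intro cont_bdd_analytic_mult) auto
      show "plus_fun (\<lambda>z. U z ** Gp z)"
        using pU Gp unfolding plus_fun_def plus_factor_def by (intro cont_bdd_analytic_mult) auto
      fix x :: real
      have i: "invertible (Gm (of_real x))" "invertible (Gp (of_real x))"
        using Gm Gp by (auto simp: minus_factor_def plus_factor_def lower_cl_def upper_cl_def)
      have "V (of_real x) ** Lam_minus k (of_real x) + Lam_plus k (of_real x) ** U (of_real x) = M x"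
      proof -
        have "(V (of_real x) ** Lam_minus k (of_real x)) $ l $ j + (Lam_plus k (of_real x) ** U (of_real x)) $ l $ j = M x $ l $ j" for l j
          using uv[OF bfun_real[of x], of l j]
          unfolding Lam_plus_entry Lam_minus_entry Re_cayley_inv_bfun by (simp add: U_def V_def bfun_uminus)
        then show ?thesis by (simp add: vec_eq_iff)
      qed
      then have "Gm (of_real x) ** (V (of_real x) ** Lam_minus k (of_real x) + Lam_plus k (of_real x) ** U (of_real x)) ** Gp (of_real x)
          = Gm (of_real x) ** M x ** Gp (of_real x)" by simp
      also have "Gm (of_real x) ** M x ** Gp (of_real x) = N x"
        unfolding M_def by (simp add: matrix_mul_assoc matrix_cancel matrix_inv_both[OF i(1)] matrix_inv_both[OF i(2)])
      finally show "Gm (of_real x) ** V (of_real x) ** Lam_minus k (of_real x) ** Gp (of_real x)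
          + Gm (of_real x) ** Lam_plus k (of_real x) ** (U (of_real x) ** Gp (of_real x)) = N x"
        by (simp only: matrix_add_ldistrib matrix_add_right_distrib matrix_mul_assoc)
    qed
    moreover have "norm (Gm z ** V z) \<le> D * K" if "z \<in> lower_cl" for z
    proof -
      have "norm (Gm z) * norm (V z) \<le> (Bm + Bp) * (C1 * K)"
        using Bm(2)[OF that] Vb[OF that] Bm(1) Bp(1) by (intro mult_mono) auto
      then show ?thesis using norm_matrix_mult_le[of "Gm z" "V z"] prod_bd order_trans by blast
    qed
    moreover have "norm (U z ** Gp z) \<le> D * K" if "z \<in> upper_cl" for z
    proof -
      have "norm (U z) * norm (Gp z) \<le> (C1 * K) * (Bm + Bp)"
        using Bp(2)[OF that] Ub[OF that] Bm(1) Bp(1) C1 K by (intro mult_mono) auto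
      then have "norm (U z) * norm (Gp z) \<le> (Bm + Bp) * (C1 * K)" by (simp only: mult.commute)
      then show ?thesis using norm_matrix_mult_le[of "U z" "Gp z"] prod_bd order_trans by blast
    qed
    ultimately show ?thesis by blast
  qed
  with D show ?thesis by blast
qed

section \<open>Perturbed factors and the quadratic error\<close>

lemma matrix_scaleR_left: "(r *\<^sub>R A) ** B = r *\<^sub>R (A ** (B :: 'n::finite cmat))"
  by (simp add: vec_eq_iff matrix_mult_entry scaleR_sum_right)

lemma matrix_scaleR_right: "A ** (r *\<^sub>R B) = r *\<^sub>R (A ** (B :: 'n::finite cmat))"
  by (simp add: vec_eq_iff matrix_mult_entry scaleR_sum_right)

lemma Lam_identities:
  assumes "bfun z \<noteq> 0"
  shows "Lam_plus_inv k z ** Lam k z = Lam_minus k z" "Lam k z ** Lam_minus_inv k z = Lam_plus k z"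
    "Lam_minus k z ** Lam_minus_inv k z = mat 1"
proof -
  have "(\<lambda>i. - max (k i) 0 + k i) = (\<lambda>i. min (k i) 0)" "(\<lambda>i. k i + - min (k i) 0) = (\<lambda>i. max (k i) 0)"
    "(\<lambda>i. min (k i) 0 + - min (k i) 0) = (\<lambda>i. 0)"
    by (auto simp: fun_eq_iff max_def min_def)
  then show "Lam_plus_inv k z ** Lam k z = Lam_minus k z" "Lam k z ** Lam_minus_inv k z = Lam_plus k z"
    "Lam_minus k z ** Lam_minus_inv k z = mat 1"
    unfolding Lam_plus_inv_def Lam_def Lam_minus_def Lam_plus_def Lam_minus_inv_def diag_b_mult[OF assms]
    by (simp_all only: diag_b_zero)
qed

text \<open>The bilinear term is the only one that the boundary value problem does not cancel.\<close>
lemma perturbed_product: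
  fixes A B X Y :: "'n::finite cmat"
  assumes z: "bfun z \<noteq> 0"
  shows "(A + e *\<^sub>R (X ** Lam_plus_inv k z)) ** Lam k z ** (B + e *\<^sub>R (Lam_minus_inv k z ** Y))
    = A ** Lam k z ** B + e *\<^sub>R (X ** Lam_minus k z ** B + A ** Lam_plus k z ** Y) + e\<^sup>2 *\<^sub>R (X ** Y)"
proof -
  note i = Lam_identities[OF z, of k]
  have 1: "X ** Lam_plus_inv k z ** Lam k z = X ** Lam_minus k z"
    by (simp only: matrix_mul_assoc[symmetric] i)
  have 2: "A ** Lam k z ** (Lam_minus_inv k z ** Y) = A ** Lam_plus k z ** Y"
    by (simp only: matrix_mul_assoc[symmetric]) (simp only: matrix_mul_assoc[of "Lam k z"] i)
  have 3: "X ** Lam_minus k z ** (Lam_minus_inv k z ** Y) = X ** Y"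
    by (simp only: matrix_mul_assoc[symmetric]) (simp only: matrix_mul_assoc[of "Lam_minus k z"] i matrix_mul_lid)
  have "(A + e *\<^sub>R (X ** Lam_plus_inv k z)) ** Lam k z ** (B + e *\<^sub>R (Lam_minus_inv k z ** Y))
    = (A ** Lam k z ** B + e *\<^sub>R (X ** Lam_minus k z ** B)) + (e *\<^sub>R (A ** Lam_plus k z ** Y) + e *\<^sub>R (e *\<^sub>R (X ** Y)))"
    by (simp only: matrix_add_ldistrib matrix_add_right_distrib matrix_scaleR_left matrix_scaleR_right scaleR_add_right 1 2 3)
  then show ?thesis by (simp add: scaleR_add_right power2_eq_square)
qed

text \<open>The pointwise perturbation result becomes uniform on the closed half-plane because
  \<open>B\<close> bounds all inverses and \<open>Q\<close> all perturbations; the new inverses are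
  bounded by \<open>2 * B\<close>.\<close>

lemma perturbed_factor:
  fixes F R :: "complex \<Rightarrow> 'n::finite cmat"
  assumes F: "cont_bdd_analytic U C F" and R: "cont_bdd_analytic U C R" and UC: "U \<subseteq> C"
    and inv: "\<And>z. z \<in> C \<Longrightarrow> invertible (F z)" and B: "\<And>z. z \<in> C \<Longrightarrow> norm (matrix_inv (F z)) \<le> B"
    and Q: "\<And>z. z \<in> C \<Longrightarrow> norm (R z) \<le> Q" and e: "0 < e" "real CARD('n) ^ 6 * B * (e * Q) \<le> 1 / 2"
  shows "cont_bdd_analytic U C (\<lambda>z. F z + e *\<^sub>R R z)" "\<forall>z\<in>C. invertible (F z + e *\<^sub>R R z)"
    "cont_bdd_analytic U C (\<lambda>z. matrix_inv (F z + e *\<^sub>R R z))"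
    "bounded ((\<lambda>z. matrix_inv (F z + e *\<^sub>R R z)) ` C)"
proof -
  show 1: "cont_bdd_analytic U C (\<lambda>z. F z + e *\<^sub>R R z)" by (rule cont_bdd_analytic_add_scaleR[OF F R])
  have p: "invertible (F z + e *\<^sub>R R z) \<and> norm (matrix_inv (F z + e *\<^sub>R R z)) \<le> 2 * B" if z: "z \<in> C" for z
  proof -
    have "norm (matrix_inv (F z)) * norm (e *\<^sub>R R z) \<le> B * (e * Q)"
      using B[OF z] Q[OF z] e(1) order_trans[OF norm_ge_zero B[OF z]] by (intro mult_mono) auto
    then have "real CARD('n) ^ 6 * norm (matrix_inv (F z)) * norm (e *\<^sub>R R z) \<le> real CARD('n) ^ 6 * B * (e * Q)"
      unfolding mult.assoc[of "real CARD('n) ^ 6"] by (intro mult_left_mono) auto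
    with e(2) have "real CARD('n) ^ 6 * norm (matrix_inv (F z)) * norm (e *\<^sub>R R z) \<le> 1 / 2" by linarith
    from invertible_perturbation[OF inv[OF z] this] B[OF z] show ?thesis by linarith
  qed
  then show 2: "\<forall>z\<in>C. invertible (F z + e *\<^sub>R R z)" by blast
  show 3: "bounded ((\<lambda>z. matrix_inv (F z + e *\<^sub>R R z)) ` C)" unfolding bounded_iff using p by blast
  show "cont_bdd_analytic U C (\<lambda>z. matrix_inv (F z + e *\<^sub>R R z))"
    using 2 by (intro cont_bdd_analytic_matrix_inv[OF 1 UC _ 3]) simp
qed

theorem theorem1:
  fixes \<kappa> :: "'n::{finite,linorder} \<Rightarrow> int"
    and \<mu> \<epsilon>0 :: real
    and G0 :: "real \<Rightarrow> 'n cmat"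
    and Gm Gp :: "complex \<Rightarrow> 'n cmat"
    and N :: "real \<Rightarrow> real \<Rightarrow> 'n cmat"
    and M :: "real \<Rightarrow> real \<Rightarrow> 'n cmat"
  assumes mu: "0 < \<mu>" "\<mu> < 1"
    and eps0: "0 < \<epsilon>0"
    and G0: "inv_hoelder \<mu> G0"
    and fact: "right_factorization G0 Gm Gp \<kappa>"
    and Nbdd: "\<exists>K. \<forall>\<epsilon>\<in>{0<..<\<epsilon>0}. hoelder_bounded \<mu> K (N \<epsilon>)"
    and M_def: "\<And>\<epsilon> x. M \<epsilon> x = matrix_inv (Gm (of_real x)) ** N \<epsilon> x ** matrix_inv (Gp (of_real x))"
  shows
    "(\<forall>\<epsilon>\<in>{0<..<\<epsilon>0}.
        (\<exists>N1m N1p. solves_bvp \<kappa> Gm Gp (N \<epsilon>) N1m N1p) \<longleftrightarrow>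
        (cond_a \<kappa> (M \<epsilon>) \<and> cond_b \<kappa> (M \<epsilon>) \<and> cond_c \<kappa> (M \<epsilon>)))
     \<and>
     ((\<forall>\<epsilon>\<in>{0<..<\<epsilon>0}. cond_a \<kappa> (M \<epsilon>) \<and> cond_b \<kappa> (M \<epsilon>) \<and> cond_c \<kappa> (M \<epsilon>)) \<longrightarrow>
      (\<exists>N1m N1p.
         (\<forall>\<epsilon>\<in>{0<..<\<epsilon>0}. solves_bvp \<kappa> Gm Gp (N \<epsilon>) (N1m \<epsilon>) (N1p \<epsilon>)) \<and>
         (\<exists>K. \<forall>\<epsilon>\<in>{0<..<\<epsilon>0}. (\<forall>z\<in>lower_cl. norm (N1m \<epsilon> z) \<le> K) \<and> (\<forall>z\<in>upper_cl. norm (N1p \<epsilon> z) \<le> K)) \<and>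
         (let Fm = (\<lambda>\<epsilon> z. Gm z + \<epsilon> *\<^sub>R (N1m \<epsilon> z ** Lam_plus_inv \<kappa> z));
              Fp = (\<lambda>\<epsilon> z. Gp z + \<epsilon> *\<^sub>R (Lam_minus_inv \<kappa> z ** N1p \<epsilon> z))
          in \<exists>\<epsilon>1>0. \<epsilon>1 \<le> \<epsilon>0 \<and>
             (\<forall>\<epsilon>\<in>{0<..<\<epsilon>1}.
                minus_fun (Fm \<epsilon>) \<and> (\<forall>z\<in>lower_cl. invertible (Fm \<epsilon> z)) \<and>
                  bounded ((\<lambda>z. matrix_inv (Fm \<epsilon> z)) ` lower_cl) \<and>
                plus_fun (Fp \<epsilon>) \<and> (\<forall>z\<in>upper_cl. invertible (Fp \<epsilon> z)) \<and>
                  bounded ((\<lambda>z. matrix_inv (Fp \<epsilon> z)) ` upper_cl) \<and>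
                right_factorization
                  (\<lambda>x. Fm \<epsilon> (of_real x) ** Lam \<kappa> (of_real x) ** Fp \<epsilon> (of_real x))
                  (Fm \<epsilon>) (Fp \<epsilon>) \<kappa>) \<and>
             (\<exists>C. \<forall>\<epsilon>\<in>{0<..<\<epsilon>1}. \<forall>x::real.
                norm (G0 x + \<epsilon> *\<^sub>R N \<epsilon> x
                      - Fm \<epsilon> (of_real x) ** Lam \<kappa> (of_real x) ** Fp \<epsilon> (of_real x))
                \<le> C * \<epsilon>\<^sup>2))))"
proof -
  have Gm: "minus_factor Gm" and Gp: "plus_factor Gp" and ord: "\<forall>i j. i \<le> j \<longrightarrow> \<kappa> j \<le> \<kappa> i"
    and G0_eq: "\<And>x::real. G0 x = Gm (of_real x) ** Lam \<kappa> (of_real x) ** Gp (of_real x)"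
    using fact by (auto simp: right_factorization_def)
  have mu1: "\<mu> \<le> 1" using mu by simp
  have half: "0 < \<mu> / 2" "\<mu> / 2 \<le> 1" using mu by auto
  obtain KG where KG: "hoelder_bounded \<mu> KG (\<lambda>x. matrix_inv (G0 x))"
    using G0 by (auto simp: inv_hoelder_def hoelder_def)
  obtain L1 where L1: "\<And>i j. circle_hoelder (\<mu> / 2) L1 (\<lambda>t. matrix_inv (Gm (cayley_inv t)) $ i $ j)"
    using minus_factor_inverse_hoelder[OF mu(1) mu1 Gm Gp G0_eq KG] by blast
  obtain L2 where L2: "\<And>i j. circle_hoelder (\<mu> / 2) L2 (\<lambda>t. matrix_inv (Gp (cayley_inv t)) $ i $ j)"
    using plus_factor_inverse_hoelder[OF mu(1) mu1 Gm Gp G0_eq KG] by blast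
  obtain C1 where C1: "0 \<le> C1" and M_hoelder: "\<And>K N l j. hoelder_bounded \<mu> K N \<Longrightarrow> circle_hoelder (\<mu> / 2) (C1 * K)
    (\<lambda>t. (matrix_inv (Gm (of_real (Re (cayley_inv t)))) ** N (Re (cayley_inv t)) ** matrix_inv (Gp (of_real (Re (cayley_inv t))))) $ l $ j)"
    using conjugated_hoelder[OF mu(1) mu1, of L1 "\<lambda>z. matrix_inv (Gm z)" L2 "\<lambda>z. matrix_inv (Gp z)", OF L1 L2] by blast
  obtain C2 where C2: "0 \<le> C2" and solve: "\<And>K N. 0 \<le> K \<Longrightarrow> (\<And>l j. circle_hoelder (\<mu> / 2) K
        (\<lambda>t. (matrix_inv (Gm (of_real (Re (cayley_inv t)))) ** N (Re (cayley_inv t)) ** matrix_inv (Gp (of_real (Re (cayley_inv t))))) $ l $ j)) \<Longrightarrow>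
      (\<And>l j. moments_vanish (nat (\<kappa> l)) (nat (- \<kappa> j))
        (\<lambda>t. (matrix_inv (Gm (of_real (Re (cayley_inv t)))) ** N (Re (cayley_inv t)) ** matrix_inv (Gp (of_real (Re (cayley_inv t))))) $ l $ j)) \<Longrightarrow>
      (\<exists>N1m N1p. solves_bvp \<kappa> Gm Gp N N1m N1p \<and>
        (\<forall>z\<in>lower_cl. norm (N1m z) \<le> C2 * K) \<and> (\<forall>z\<in>upper_cl. norm (N1p z) \<le> C2 * K))"
    using bvp_sufficient[OF half Gm Gp, of \<kappa>] by blast
  obtain K where K: "\<And>\<epsilon>. \<epsilon> \<in> {0<..<\<epsilon>0} \<Longrightarrow> hoelder_bounded \<mu> K (N \<epsilon>)" using Nbdd by blast
  have K0: "0 \<le> K"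
  proof -
    have "\<epsilon>0 / 2 \<in> {0<..<\<epsilon>0}" using eps0 by simp
    from K[OF this] have "norm (N (\<epsilon>0 / 2) 0) \<le> K" by (simp add: hoelder_bounded_def)
    then show ?thesis using norm_ge_zero order_trans by blast
  qed
  \<comment> \<open>\<open>C1\<close> turns the Hoelder constant of \<open>N \<epsilon>\<close> into
    one for \<open>M \<epsilon>\<close>, and \<open>C2\<close> turns that into a bound for the
    solutions; none of them depends on \<epsilon>.\<close>
  define K1 where "K1 = C2 * (C1 * K)"
  have K1: "0 \<le> K1" using C1 C2 K0 by (simp add: K1_def)
  have conds: "cond_a \<kappa> (M \<epsilon>) \<and> cond_b \<kappa> (M \<epsilon>) \<and> cond_c \<kappa> (M \<epsilon>) \<longleftrightarrow>
      (\<forall>l j. moments_vanish (nat (\<kappa> l)) (nat (- \<kappa> j)) (\<lambda>t. M \<epsilon> (Re (cayley_inv t)) $ l $ j))"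
    if e: "\<epsilon> \<in> {0<..<\<epsilon>0}" for \<epsilon>
  proof (rule conditions_iff_moments)
    show "circle_fun (\<lambda>t. M \<epsilon> (Re (cayley_inv t)) $ l $ j)" for l j
      unfolding M_def by (rule circle_hoelder_circle_fun[OF M_hoelder[OF K[OF e]] half(1)])
  qed
  have suff: "\<exists>N1m N1p. solves_bvp \<kappa> Gm Gp (N \<epsilon>) N1m N1p \<and>
        (\<forall>z\<in>lower_cl. norm (N1m z) \<le> K1) \<and> (\<forall>z\<in>upper_cl. norm (N1p z) \<le> K1)"
    if e: "\<epsilon> \<in> {0<..<\<epsilon>0}" and c: "cond_a \<kappa> (M \<epsilon>) \<and> cond_b \<kappa> (M \<epsilon>) \<and> cond_c \<kappa> (M \<epsilon>)" for \<epsilon>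
    unfolding K1_def
  proof (rule solve[OF _ M_hoelder[OF K[OF e]]])
    show "0 \<le> C1 * K" using C1 K0 by simp
    show "moments_vanish (nat (\<kappa> l)) (nat (- \<kappa> j))
        (\<lambda>t. (matrix_inv (Gm (of_real (Re (cayley_inv t)))) ** N \<epsilon> (Re (cayley_inv t)) ** matrix_inv (Gp (of_real (Re (cayley_inv t))))) $ l $ j)" for l j
      using c unfolding conds[OF e] M_def by simp
  qed
  have iff: "(\<exists>N1m N1p. solves_bvp \<kappa> Gm Gp (N \<epsilon>) N1m N1p) \<longleftrightarrow>
        (cond_a \<kappa> (M \<epsilon>) \<and> cond_b \<kappa> (M \<epsilon>) \<and> cond_c \<kappa> (M \<epsilon>))"
    if e: "\<epsilon> \<in> {0<..<\<epsilon>0}" for \<epsilon>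
  proof
    assume "\<exists>N1m N1p. solves_bvp \<kappa> Gm Gp (N \<epsilon>) N1m N1p"
    then obtain N1m N1p where s: "solves_bvp \<kappa> Gm Gp (N \<epsilon>) N1m N1p" by blast
    show "cond_a \<kappa> (M \<epsilon>) \<and> cond_b \<kappa> (M \<epsilon>) \<and> cond_c \<kappa> (M \<epsilon>)"
      unfolding conds[OF e] M_def by (intro allI bvp_necessary[OF Gm Gp s])
  next
    assume "cond_a \<kappa> (M \<epsilon>) \<and> cond_b \<kappa> (M \<epsilon>) \<and> cond_c \<kappa> (M \<epsilon>)"
    from suff[OF e this] show "\<exists>N1m N1p. solves_bvp \<kappa> Gm Gp (N \<epsilon>) N1m N1p" by blast
  qed
  show ?thesis (is "_ \<and> (_ \<longrightarrow> ?C)")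
  proof (intro conjI impI ballI iff, assumption)
    assume all: "\<forall>\<epsilon>\<in>{0<..<\<epsilon>0}. cond_a \<kappa> (M \<epsilon>) \<and> cond_b \<kappa> (M \<epsilon>) \<and> cond_c \<kappa> (M \<epsilon>)"
    define Sol where "Sol \<epsilon> X Y \<longleftrightarrow> solves_bvp \<kappa> Gm Gp (N \<epsilon>) X Y \<and>
        (\<forall>z\<in>lower_cl. norm (X z) \<le> K1) \<and> (\<forall>z\<in>upper_cl. norm (Y z) \<le> K1)" for \<epsilon> X Y
    \<comment> \<open>A pair is selected for each \<epsilon>, since the two halves of a solution
      belong together.\<close>
    have "\<forall>\<epsilon>\<in>{0<..<\<epsilon>0}. \<exists>P. Sol \<epsilon> (fst P) (snd P)"
    proof
      fix \<epsilon> assume e: "\<epsilon> \<in> {0<..<\<epsilon>0}"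
      from suff[OF e] all e obtain X Y where "Sol \<epsilon> X Y" unfolding Sol_def by blast
      then show "\<exists>P. Sol \<epsilon> (fst P) (snd P)" by (intro exI[of _ "(X, Y)"]) simp
    qed
    from bchoice[OF this] obtain P where P: "\<And>\<epsilon>. \<epsilon> \<in> {0<..<\<epsilon>0} \<Longrightarrow> Sol \<epsilon> (fst (P \<epsilon>)) (snd (P \<epsilon>))" by blast
    define N1m where "N1m \<epsilon> = fst (P \<epsilon>)" for \<epsilon>
    define N1p where "N1p \<epsilon> = snd (P \<epsilon>)" for \<epsilon>
    have sol: "solves_bvp \<kappa> Gm Gp (N \<epsilon>) (N1m \<epsilon>) (N1p \<epsilon>)"
      and mb: "\<And>z. z \<in> lower_cl \<Longrightarrow> norm (N1m \<epsilon> z) \<le> K1" and pb: "\<And>z. z \<in> upper_cl \<Longrightarrow> norm (N1p \<epsilon> z) \<le> K1"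
      if "\<epsilon> \<in> {0<..<\<epsilon>0}" for \<epsilon>
      using P[OF that] unfolding Sol_def N1m_def N1p_def by auto
    let ?n = "real CARD('n)"
    define Rm where "Rm \<epsilon> z = N1m \<epsilon> z ** Lam_plus_inv \<kappa> z" for \<epsilon> z
    define Rp where "Rp \<epsilon> z = Lam_minus_inv \<kappa> z ** N1p \<epsilon> z" for \<epsilon> z
    have bds: "bounded ((\<lambda>z. matrix_inv (Gm z)) ` lower_cl)" "bounded ((\<lambda>z. matrix_inv (Gp z)) ` upper_cl)"
      "bounded (Lam_plus_inv \<kappa> ` lower_cl)" "bounded (Lam_minus_inv \<kappa> ` upper_cl)"
      using Gm Gp Lam_plus_inv_minus_fun[of \<kappa>] Lam_minus_inv_plus_fun[of \<kappa>]
      unfolding minus_factor_def plus_factor_def minus_fun_def plus_fun_def cont_bdd_analytic_def by simp_all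
    obtain B1 where B1: "0 < B1" "\<And>z. z \<in> lower_cl \<Longrightarrow> norm (matrix_inv (Gm z)) \<le> B1" using bds(1) unfolding bounded_pos by auto
    obtain B2 where B2: "0 < B2" "\<And>z. z \<in> upper_cl \<Longrightarrow> norm (matrix_inv (Gp z)) \<le> B2" using bds(2) unfolding bounded_pos by auto
    obtain B3 where B3: "0 < B3" "\<And>z. z \<in> lower_cl \<Longrightarrow> norm (Lam_plus_inv \<kappa> z) \<le> B3" using bds(3) unfolding bounded_pos by auto
    obtain B4 where B4: "0 < B4" "\<And>z. z \<in> upper_cl \<Longrightarrow> norm (Lam_minus_inv \<kappa> z) \<le> B4" using bds(4) unfolding bounded_pos by auto
    define B where "B = max B1 B2"
    define Q where "Q = ?n ^ 3 * K1 * max B3 B4"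
    have B0: "0 \<le> B" using B1 by (simp add: B_def)
    have Q0: "0 \<le> Q" unfolding Q_def using K1 B3 by (intro mult_nonneg_nonneg) auto
    have Rmb: "norm (Rm \<epsilon> z) \<le> Q" if "\<epsilon> \<in> {0<..<\<epsilon>0}" "z \<in> lower_cl" for \<epsilon> z
    proof -
      have "norm (Rm \<epsilon> z) \<le> ?n ^ 3 * norm (N1m \<epsilon> z) * norm (Lam_plus_inv \<kappa> z)"
        unfolding Rm_def by (rule norm_matrix_mult_le)
      also have "\<dots> \<le> Q"
        unfolding Q_def using mb[OF that] B3(2)[OF that(2)] K1 by (intro mult_mono mult_left_mono) auto
      finally show ?thesis .
    qed
    have Rpb: "norm (Rp \<epsilon> z) \<le> Q" if "\<epsilon> \<in> {0<..<\<epsilon>0}" "z \<in> upper_cl" for \<epsilon> z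
    proof -
      have "norm (Rp \<epsilon> z) \<le> ?n ^ 3 * norm (Lam_minus_inv \<kappa> z) * norm (N1p \<epsilon> z)"
        unfolding Rp_def by (rule norm_matrix_mult_le)
      also have "\<dots> = ?n ^ 3 * norm (N1p \<epsilon> z) * norm (Lam_minus_inv \<kappa> z)" by simp
      also have "\<dots> \<le> Q"
        unfolding Q_def using pb[OF that] B4(2)[OF that(2)] K1 by (intro mult_mono mult_left_mono) auto
      finally show ?thesis .
    qed
    have Rma: "cont_bdd_analytic lower_hp lower_cl (Rm \<epsilon>)" and Rpa: "cont_bdd_analytic upper_hp upper_cl (Rp \<epsilon>)"
      if "\<epsilon> \<in> {0<..<\<epsilon>0}" for \<epsilon>
      unfolding Rm_def[abs_def] Rp_def[abs_def]
      using sol[OF that] Lam_plus_inv_minus_fun[of \<kappa>] Lam_minus_inv_plus_fun[of \<kappa>]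
      by (auto simp: solves_bvp_def minus_fun_def plus_fun_def intro!: cont_bdd_analytic_mult)
    define p where "p = ?n ^ 6 * B * Q"
    have p: "0 \<le> p" using B0 Q0 by (simp add: p_def)
    \<comment> \<open>\<open>p + 1\<close> keeps the denominator positive when \<open>p = 0\<close>,
      and \<open>p * \<epsilon>\<close> stays below the threshold 1/2 of
      \<open>perturbed_factor\<close>.\<close>
    define \<epsilon>1 where "\<epsilon>1 = min \<epsilon>0 (1 / (2 * (p + 1)))"
    have e1: "0 < \<epsilon>1" "\<epsilon>1 \<le> \<epsilon>0" using eps0 p by (auto simp: \<epsilon>1_def)
    have small: "?n ^ 6 * B * (\<epsilon> * Q) \<le> 1 / 2" if e: "\<epsilon> \<in> {0<..<\<epsilon>1}" for \<epsilon>
    proof -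
      have "p * \<epsilon> \<le> p * (1 / (2 * (p + 1)))" using e p by (intro mult_left_mono) (auto simp: \<epsilon>1_def)
      also have "\<dots> \<le> 1 / 2" using p by (simp add: divide_simps)
      finally show ?thesis by (simp add: p_def mult_ac)
    qed
    have sub: "lower_hp \<subseteq> lower_cl" "upper_hp \<subseteq> upper_cl"
      by (auto simp: lower_hp_def lower_cl_def upper_hp_def upper_cl_def)
    define Fm where "Fm \<epsilon> z = Gm z + \<epsilon> *\<^sub>R Rm \<epsilon> z" for \<epsilon> z
    define Fp where "Fp \<epsilon> z = Gp z + \<epsilon> *\<^sub>R Rp \<epsilon> z" for \<epsilon> z
    have fac: "minus_fun (Fm \<epsilon>) \<and> (\<forall>z\<in>lower_cl. invertible (Fm \<epsilon> z)) \<and>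
          bounded ((\<lambda>z. matrix_inv (Fm \<epsilon> z)) ` lower_cl) \<and>
        plus_fun (Fp \<epsilon>) \<and> (\<forall>z\<in>upper_cl. invertible (Fp \<epsilon> z)) \<and>
          bounded ((\<lambda>z. matrix_inv (Fp \<epsilon> z)) ` upper_cl) \<and>
        right_factorization
          (\<lambda>x. Fm \<epsilon> (of_real x) ** Lam \<kappa> (of_real x) ** Fp \<epsilon> (of_real x))
          (Fm \<epsilon>) (Fp \<epsilon>) \<kappa>"
      if e: "\<epsilon> \<in> {0<..<\<epsilon>1}" for \<epsilon>
    proof -
      have e0: "\<epsilon> \<in> {0<..<\<epsilon>0}" "0 < \<epsilon>" using e e1 by auto
      have A: "cont_bdd_analytic lower_hp lower_cl Gm" "\<And>z. z \<in> lower_cl \<Longrightarrow> invertible (Gm z)"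
        "\<And>z. z \<in> lower_cl \<Longrightarrow> norm (matrix_inv (Gm z)) \<le> B"
        using Gm B1(2) by (auto simp: minus_factor_def minus_fun_def B_def intro: order_trans[OF _ max.cobounded1])
      have A': "cont_bdd_analytic upper_hp upper_cl Gp" "\<And>z. z \<in> upper_cl \<Longrightarrow> invertible (Gp z)"
        "\<And>z. z \<in> upper_cl \<Longrightarrow> norm (matrix_inv (Gp z)) \<le> B"
        using Gp B2(2) by (auto simp: plus_factor_def plus_fun_def B_def intro: order_trans[OF _ max.cobounded2])
      note m = perturbed_factor[OF A(1) Rma[OF e0(1)] sub(1) A(2,3) Rmb[OF e0(1)] e0(2) small[OF e], folded Fm_def minus_fun_def]
      note q = perturbed_factor[OF A'(1) Rpa[OF e0(1)] sub(2) A'(2,3) Rpb[OF e0(1)] e0(2) small[OF e], folded Fp_def plus_fun_def]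
      \<comment> \<open>The diagonal matrix between the new factors is still
        \<open>Lam \<kappa>\<close>, so the partial indices are those of \<open>G0\<close>.\<close>
      show ?thesis
        unfolding right_factorization_def minus_factor_def plus_factor_def
        using m q ord by auto
    qed
    have err: "norm (G0 x + \<epsilon> *\<^sub>R N \<epsilon> x - Fm \<epsilon> (of_real x) ** Lam \<kappa> (of_real x) ** Fp \<epsilon> (of_real x))
        \<le> (?n ^ 3 * K1 * K1) * \<epsilon>\<^sup>2"
      if e: "\<epsilon> \<in> {0<..<\<epsilon>1}" for \<epsilon> and x :: real
    proof -
      have e0: "\<epsilon> \<in> {0<..<\<epsilon>0}" using e e1 by auto
      let ?x = "complex_of_real x"
      have N: "N1m \<epsilon> ?x ** Lam_minus \<kappa> ?x ** Gp ?x + Gm ?x ** Lam_plus \<kappa> ?x ** N1p \<epsilon> ?x = N \<epsilon> x"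
        using sol[OF e0] by (simp add: solves_bvp_def)
      \<comment> \<open>The boundary value problem makes the coefficient of \<epsilon> equal to
        \<open>N \<epsilon> x\<close>, so the error is exactly the term with
        \<open>\<epsilon>\<^sup>2\<close>.\<close>
      have "Fm \<epsilon> ?x ** Lam \<kappa> ?x ** Fp \<epsilon> ?x = G0 x + \<epsilon> *\<^sub>R N \<epsilon> x + \<epsilon>\<^sup>2 *\<^sub>R (N1m \<epsilon> ?x ** N1p \<epsilon> ?x)"
        unfolding Fm_def Fp_def Rm_def Rp_def perturbed_product[OF bfun_real_nonzero] N G0_eq ..
      then have "norm (G0 x + \<epsilon> *\<^sub>R N \<epsilon> x - Fm \<epsilon> ?x ** Lam \<kappa> ?x ** Fp \<epsilon> ?x) = \<epsilon>\<^sup>2 * norm (N1m \<epsilon> ?x ** N1p \<epsilon> ?x)"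
        by simp
      also have "\<dots> \<le> \<epsilon>\<^sup>2 * (?n ^ 3 * norm (N1m \<epsilon> ?x) * norm (N1p \<epsilon> ?x))"
        by (intro mult_left_mono norm_matrix_mult_le) auto
      also have "\<dots> \<le> \<epsilon>\<^sup>2 * (?n ^ 3 * K1 * K1)"
        using mb[OF e0, of ?x] pb[OF e0, of ?x] K1
        by (intro mult_left_mono mult_mono) (auto simp: lower_cl_def upper_cl_def)
      finally show ?thesis by (simp only: mult.commute)
    qed
    have F_eq: "(\<lambda>\<epsilon> z. Gm z + \<epsilon> *\<^sub>R (N1m \<epsilon> z ** Lam_plus_inv \<kappa> z)) = Fm"
      "(\<lambda>\<epsilon> z. Gp z + \<epsilon> *\<^sub>R (Lam_minus_inv \<kappa> z ** N1p \<epsilon> z)) = Fp"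
      by (simp_all add: fun_eq_iff Fm_def Fp_def Rm_def Rp_def)
    show ?C
    proof (rule exI[of _ N1m], rule exI[of _ N1p], unfold F_eq Let_def, intro conjI)
      show "\<forall>\<epsilon>\<in>{0<..<\<epsilon>0}. solves_bvp \<kappa> Gm Gp (N \<epsilon>) (N1m \<epsilon>) (N1p \<epsilon>)" using sol by blast
    next
      show "\<exists>K. \<forall>\<epsilon>\<in>{0<..<\<epsilon>0}. (\<forall>z\<in>lower_cl. norm (N1m \<epsilon> z) \<le> K) \<and> (\<forall>z\<in>upper_cl. norm (N1p \<epsilon> z) \<le> K)"
        using mb pb by blast
    qed (use e1 fac err in blast)
  qed
qed

end
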